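(* Let $R\to A$ be a homomorphism of associative rings, and let $(\mathcal F,\mathcal C)$ be a hereditary complete cotorsion pair in the category of left $R$-modules. Assume that the left $R$-module $A$ belongs to $\mathcal F$, and that for every left $R$-module $F\in\mathcal F$ the underlying left $R$-module of $\operatorname{Hom}_R(A,F)$ also belongs to $\mathcal F$. Assume further that the class $\mathcal F$ is closed under countable products in the category of left $R$-modules. Let $\mathcal F_A$ be the class of all left $A$-modules whose underlying left $R$-modules belong to $\mathcal F$, and put $\mathcal C_A=\mathrm{Cof}_\omega(\operatorname{Hom}_R(A,\mathcal C))^\oplus$, where $\omega$ is the first infinite ordinal. Then $(\mathcal F_A,\mathcal C_A)$ is a hereditary complete cotorsion pair in the category of left $A$-modules.
   Context: Rings are associative and unital, ring homomorphisms preserve the unit, and modules are unital. For a left $R$-module $M$, $\operatorname{Hom}_R(A,M)$ is a left $A$-module via the right multiplication of $A$ on itself (the module coinduced from $M$); for a class $\mathcal T$ of left $R$-modules, $\operatorname{Hom}_R(A,\mathcal T)$ denotes the class of all left $A$-modules of the form $\operatorname{Hom}_R(A,T)$, $T\in\mathcal T$. For a class $\mathcal X$ of left modules over a ring $S$: $\mathcal X^{\perp_1}=\{Y\mid \operatorname{Ext}^1_S(X,Y)=0\ \forall X\in\mathcal X\}$, ${}^{\perp_1}\mathcal X=\{Y\mid\operatorname{Ext}^1_S(Y,X)=0\ \forall X\in\mathcal X\}$, and $\mathcal X^\oplus$ is the class of all direct summands of modules from $\mathcal X$. A cotorsion pair is a pair of classes $(\mathcal F,\mathcal C)$ with $\mathcal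 C=\mathcal F^{\perp_1}$ and $\mathcal F={}^{\perp_1}\mathcal C$. It is complete if for every module $M$ there are short exact sequences $0\to C'\to F\to M\to0$ and $0\to M\to C\to F'\to0$ with $F,F'\in\mathcal F$ and $C,C'\in\mathcal C$. It is hereditary if $\operatorname{Ext}^n(F,C)=0$ for all $F\in\mathcal F$, $C\in\mathcal C$, $n\ge1$ (equivalently, $\mathcal F$ is closed under kernels of surjective morphisms). For an ordinal $\alpha$, an $\alpha$-cofiltration on a module $N$ consists of modules $G_iN$, $0\le i\le\alpha$, and morphisms $G_iN\to G_jN$ for $0\le j<i\le\alpha$, compatible with compositions, such that $G_0N=0$, $G_\alpha N=N$, the map $G_iN\to\varprojlim_{j<i}G_jN$ is an isomorphism for every limit ordinal $i\le\alpha$, and $G_{i+1}N\to G_iN$ is surjective for all $0\le i<\alpha$. For a class of modules $\mathcal T$, $\mathrm{Cof}_\alpha(\mathcal T)$ is the class of all modules $N$ admitting an $\alpha$-cofiltration such that $\ker(G_{i+1}N\to G_iN)$ is isomorphic to a module from $\mathcal T$ for all $0\le i<\alpha$. *)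

theory Defs
  imports
    "HOL-Algebra.Module"
    "HOL-Algebra.Coset"
    "HOL-Algebra.Elementary_Groups"
    "HOL-Library.FuncSet"
    "HOL-Library.Equipollence"
    "HOL-Library.Extended_Nat"
begin

section \<open>Left modules over an associative unital ring\<close>

text \<open>
  The library locale \<open>module\<close> requires a commutative ring of scalars. We reuse its record type;
  the fields \<open>mult\<close> and \<open>one\<close> of a module record carry no information.
\<close>

locale left_module = R?: ring R + M?: abelian_group M
  for R (structure) and M (structure) +
  assumes smult_closed:
      "\<lbrakk>r \<in> carrier R; x \<in> carrier M\<rbrakk> \<Longrightarrow> r \<odot>\<^bsub>M\<^esub> x \<in> carrier M"
    and smult_l_distr:
      "\<lbrakk>r \<in> carrier R; s \<in> carrier R; x \<in> carrier M\<rbrakk> \<Longrightarrow>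
        (r \<oplus>\<^bsub>R\<^esub> s) \<odot>\<^bsub>M\<^esub> x = r \<odot>\<^bsub>M\<^esub> x \<oplus>\<^bsub>M\<^esub> s \<odot>\<^bsub>M\<^esub> x"
    and smult_r_distr:
      "\<lbrakk>r \<in> carrier R; x \<in> carrier M; y \<in> carrier M\<rbrakk> \<Longrightarrow>
        r \<odot>\<^bsub>M\<^esub> (x \<oplus>\<^bsub>M\<^esub> y) = r \<odot>\<^bsub>M\<^esub> x \<oplus>\<^bsub>M\<^esub> r \<odot>\<^bsub>M\<^esub> y"
    and smult_assoc:
      "\<lbrakk>r \<in> carrier R; s \<in> carrier R; x \<in> carrier M\<rbrakk> \<Longrightarrow>
        (r \<otimes>\<^bsub>R\<^esub> s) \<odot>\<^bsub>M\<^esub> x = r \<odot>\<^bsub>M\<^esub> (s \<odot>\<^bsub>M\<^esub> x)"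
    and smult_unital:
      "x \<in> carrier M \<Longrightarrow> \<one>\<^bsub>R\<^esub> \<odot>\<^bsub>M\<^esub> x = x"

definition mod_hom :: "'s ring \<Rightarrow> ('s, 'm) module \<Rightarrow> ('s, 'n) module \<Rightarrow> ('m \<Rightarrow> 'n) set" where
  "mod_hom S M N = {h \<in> carrier M \<rightarrow> carrier N.
     (\<forall>x\<in>carrier M. \<forall>y\<in>carrier M. h (x \<oplus>\<^bsub>M\<^esub> y) = h x \<oplus>\<^bsub>N\<^esub> h y) \<and>
     (\<forall>r\<in>carrier S. \<forall>x\<in>carrier M. h (r \<odot>\<^bsub>M\<^esub> x) = r \<odot>\<^bsub>N\<^esub> h x)}"

definition mod_iso :: "'s ring \<Rightarrow> ('s, 'm) module \<Rightarrow> ('s, 'n) module \<Rightarrow> ('m \<Rightarrow> 'n) set" where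
  "mod_iso S M N = {h \<in> mod_hom S M N. bij_betw h (carrier M) (carrier N)}"

definition iso_to_member :: "'s ring \<Rightarrow> ('s, 'm) module \<Rightarrow> ('s, 'n) module set \<Rightarrow> bool" where
  "iso_to_member S M \<X> \<longleftrightarrow> (\<exists>N\<in>\<X>. mod_iso S M N \<noteq> {})"

definition mod_kernel :: "('s, 'm) module \<Rightarrow> ('s, 'n) module \<Rightarrow> ('m \<Rightarrow> 'n) \<Rightarrow> 'm set" where
  "mod_kernel M N h = {x \<in> carrier M. h x = \<zero>\<^bsub>N\<^esub>}"

definition short_exact ::
  "'s ring \<Rightarrow> ('s, 'l) module \<Rightarrow> ('s, 'm) module \<Rightarrow> ('s, 'n) module \<Rightarrow> ('l \<Rightarrow> 'm) \<Rightarrow> ('m \<Rightarrow> 'n) \<Rightarrow> bool"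
  where
  "short_exact S L M N i p \<longleftrightarrow>
     i \<in> mod_hom S L M \<and> p \<in> mod_hom S M N \<and>
     inj_on i (carrier L) \<and> i ` carrier L = mod_kernel M N p \<and> p ` carrier M = carrier N"

definition prod_module :: "'i set \<Rightarrow> ('i \<Rightarrow> ('s, 'm) module) \<Rightarrow> ('s, 'i \<Rightarrow> 'm) module" where
  "prod_module I M = \<lparr>carrier = (\<Pi>\<^sub>E i\<in>I. carrier (M i)), mult = undefined, one = undefined,
     zero = (\<lambda>i\<in>I. \<zero>\<^bsub>M i\<^esub>), add = (\<lambda>f g. \<lambda>i\<in>I. f i \<oplus>\<^bsub>M i\<^esub> g i),
     smult = (\<lambda>r f. \<lambda>i\<in>I. r \<odot>\<^bsub>M i\<^esub> f i)\<rparr>"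

definition sum_module :: "('s, 'm) module \<Rightarrow> ('s, 'n) module \<Rightarrow> ('s, 'm \<times> 'n) module" where
  "sum_module M N = \<lparr>carrier = carrier M \<times> carrier N, mult = undefined, one = undefined,
     zero = (\<zero>\<^bsub>M\<^esub>, \<zero>\<^bsub>N\<^esub>), add = (\<lambda>(x, y) (x', y'). (x \<oplus>\<^bsub>M\<^esub> x', y \<oplus>\<^bsub>N\<^esub> y')),
     smult = (\<lambda>r (x, y). (r \<odot>\<^bsub>M\<^esub> x, r \<odot>\<^bsub>N\<^esub> y))\<rparr>"

section \<open>The universe of modules\<close>

text \<open>
  HOL has no type of all modules, so \<open>the category of left modules\<close> means the modules whose
  carriers are small sets of a universe \<open>\<U>\<close> over some type \<open>'u\<close>. A family \<open>\<U>\<close> counts as a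
  universe for the rings \<open>R\<close> and \<open>A\<close> if smallness is inherited by sets of smaller or equal
  cardinality, \<open>R\<close> and \<open>A\<close> are small up to bijection, and, up to bijection, products of
  sequences of small sets and powers of small sets with exponent \<open>A\<close> are small. So the
  category has countable products and the coinduced modules, and enough projectives.
  Under \<open>module_universe_Grothendieck\<close>, this includes the usual reading, where \<open>UNIV :: 'u set\<close> has
  inaccessible cardinality and small means of smaller cardinality. By \<open>module_universe_exists\<close>,
  every \<open>R\<close> and \<open>A\<close> have such a \<open>\<U>\<close> in plain HOL, without an inaccessible cardinal.
\<close>

definition module_universe :: "'r ring \<Rightarrow> 'a ring \<Rightarrow> 'u set set \<Rightarrow> bool" where
  "module_universe R A \<U> \<longleftrightarrow>
     (\<forall>S\<in>\<U>. \<forall>T. T \<lesssim> S \<longrightarrow> T \<in> \<U>) \<and>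
     (\<exists>S\<in>\<U>. carrier R \<lesssim> S) \<and>
     (\<exists>S\<in>\<U>. carrier A \<lesssim> S) \<and>
     (\<forall>S :: nat \<Rightarrow> 'u set. (\<forall>n. S n \<in> \<U>) \<longrightarrow> (\<exists>T\<in>\<U>. (\<Pi>\<^sub>E n\<in>UNIV. S n) \<lesssim> T)) \<and>
     (\<forall>S\<in>\<U>. \<exists>T\<in>\<U>. (carrier A \<rightarrow>\<^sub>E S) \<lesssim> T)"

lemma small_copy:
  assumes "X \<prec> (UNIV :: 'u set)"
  shows "\<exists>T \<in> {S :: 'u set. S \<prec> (UNIV :: 'u set)}. X \<lesssim> T"
proof -
  obtain f :: "_ \<Rightarrow> 'u" where "inj_on f X"
    using assms by (auto simp: lesspoll_def lepoll_def)
  then have e: "f ` X \<approx> X" by (rule inj_on_image_eqpoll_self)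
  then have "f ` X \<prec> (UNIV :: 'u set)" using assms eq_lesspoll_trans by blast
  with e show ?thesis using eqpoll_sym eqpoll_imp_lepoll by blast
qed

lemma small_power:
  fixes S :: "'u set"
  assumes I: "I \<prec> (UNIV :: 'u set)" and S: "S \<prec> (UNIV :: 'u set)"
    and nat: "(UNIV :: nat set) \<prec> (UNIV :: 'u set)"
    and power: "\<And>(S :: 'u set) (T :: 'u set). \<lbrakk>S \<prec> (UNIV :: 'u set); T \<prec> (UNIV :: 'u set)\<rbrakk> \<Longrightarrow>
      (S \<rightarrow>\<^sub>E T) \<prec> (UNIV :: 'u set)"
  shows "(I \<rightarrow>\<^sub>E S) \<prec> (UNIV :: 'u set)"
proof (cases "S = {}")
  case True
  have "finite (I \<rightarrow>\<^sub>E S)"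
    by (auto simp: True finite_funcset_iff)
  moreover have "infinite (UNIV :: 'u set)"
    using nat infinite_le_lepoll lesspoll_imp_lepoll by blast
  ultimately show ?thesis by (rule finite_lesspoll_infinite[rotated])
next
  case False
  obtain J :: "'u set" where J: "J \<prec> (UNIV :: 'u set)" "I \<lesssim> J"
    using small_copy[OF I] by auto
  have "(I \<rightarrow>\<^sub>E S) \<lesssim> (J \<rightarrow>\<^sub>E S)" by (rule lepoll_funcset_left[OF False J(2)])
  then show ?thesis by (rule lesspoll_trans1[OF _ power[OF J(1) S]])
qed

lemma module_universe_Grothendieck:
  fixes R :: "'r ring" and A :: "'a ring"
  assumes R: "carrier R \<prec> (UNIV :: 'u set)" and A: "carrier A \<prec> (UNIV :: 'u set)"
    and nat: "(UNIV :: nat set) \<prec> (UNIV :: 'u set)"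
    and power: "\<And>(S :: 'u set) (T :: 'u set). \<lbrakk>S \<prec> (UNIV :: 'u set); T \<prec> (UNIV :: 'u set)\<rbrakk> \<Longrightarrow>
      (S \<rightarrow>\<^sub>E T) \<prec> (UNIV :: 'u set)"
    and union: "\<And>S :: nat \<Rightarrow> 'u set. (\<And>n. S n \<prec> (UNIV :: 'u set)) \<Longrightarrow>
      (\<Union>n. S n) \<prec> (UNIV :: 'u set)"
  shows "module_universe R A {S :: 'u set. S \<prec> (UNIV :: 'u set)}"
  unfolding module_universe_def
proof (intro conjI ballI allI impI)
  fix S T :: "'u set"
  assume "S \<in> {S :: 'u set. S \<prec> (UNIV :: 'u set)}" and "T \<lesssim> S"
  then show "T \<in> {S :: 'u set. S \<prec> (UNIV :: 'u set)}" by (simp add: lesspoll_trans1)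
next
  fix S :: "nat \<Rightarrow> 'u set"
  assume "\<forall>n. S n \<in> {S :: 'u set. S \<prec> (UNIV :: 'u set)}"
  then have "(\<Union>n. S n) \<prec> (UNIV :: 'u set)" by (intro union) simp
  then have "((UNIV :: nat set) \<rightarrow>\<^sub>E (\<Union>n. S n)) \<prec> (UNIV :: 'u set)"
    by (rule small_power[OF nat _ nat power])
  moreover have "(\<Pi>\<^sub>E n\<in>UNIV. S n) \<subseteq> (UNIV \<rightarrow>\<^sub>E (\<Union>n. S n))"
    by (rule PiE_mono) blast
  ultimately have "(\<Pi>\<^sub>E n\<in>UNIV. S n) \<prec> (UNIV :: 'u set)"
    using lesspoll_trans1[OF subset_imp_lepoll] by metis
  then show "\<exists>T\<in>{S :: 'u set. S \<prec> (UNIV :: 'u set)}. (\<Pi>\<^sub>E n\<in>UNIV. S n) \<lesssim> T"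
    by (rule small_copy)
next
  fix S :: "'u set"
  assume "S \<in> {S :: 'u set. S \<prec> (UNIV :: 'u set)}"
  then have "S \<prec> (UNIV :: 'u set)" by simp
  then have "(carrier A \<rightarrow>\<^sub>E S) \<prec> (UNIV :: 'u set)"
    by (rule small_power[OF A _ nat power])
  then show "\<exists>T\<in>{S :: 'u set. S \<prec> (UNIV :: 'u set)}. (carrier A \<rightarrow>\<^sub>E S) \<lesssim> T"
    by (rule small_copy)
qed (rule small_copy[OF R] small_copy[OF A])+

lemma function_lepoll:
  fixes h :: "'c \<Rightarrow> 'i" and X :: "('i \<Rightarrow> 'c list \<Rightarrow> bool) set"
  assumes h: "surj h"
  shows "X \<lesssim> (UNIV :: ('c list \<Rightarrow> bool) set)"
proof -
  have "inj_on (\<lambda>f xs. xs \<noteq> [] \<and> f (h (hd xs)) (tl xs)) X"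
  proof (rule inj_onI, rule ext, rule ext)
    fix f g :: "'i \<Rightarrow> 'c list \<Rightarrow> bool" and i xs
    assume eq: "(\<lambda>xs. xs \<noteq> [] \<and> f (h (hd xs)) (tl xs)) = (\<lambda>xs. xs \<noteq> [] \<and> g (h (hd xs)) (tl xs))"
    obtain c where "i = h c" using surjD[OF h] by blast
    then show "f i xs = g i xs" using fun_cong[OF eq, of "c # xs"] by simp
  qed
  then show ?thesis unfolding lepoll_def by (intro exI conjI subset_UNIV)
qed

lemma module_universe_exists:
  fixes R :: "'r ring" and A :: "'a ring"
  shows "module_universe R A (UNIV :: ((nat \<times> ('r + 'a)) list \<Rightarrow> bool) set set)"
proof -
  let ?U = "UNIV :: ((nat \<times> ('r + 'a)) list \<Rightarrow> bool) set"
  have "surj (fst :: nat \<times> ('r + 'a) \<Rightarrow> nat)"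
    by (rule surjI[of _ "\<lambda>n. (n, undefined)"]) simp
  note nat = function_lepoll[OF this]
  have "surj (\<lambda>c :: nat \<times> ('r + 'a). case snd c of Inl r \<Rightarrow> undefined | Inr a \<Rightarrow> a)"
    by (rule surjI[of _ "\<lambda>a. (0, Inr a)"]) simp
  note A_power = function_lepoll[OF this]
  have "inj_on (\<lambda>r xs. xs = [(0 :: nat, Inl r :: 'r + 'a)]) (carrier R)"
  proof (rule inj_onI)
    fix x y
    assume eq: "(\<lambda>xs. xs = [(0 :: nat, Inl x :: 'r + 'a)]) = (\<lambda>xs. xs = [(0, Inl y)])"
    show "x = y" using fun_cong[OF eq, of "[(0, Inl x)]"] by simp
  qed
  then have R: "carrier R \<lesssim> ?U"
    unfolding lepoll_def by (intro exI conjI subset_UNIV)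
  have "inj_on (\<lambda>a xs. xs = [(0 :: nat, Inr a :: 'r + 'a)]) (carrier A)"
  proof (rule inj_onI)
    fix x y
    assume eq: "(\<lambda>xs. xs = [(0 :: nat, Inr x :: 'r + 'a)]) = (\<lambda>xs. xs = [(0, Inr y)])"
    show "x = y" using fun_cong[OF eq, of "[(0, Inr x)]"] by simp
  qed
  then have A: "carrier A \<lesssim> ?U"
    unfolding lepoll_def by (intro exI conjI subset_UNIV)
  show ?thesis
    unfolding module_universe_def
    by (intro conjI ballI allI impI UNIV_I bexI[of _ ?U] R A nat A_power)
qed

section \<open>The category of modules, projective resolutions and Ext\<close>

definition left_modules :: "'u set set \<Rightarrow> 's ring \<Rightarrow> ('s, 'u) module set" where
  "left_modules \<U> S = {M. left_module S M \<and> carrier M \<in> \<U>}"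

definition projective_module :: "'u set set \<Rightarrow> 's ring \<Rightarrow> ('s, 'u) module \<Rightarrow> bool" where
  "projective_module \<U> S P \<longleftrightarrow> P \<in> left_modules \<U> S \<and>
     (\<forall>M\<in>left_modules \<U> S. \<forall>N\<in>left_modules \<U> S. \<forall>p\<in>mod_hom S M N. \<forall>f\<in>mod_hom S P N.
        p ` carrier M = carrier N \<longrightarrow>
        (\<exists>g\<in>mod_hom S P M. \<forall>x\<in>carrier P. p (g x) = f x))"

definition projective_resolution ::
  "'u set set \<Rightarrow> 's ring \<Rightarrow> ('s, 'u) module \<Rightarrow>
   (nat \<Rightarrow> ('s, 'u) module) \<Rightarrow> (nat \<Rightarrow> 'u \<Rightarrow> 'u) \<Rightarrow> ('u \<Rightarrow> 'u) \<Rightarrow> bool"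
  where
  "projective_resolution \<U> S X P d \<epsilon> \<longleftrightarrow>
     (\<forall>n. projective_module \<U> S (P n)) \<and>
     (\<forall>n. d n \<in> mod_hom S (P (Suc n)) (P n)) \<and>
     \<epsilon> \<in> mod_hom S (P 0) X \<and>
     \<epsilon> ` carrier (P 0) = carrier X \<and>
     mod_kernel (P 0) X \<epsilon> = d 0 ` carrier (P (Suc 0)) \<and>
     (\<forall>n. mod_kernel (P (Suc n)) (P n) (d n) = d (Suc n) ` carrier (P (Suc (Suc n))))"

text \<open>
  The abelian group of homomorphisms, written multiplicatively so that the library's quotient
  groups apply. Homomorphisms are made extensional, so that equality of elements is equality
  of maps on the carrier.
\<close>

definition hom_group :: "'s ring \<Rightarrow> ('s, 'm) module \<Rightarrow> ('s, 'n) module \<Rightarrow> ('m \<Rightarrow> 'n) monoid" where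
  "hom_group S M N = \<lparr>carrier = mod_hom S M N \<inter> extensional (carrier M),
     mult = (\<lambda>f g. \<lambda>x\<in>carrier M. f x \<oplus>\<^bsub>N\<^esub> g x), one = (\<lambda>x\<in>carrier M. \<zero>\<^bsub>N\<^esub>)\<rparr>"

definition cocycles ::
  "'s ring \<Rightarrow> (nat \<Rightarrow> ('s, 'm) module) \<Rightarrow> (nat \<Rightarrow> 'm \<Rightarrow> 'm) \<Rightarrow> ('s, 'n) module \<Rightarrow> nat \<Rightarrow> ('m \<Rightarrow> 'n) set"
  where
  "cocycles S P d Y n =
     {f \<in> carrier (hom_group S (P n) Y). \<forall>x\<in>carrier (P (Suc n)). f (d n x) = \<zero>\<^bsub>Y\<^esub>}"

definition coboundaries ::
  "'s ring \<Rightarrow> (nat \<Rightarrow> ('s, 'm) module) \<Rightarrow> (nat \<Rightarrow> 'm \<Rightarrow> 'm) \<Rightarrow> ('s, 'n) module \<Rightarrow> nat \<Rightarrow> ('m \<Rightarrow> 'n) set"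
  where
  "coboundaries S P d Y n =
     (case n of
        0 \<Rightarrow> {\<one>\<^bsub>hom_group S (P 0) Y\<^esub>}
      | Suc m \<Rightarrow> {\<lambda>x\<in>carrier (P (Suc m)). g (d m x) |g. g \<in> carrier (hom_group S (P m) Y)})"

text \<open>
  \<open>Ext\<close> is the cohomology of the Hom complex of some chosen projective resolution; as usual,
  the result does not depend on the choice up to isomorphism.
\<close>

definition Ext ::
  "'u set set \<Rightarrow> 's ring \<Rightarrow> nat \<Rightarrow> ('s, 'u) module \<Rightarrow> ('s, 'u) module \<Rightarrow> ('u \<Rightarrow> 'u) set monoid"
  where
  "Ext \<U> S n X Y =
     (let (P, d) = (SOME (P, d). \<exists>\<epsilon>. projective_resolution \<U> S X P d \<epsilon>) in
        (hom_group S (P n) Y)\<lparr>carrier := cocycles S P d Y n\<rparr> Mod coboundaries S P d Y n)"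

section \<open>Cotorsion pairs\<close>

definition right_perp :: "'u set set \<Rightarrow> 's ring \<Rightarrow> ('s, 'u) module set \<Rightarrow> ('s, 'u) module set" where
  "right_perp \<U> S \<X> = {Y \<in> left_modules \<U> S. \<forall>X\<in>\<X>. trivial_group (Ext \<U> S 1 X Y)}"

definition left_perp :: "'u set set \<Rightarrow> 's ring \<Rightarrow> ('s, 'u) module set \<Rightarrow> ('s, 'u) module set" where
  "left_perp \<U> S \<X> = {Y \<in> left_modules \<U> S. \<forall>X\<in>\<X>. trivial_group (Ext \<U> S 1 Y X)}"

definition cotorsion_pair ::
  "'u set set \<Rightarrow> 's ring \<Rightarrow> ('s, 'u) module set \<Rightarrow> ('s, 'u) module set \<Rightarrow> bool"
  where
  "cotorsion_pair \<U> S \<F> \<C> \<longleftrightarrow> \<C> = right_perp \<U> S \<F> \<and> \<F> = left_perp \<U> S \<C>"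

definition complete_cotorsion_pair ::
  "'u set set \<Rightarrow> 's ring \<Rightarrow> ('s, 'u) module set \<Rightarrow> ('s, 'u) module set \<Rightarrow> bool"
  where
  "complete_cotorsion_pair \<U> S \<F> \<C> \<longleftrightarrow> cotorsion_pair \<U> S \<F> \<C> \<and>
     (\<forall>M\<in>left_modules \<U> S.
        (\<exists>C'\<in>\<C>. \<exists>F\<in>\<F>. \<exists>i p. short_exact S C' F M i p) \<and>
        (\<exists>C\<in>\<C>. \<exists>F'\<in>\<F>. \<exists>i p. short_exact S M C F' i p))"

definition hereditary_cotorsion_pair ::
  "'u set set \<Rightarrow> 's ring \<Rightarrow> ('s, 'u) module set \<Rightarrow> ('s, 'u) module set \<Rightarrow> bool"
  where
  "hereditary_cotorsion_pair \<U> S \<F> \<C> \<longleftrightarrow> cotorsion_pair \<U> S \<F> \<C> \<and>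
     (\<forall>F\<in>\<F>. \<forall>C\<in>\<C>. \<forall>n\<ge>1. trivial_group (Ext \<U> S n F C))"

definition direct_summands :: "'u set set \<Rightarrow> 's ring \<Rightarrow> ('s, 'u) module set \<Rightarrow> ('s, 'u) module set" where
  "direct_summands \<U> S \<X> =
     {N \<in> left_modules \<U> S. \<exists>N'\<in>left_modules \<U> S. iso_to_member S (sum_module N N') \<X>}"

section \<open>Cofiltrations\<close>

text \<open>
  An ordinal is given as an element \<open>\<alpha>\<close> of a well-ordered type, the ordinals up to \<open>\<alpha>\<close> being
  the elements of \<open>{..\<alpha>}\<close>; in particular \<open>\<infinity> :: enat\<close> represents the first infinite ordinal.
\<close>

definition ord_zero :: "'i::wellorder \<Rightarrow> bool" where
  "ord_zero i \<longleftrightarrow> (\<forall>j. i \<le> j)"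

definition ord_succ :: "'i::wellorder \<Rightarrow> 'i \<Rightarrow> bool" where
  "ord_succ i j \<longleftrightarrow> i < j \<and> (\<forall>k. \<not> (i < k \<and> k < j))"

definition ord_limit :: "'i::wellorder \<Rightarrow> bool" where
  "ord_limit i \<longleftrightarrow> \<not> ord_zero i \<and> (\<nexists>j. ord_succ j i)"

text \<open>\<open>t i j\<close> is the map from \<open>G i\<close> to \<open>G j\<close>, for \<open>j < i\<close>.\<close>

definition inverse_limit ::
  "('i::wellorder \<Rightarrow> ('s, 'm) module) \<Rightarrow> ('i \<Rightarrow> 'i \<Rightarrow> 'm \<Rightarrow> 'm) \<Rightarrow> 'i \<Rightarrow> ('s, 'i \<Rightarrow> 'm) module"
  where
  "inverse_limit G t i =
     (prod_module {..<i} G)\<lparr>carrier :=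
        {s \<in> carrier (prod_module {..<i} G). \<forall>j<i. \<forall>k<j. t j k (s j) = s k}\<rparr>"

definition cofiltration ::
  "'u set set \<Rightarrow> 's ring \<Rightarrow> 'i::wellorder \<Rightarrow> ('s, 'u) module \<Rightarrow>
   ('i \<Rightarrow> ('s, 'u) module) \<Rightarrow> ('i \<Rightarrow> 'i \<Rightarrow> 'u \<Rightarrow> 'u) \<Rightarrow> bool"
  where
  "cofiltration \<U> S \<alpha> N G t \<longleftrightarrow>
     (\<forall>i\<le>\<alpha>. G i \<in> left_modules \<U> S) \<and>
     (\<forall>i\<le>\<alpha>. \<forall>j<i. t i j \<in> mod_hom S (G i) (G j)) \<and>
     (\<forall>i\<le>\<alpha>. \<forall>j<i. \<forall>k<j. \<forall>x\<in>carrier (G i). t j k (t i j x) = t i k x) \<and>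
     (\<forall>i. ord_zero i \<longrightarrow> carrier (G i) = {\<zero>\<^bsub>G i\<^esub>}) \<and>
     G \<alpha> = N \<and>
     (\<forall>i\<le>\<alpha>. ord_limit i \<longrightarrow> (\<lambda>x. \<lambda>j\<in>{..<i}. t i j x) \<in> mod_iso S (G i) (inverse_limit G t i)) \<and>
     (\<forall>i j. j \<le> \<alpha> \<longrightarrow> ord_succ i j \<longrightarrow> t j i ` carrier (G j) = carrier (G i))"

definition Cof ::
  "'u set set \<Rightarrow> 's ring \<Rightarrow> 'i::wellorder \<Rightarrow> ('s, 'v) module set \<Rightarrow> ('s, 'u) module set"
  where
  "Cof \<U> S \<alpha> \<T> = {N \<in> left_modules \<U> S. \<exists>G t. cofiltration \<U> S \<alpha> N G t \<and>
     (\<forall>i j. j \<le> \<alpha> \<longrightarrow> ord_succ i j \<longrightarrow>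
        iso_to_member S ((G j)\<lparr>carrier := mod_kernel (G j) (G i) (t j i)\<rparr>) \<T>)}"

section \<open>Change of rings\<close>

definition regular_module :: "'a ring \<Rightarrow> ('a, 'a) module" where
  "regular_module A = \<lparr>carrier = carrier A, mult = mult A, one = one A, zero = zero A, add = add A,
     smult = mult A\<rparr>"

definition restrict_scalars :: "('r \<Rightarrow> 'a) \<Rightarrow> ('a, 'm) module \<Rightarrow> ('r, 'm) module" where
  "restrict_scalars \<phi> M = \<lparr>carrier = carrier M, mult = mult M, one = one M, zero = zero M,
     add = add M, smult = (\<lambda>r x. \<phi> r \<odot>\<^bsub>M\<^esub> x)\<rparr>"

definition coinduced ::
  "'r ring \<Rightarrow> 'a ring \<Rightarrow> ('r \<Rightarrow> 'a) \<Rightarrow> ('r, 'm) module \<Rightarrow> ('a, 'a \<Rightarrow> 'm) module"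
  where
  "coinduced R A \<phi> M = (let H = hom_group R (restrict_scalars \<phi> (regular_module A)) M in
     \<lparr>carrier = carrier H, mult = undefined, one = undefined, zero = one H, add = mult H,
      smult = (\<lambda>a f. \<lambda>x\<in>carrier A. f (x \<otimes>\<^bsub>A\<^esub> a))\<rparr>)"

text \<open>
  Products and coinduced modules have carriers in other types than \<open>'u\<close>, so membership in a
  class of modules over \<open>'u\<close> is understood up to isomorphism. Every class occurring in a
  cotorsion pair is closed under isomorphism.
\<close>

definition closed_under_countable_products :: "'s ring \<Rightarrow> ('s, 'u) module set \<Rightarrow> bool" where
  "closed_under_countable_products S \<X> \<longleftrightarrow>
     (\<forall>(I :: nat set) M. (\<forall>i\<in>I. M i \<in> \<X>) \<longrightarrow> iso_to_member S (prod_module I M) \<X>)"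

definition restricting_to ::
  "'u set set \<Rightarrow> 'a ring \<Rightarrow> ('r \<Rightarrow> 'a) \<Rightarrow> ('r, 'u) module set \<Rightarrow> ('a, 'u) module set"
  where
  "restricting_to \<U> A \<phi> \<F> = {M \<in> left_modules \<U> A. restrict_scalars \<phi> M \<in> \<F>}"

end

theory Submission
  imports Defs "HOL-Library.Countable_Set"
begin

text \<open>
  Write \<open>\<F>\<^sub>A\<close> for the \<open>A\<close>-modules whose restriction to \<open>R\<close> is in \<open>\<F>\<close>, and \<open>\<W>\<close> for the \<open>A\<close>-modules with an
  \<open>\<omega>\<close>-cofiltration by modules \<open>Hom\<^sub>R(A, C)\<close>, \<open>C \<in> \<C>\<close>. A pair \<open>(\<F>\<^sub>A, \<W>\<^sup>\<oplus>)\<close> is a complete cotorsion pair as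
  soon as \<open>Ext\<^sup>1\<close> vanishes from \<open>\<F>\<^sub>A\<close> to \<open>\<W>\<close>, every \<open>A\<close>-module has both approximation sequences with terms
  from \<open>\<F>\<^sub>A\<close> and \<open>\<W>\<close>, and \<open>\<F>\<^sub>A\<close> is closed under direct summands (\<open>complete_cotorsion_pairI\<close>): a module
  orthogonal to one class splits off its approximation. It is hereditary if \<open>\<F>\<^sub>A\<close> is closed under kernels
  of surjections, by dimension shifting (\<open>hereditary_cotorsion_pairI\<close>), and \<open>\<F>\<^sub>A\<close> inherits this from \<open>\<F>\<close>
  (\<open>hereditary_kernel\<close>).

  Orthogonality. By adjunction, a map into \<open>Hom\<^sub>R(A, C)\<close> is an \<open>R\<close>-linear map into \<open>C\<close>, so that
  \<open>Ext\<^sup>1\<^sub>R(X, C) = 0\<close> implies \<open>Ext\<^sup>1\<^sub>A(X, Hom\<^sub>R(A, C)) = 0\<close> (\<open>ext1_coinduced\<close>). This passes to \<open>\<omega>\<close>-cofiltered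
  modules, because maps can be extended stage by stage along the cofiltration (\<open>ext1_Cof\<close>).

  Approximations. Let \<open>M\<close> be an \<open>A\<close>-module and \<open>p : F \<rightarrow> M\<close> an \<open>R\<close>-linear surjection with \<open>F \<in> \<F>\<close> and kernel
  \<open>C \<in> \<C>\<close>. The pullback \<open>Q(M)\<close> of \<open>Hom\<^sub>R(A, F) \<rightarrow> Hom\<^sub>R(A, M)\<close> along \<open>M \<rightarrow> Hom\<^sub>R(A, M)\<close> is an \<open>A\<close>-module that maps
  onto \<open>M\<close> with kernel \<open>Hom\<^sub>R(A, C)\<close>, since \<open>A \<in> \<F>\<close>; and as an \<open>R\<close>-linear map, \<open>Q(M) \<rightarrow> M\<close> factors through
  \<open>F\<close> (\<open>tower_step\<close>). Iterating this gives a tower \<open>\<dots> \<rightarrow> Q(Q(M)) \<rightarrow> Q(M) \<rightarrow> M\<close>, which over \<open>R\<close> is interleaved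
  with a tower of modules \<open>F\<^sub>n \<in> \<F>\<close>. So its limit \<open>N\<close> is also the limit of the \<open>F\<^sub>n\<close>. By surjectivity of the
  maps in the first tower, this is the kernel of a surjective endomorphism of the product of the \<open>F\<^sub>n\<close>
  (\<open>interleaved_limit\<close>), and hence \<open>N \<in> \<F>\<^sub>A\<close>.

  The pullback of \<open>N \<rightarrow> M\<close> along a map \<open>B \<rightarrow> M\<close> with \<open>B = Hom\<^sub>R(A, C)\<close> is in \<open>\<W>\<close>: the pullbacks of the stages
  of the tower, preceded by \<open>0\<close>, form an \<open>\<omega>\<close>-cofiltration, whose first subquotient is \<open>B\<close>
  (\<open>pullback_of_tower_in_Cof\<close>). With \<open>B = 0\<close> this is the kernel of \<open>N \<rightarrow> M\<close> (\<open>special_precover\<close>). For the other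
  sequence, embed \<open>M\<close> into some \<open>B = Hom\<^sub>R(A, C)\<close> and apply the construction to \<open>B/M\<close>: the pullback of
  \<open>N \<rightarrow> B/M\<close> along \<open>B \<rightarrow> B/M\<close> is in \<open>\<W>\<close> and is an extension of \<open>N\<close> by \<open>M\<close> (\<open>special_preenvelope\<close>).

  Elements of products, pullbacks and coinduced modules live in types of their own. So the vanishing of
  \<open>Ext\<^sup>1\<close> is stated for modules with elements of any type, and constructions are carried back to the
  universe by isomorphisms (\<open>small_copy_exists\<close>).
\<close>

section \<open>Modules and homomorphisms\<close>

lemma left_moduleI:
  assumes "ring S"
    and "\<And>x y. \<lbrakk>x \<in> carrier M; y \<in> carrier M\<rbrakk> \<Longrightarrow> x \<oplus>\<^bsub>M\<^esub> y \<in> carrier M"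
    and "\<zero>\<^bsub>M\<^esub> \<in> carrier M"
    and "\<And>x y z. \<lbrakk>x \<in> carrier M; y \<in> carrier M; z \<in> carrier M\<rbrakk> \<Longrightarrow>
      (x \<oplus>\<^bsub>M\<^esub> y) \<oplus>\<^bsub>M\<^esub> z = x \<oplus>\<^bsub>M\<^esub> (y \<oplus>\<^bsub>M\<^esub> z)"
    and "\<And>x y. \<lbrakk>x \<in> carrier M; y \<in> carrier M\<rbrakk> \<Longrightarrow> x \<oplus>\<^bsub>M\<^esub> y = y \<oplus>\<^bsub>M\<^esub> x"
    and "\<And>x. x \<in> carrier M \<Longrightarrow> \<zero>\<^bsub>M\<^esub> \<oplus>\<^bsub>M\<^esub> x = x"
    and "\<And>x. x \<in> carrier M \<Longrightarrow> \<exists>y\<in>carrier M. y \<oplus>\<^bsub>M\<^esub> x = \<zero>\<^bsub>M\<^esub>"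
    and "\<And>r x. \<lbrakk>r \<in> carrier S; x \<in> carrier M\<rbrakk> \<Longrightarrow> r \<odot>\<^bsub>M\<^esub> x \<in> carrier M"
    and "\<And>r s x. \<lbrakk>r \<in> carrier S; s \<in> carrier S; x \<in> carrier M\<rbrakk> \<Longrightarrow>
      (r \<oplus>\<^bsub>S\<^esub> s) \<odot>\<^bsub>M\<^esub> x = r \<odot>\<^bsub>M\<^esub> x \<oplus>\<^bsub>M\<^esub> s \<odot>\<^bsub>M\<^esub> x"
    and "\<And>r x y. \<lbrakk>r \<in> carrier S; x \<in> carrier M; y \<in> carrier M\<rbrakk> \<Longrightarrow>
      r \<odot>\<^bsub>M\<^esub> (x \<oplus>\<^bsub>M\<^esub> y) = r \<odot>\<^bsub>M\<^esub> x \<oplus>\<^bsub>M\<^esub> r \<odot>\<^bsub>M\<^esub> y"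
    and "\<And>r s x. \<lbrakk>r \<in> carrier S; s \<in> carrier S; x \<in> carrier M\<rbrakk> \<Longrightarrow>
      (r \<otimes>\<^bsub>S\<^esub> s) \<odot>\<^bsub>M\<^esub> x = r \<odot>\<^bsub>M\<^esub> (s \<odot>\<^bsub>M\<^esub> x)"
    and "\<And>x. x \<in> carrier M \<Longrightarrow> \<one>\<^bsub>S\<^esub> \<odot>\<^bsub>M\<^esub> x = x"
  shows "left_module S M"
  using assms by (intro left_module.intro left_module_axioms.intro abelian_groupI) auto

context left_module
begin

lemma smult_zero_left [simp]: "x \<in> carrier M \<Longrightarrow> \<zero>\<^bsub>R\<^esub> \<odot>\<^bsub>M\<^esub> x = \<zero>\<^bsub>M\<^esub>"
  by (metis M.add.r_cancel_one' R.l_zero R.zero_closed smult_closed smult_l_distr)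

lemma smult_zero_right [simp]: "r \<in> carrier R \<Longrightarrow> r \<odot>\<^bsub>M\<^esub> \<zero>\<^bsub>M\<^esub> = \<zero>\<^bsub>M\<^esub>"
  by (metis M.add.r_cancel_one' M.l_zero M.zero_closed smult_closed smult_r_distr)

lemma minus_eq_smult: "x \<in> carrier M \<Longrightarrow> \<ominus>\<^bsub>M\<^esub> x = (\<ominus>\<^bsub>R\<^esub> \<one>\<^bsub>R\<^esub>) \<odot>\<^bsub>M\<^esub> x"
  by (rule M.minus_equality)
    (metis R.a_inv_closed R.l_neg R.one_closed smult_l_distr smult_unital smult_zero_left, auto intro: smult_closed)

lemma uminus_zero [simp]: "\<ominus>\<^bsub>M\<^esub> \<zero>\<^bsub>M\<^esub> = \<zero>\<^bsub>M\<^esub>"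
  by (rule M.minus_equality) auto

lemma diff_eq_zero_iff:
  "\<lbrakk>x \<in> carrier M; y \<in> carrier M\<rbrakk> \<Longrightarrow> x \<ominus>\<^bsub>M\<^esub> y = \<zero>\<^bsub>M\<^esub> \<longleftrightarrow> x = y"
  by (metis M.a_inv_closed M.minus_equality M.minus_minus M.r_neg a_minus_def)

lemma add_diff_cancel:
  "\<lbrakk>x \<in> carrier M; y \<in> carrier M\<rbrakk> \<Longrightarrow> y \<oplus>\<^bsub>M\<^esub> (x \<ominus>\<^bsub>M\<^esub> y) = x"
  "\<lbrakk>x \<in> carrier M; y \<in> carrier M\<rbrakk> \<Longrightarrow> (x \<ominus>\<^bsub>M\<^esub> y) \<oplus>\<^bsub>M\<^esub> y = x"
  by (simp_all add: a_minus_def M.a_ac M.r_neg)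

lemma smult_minus_right:
  assumes "r \<in> carrier R" "x \<in> carrier M"
  shows "r \<odot>\<^bsub>M\<^esub> (\<ominus>\<^bsub>M\<^esub> x) = \<ominus>\<^bsub>M\<^esub> (r \<odot>\<^bsub>M\<^esub> x)"
proof -
  have "r \<odot>\<^bsub>M\<^esub> (\<ominus>\<^bsub>M\<^esub> x) \<oplus>\<^bsub>M\<^esub> r \<odot>\<^bsub>M\<^esub> x = \<zero>\<^bsub>M\<^esub>"
    using assms by (simp add: smult_r_distr[symmetric] M.l_neg)
  then show ?thesis using assms by (metis M.a_inv_closed M.minus_equality smult_closed)
qed

end

lemma mod_homI:
  assumes "\<And>x. x \<in> carrier M \<Longrightarrow> h x \<in> carrier N"
    and "\<And>x y. \<lbrakk>x \<in> carrier M; y \<in> carrier M\<rbrakk> \<Longrightarrow> h (x \<oplus>\<^bsub>M\<^esub> y) = h x \<oplus>\<^bsub>N\<^esub> h y"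
    and "\<And>r x. \<lbrakk>r \<in> carrier S; x \<in> carrier M\<rbrakk> \<Longrightarrow> h (r \<odot>\<^bsub>M\<^esub> x) = r \<odot>\<^bsub>N\<^esub> h x"
  shows "h \<in> mod_hom S M N"
  using assms by (auto simp: mod_hom_def)

lemma mod_hom_closed: "\<lbrakk>h \<in> mod_hom S M N; x \<in> carrier M\<rbrakk> \<Longrightarrow> h x \<in> carrier N"
  by (auto simp: mod_hom_def)

lemma mod_hom_add:
  "\<lbrakk>h \<in> mod_hom S M N; x \<in> carrier M; y \<in> carrier M\<rbrakk> \<Longrightarrow> h (x \<oplus>\<^bsub>M\<^esub> y) = h x \<oplus>\<^bsub>N\<^esub> h y"
  by (auto simp: mod_hom_def)

lemma mod_hom_smult:
  "\<lbrakk>h \<in> mod_hom S M N; r \<in> carrier S; x \<in> carrier M\<rbrakk> \<Longrightarrow> h (r \<odot>\<^bsub>M\<^esub> x) = r \<odot>\<^bsub>N\<^esub> h x"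
  by (auto simp: mod_hom_def)

lemma mod_hom_zero:
  assumes "left_module S M" "left_module S N" "h \<in> mod_hom S M N"
  shows "h \<zero>\<^bsub>M\<^esub> = \<zero>\<^bsub>N\<^esub>"
proof -
  interpret M: left_module S M by fact
  interpret N: left_module S N by fact
  have "h (\<zero>\<^bsub>S\<^esub> \<odot>\<^bsub>M\<^esub> \<zero>\<^bsub>M\<^esub>) = \<zero>\<^bsub>S\<^esub> \<odot>\<^bsub>N\<^esub> h \<zero>\<^bsub>M\<^esub>"
    by (rule mod_hom_smult[OF assms(3)]) auto
  then show ?thesis using mod_hom_closed[OF assms(3)] by simp
qed

lemma mod_hom_minus:
  assumes "left_module S M" "left_module S N" "h \<in> mod_hom S M N" "x \<in> carrier M"
  shows "h (\<ominus>\<^bsub>M\<^esub> x) = \<ominus>\<^bsub>N\<^esub> h x"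
proof -
  interpret M: left_module S M by fact
  interpret N: left_module S N by fact
  show ?thesis
    using assms(3,4) by (simp add: M.minus_eq_smult N.minus_eq_smult mod_hom_smult mod_hom_closed)
qed

lemma mod_hom_diff:
  assumes "left_module S M" "left_module S N" "h \<in> mod_hom S M N" "x \<in> carrier M" "y \<in> carrier M"
  shows "h (x \<ominus>\<^bsub>M\<^esub> y) = h x \<ominus>\<^bsub>N\<^esub> h y"
proof -
  interpret M: left_module S M by fact
  show ?thesis
    unfolding a_minus_def using assms by (simp add: mod_hom_add mod_hom_minus)
qed

lemma mod_hom_comp:
  "\<lbrakk>f \<in> mod_hom S L M; g \<in> mod_hom S M N\<rbrakk> \<Longrightarrow> (\<lambda>x. g (f x)) \<in> mod_hom S L N"
  by (auto simp: mod_hom_def Pi_iff)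

lemma mod_hom_cong:
  assumes "left_module S M" "h \<in> mod_hom S M N" "\<And>x. x \<in> carrier M \<Longrightarrow> h' x = h x"
  shows "h' \<in> mod_hom S M N"
proof -
  interpret M: left_module S M by fact
  show ?thesis
    using assms(2,3) by (auto simp: mod_hom_def Pi_iff M.smult_closed)
qed

lemma mod_hom_plus:
  assumes "left_module S N" "f \<in> mod_hom S M N" "g \<in> mod_hom S M N"
  shows "(\<lambda>x. f x \<oplus>\<^bsub>N\<^esub> g x) \<in> mod_hom S M N"
proof -
  interpret N: left_module S N by fact
  show ?thesis
    using assms(2,3)
    by (intro mod_homI) (simp_all add: mod_hom_closed mod_hom_add mod_hom_smult N.smult_r_distr N.M.a_ac)
qed

lemma mod_hom_uminus:
  assumes "left_module S N" "f \<in> mod_hom S M N"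
  shows "(\<lambda>x. \<ominus>\<^bsub>N\<^esub> f x) \<in> mod_hom S M N"
proof -
  interpret N: left_module S N by fact
  show ?thesis
    using assms(2)
    by (intro mod_homI)
      (simp_all add: mod_hom_closed mod_hom_add mod_hom_smult N.smult_minus_right N.M.minus_add)
qed

lemma mod_hom_minus_hom:
  assumes "left_module S N" "f \<in> mod_hom S M N" "g \<in> mod_hom S M N"
  shows "(\<lambda>x. f x \<ominus>\<^bsub>N\<^esub> g x) \<in> mod_hom S M N"
  unfolding a_minus_def using assms by (intro mod_hom_plus mod_hom_uminus)

lemma mod_hom_const_zero:
  assumes "left_module S N"
  shows "(\<lambda>x. \<zero>\<^bsub>N\<^esub>) \<in> mod_hom S M N"
proof -
  interpret N: left_module S N by fact
  show ?thesis by (intro mod_homI) auto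
qed

lemma mod_hom_id: "(\<lambda>x. x) \<in> mod_hom S M M"
  by (intro mod_homI) auto

lemma mod_isoD: "h \<in> mod_iso S M N \<Longrightarrow> h \<in> mod_hom S M N"
  "h \<in> mod_iso S M N \<Longrightarrow> inj_on h (carrier M)"
  "h \<in> mod_iso S M N \<Longrightarrow> h ` carrier M = carrier N"
  by (auto simp: mod_iso_def bij_betw_def)

lemma mod_isoI:
  "\<lbrakk>h \<in> mod_hom S M N; inj_on h (carrier M); h ` carrier M = carrier N\<rbrakk> \<Longrightarrow> h \<in> mod_iso S M N"
  by (auto simp: mod_iso_def bij_betw_def)

lemma mod_iso_comp:
  "\<lbrakk>f \<in> mod_iso S L M; g \<in> mod_iso S M N\<rbrakk> \<Longrightarrow> (\<lambda>x. g (f x)) \<in> mod_iso S L N"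
  unfolding mod_iso_def using bij_betw_trans[of f "carrier L" "carrier M" g "carrier N"]
  by (auto intro: mod_hom_comp simp: o_def)

lemma mod_hom_inv_into:
  assumes "left_module S M" "h \<in> mod_hom S M N" "inj_on h (carrier M)"
    and L: "f \<in> mod_hom S L N" "f ` carrier L \<subseteq> h ` carrier M"
  shows "(\<lambda>x. inv_into (carrier M) h (f x)) \<in> mod_hom S L M"
proof -
  interpret M: left_module S M by fact
  let ?g = "\<lambda>x. inv_into (carrier M) h (f x)"
  have g: "?g x \<in> carrier M" "h (?g x) = f x" if "x \<in> carrier L" for x
  proof -
    have "f x \<in> h ` carrier M" using L(2) that by auto
    then show "?g x \<in> carrier M" "h (?g x) = f x"
      by (simp_all add: inv_into_into f_inv_into_f)
  qed
  have eq: "?g z = y" if "y \<in> carrier M" "h y = f z" for y z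
    using that assms(3) by (metis inv_into_f_f)
  show ?thesis
    using g L(1) assms(2)
    by (intro mod_homI eq) (simp_all add: mod_hom_add mod_hom_smult M.smult_closed)
qed

lemma mod_iso_inv_into:
  assumes "left_module S M" "h \<in> mod_iso S M N"
  shows "inv_into (carrier M) h \<in> mod_iso S N M"
proof -
  note h = mod_isoD[OF assms(2)]
  have "inv_into (carrier M) h \<in> mod_hom S N M"
    using mod_hom_inv_into[OF assms(1) h(1,2) mod_hom_id] h(3) by simp
  moreover have "bij_betw (inv_into (carrier M) h) (carrier N) (carrier M)"
    using assms(2) by (auto simp: mod_iso_def bij_betw_inv_into)
  ultimately show ?thesis by (simp add: mod_iso_def)
qed

lemma inj_on_kernel:
  assumes "left_module S M" "left_module S N" "h \<in> mod_hom S M N"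
    and "\<And>x. \<lbrakk>x \<in> carrier M; h x = \<zero>\<^bsub>N\<^esub>\<rbrakk> \<Longrightarrow> x = \<zero>\<^bsub>M\<^esub>"
  shows "inj_on h (carrier M)"
proof (rule inj_onI)
  interpret M: left_module S M by fact
  interpret N: left_module S N by fact
  fix x y assume xy: "x \<in> carrier M" "y \<in> carrier M" "h x = h y"
  then have "h (x \<ominus>\<^bsub>M\<^esub> y) = \<zero>\<^bsub>N\<^esub>"
    using assms(1-3) by (simp add: mod_hom_diff mod_hom_closed N.diff_eq_zero_iff)
  then show "x = y" using assms(4)[of "x \<ominus>\<^bsub>M\<^esub> y"] xy by (simp add: M.diff_eq_zero_iff)
qed

section \<open>Constructions of modules\<close>

text \<open>
  Both a quotient of a module and its copy along a bijection are images under a surjection that respects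
  the operations, and such a surjection carries over all module axioms.
\<close>

lemma left_module_image:
  assumes M: "left_module S M" and p: "p ` carrier M = carrier N"
    and add: "\<And>x y. \<lbrakk>x \<in> carrier M; y \<in> carrier M\<rbrakk> \<Longrightarrow> p (x \<oplus>\<^bsub>M\<^esub> y) = p x \<oplus>\<^bsub>N\<^esub> p y"
    and smult: "\<And>r x. \<lbrakk>r \<in> carrier S; x \<in> carrier M\<rbrakk> \<Longrightarrow> p (r \<odot>\<^bsub>M\<^esub> x) = r \<odot>\<^bsub>N\<^esub> p x"
    and zero: "p \<zero>\<^bsub>M\<^esub> = \<zero>\<^bsub>N\<^esub>"
  shows "left_module S N" "p \<in> mod_hom S M N"
proof -
  interpret M: left_module S M by fact
  note sym = add[symmetric] smult[symmetric] zero[symmetric] p[symmetric]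
  show "left_module S N"
  proof (rule left_moduleI)
    show "\<exists>y\<in>carrier N. y \<oplus>\<^bsub>N\<^esub> x = \<zero>\<^bsub>N\<^esub>" if x: "x \<in> carrier N" for x
    proof -
      obtain x' where x': "x' \<in> carrier M" "x = p x'" using x p by auto
      show ?thesis
        by (rule bexI[of _ "p (\<ominus>\<^bsub>M\<^esub> x')"]) (use x' in \<open>simp_all add: sym M.M.l_neg\<close>)
    qed
  qed (auto simp: sym M.smult_closed M.smult_l_distr M.smult_r_distr M.smult_assoc M.smult_unital
      M.M.a_ac M.R.ring_axioms)
  show "p \<in> mod_hom S M N"
    using p by (intro mod_homI add smult) auto
qed

definition submod :: "'s ring \<Rightarrow> ('s, 'm) module \<Rightarrow> 'm set \<Rightarrow> bool" where
  "submod S M H \<longleftrightarrow> H \<subseteq> carrier M \<and> \<zero>\<^bsub>M\<^esub> \<in> H \<and> (\<forall>x\<in>H. \<forall>y\<in>H. x \<oplus>\<^bsub>M\<^esub> y \<in> H) \<and>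
     (\<forall>r\<in>carrier S. \<forall>x\<in>H. r \<odot>\<^bsub>M\<^esub> x \<in> H)"

lemma submod_left_module:
  assumes "left_module S M" "submod S M H"
  shows "left_module S (M\<lparr>carrier := H\<rparr>)"
proof -
  interpret M: left_module S M by fact
  have H: "H \<subseteq> carrier M" "\<zero>\<^bsub>M\<^esub> \<in> H" "\<And>x y. \<lbrakk>x \<in> H; y \<in> H\<rbrakk> \<Longrightarrow> x \<oplus>\<^bsub>M\<^esub> y \<in> H"
    "\<And>r x. \<lbrakk>r \<in> carrier S; x \<in> H\<rbrakk> \<Longrightarrow> r \<odot>\<^bsub>M\<^esub> x \<in> H"
    using assms(2) by (auto simp: submod_def)
  show ?thesis
  proof (rule left_moduleI)
    show "\<exists>y\<in>carrier (M\<lparr>carrier := H\<rparr>). y \<oplus>\<^bsub>M\<lparr>carrier := H\<rparr>\<^esub> x = \<zero>\<^bsub>M\<lparr>carrier := H\<rparr>\<^esub>"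
      if "x \<in> carrier (M\<lparr>carrier := H\<rparr>)" for x
    proof (rule bexI[of _ "\<ominus>\<^bsub>M\<^esub> x"])
      have x: "x \<in> H" "x \<in> carrier M" using that H by auto
      show "\<ominus>\<^bsub>M\<^esub> x \<oplus>\<^bsub>M\<lparr>carrier := H\<rparr>\<^esub> x = \<zero>\<^bsub>M\<lparr>carrier := H\<rparr>\<^esub>"
        using x by (simp add: M.M.l_neg)
      show "\<ominus>\<^bsub>M\<^esub> x \<in> carrier (M\<lparr>carrier := H\<rparr>)"
        using x H(4) by (simp add: M.minus_eq_smult)
    qed
  qed (use H in \<open>auto simp: M.smult_closed M.smult_l_distr M.smult_r_distr M.smult_assoc
      M.smult_unital M.M.a_ac M.R.ring_axioms subset_iff\<close>)
qed

lemma submod_inclusion: "submod S M H \<Longrightarrow> (\<lambda>x. x) \<in> mod_hom S (M\<lparr>carrier := H\<rparr>) M"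
  by (auto simp: submod_def mod_hom_def)

lemma mod_hom_restrict_domain:
  "\<lbrakk>submod S M H; h \<in> mod_hom S M N\<rbrakk> \<Longrightarrow> h \<in> mod_hom S (M\<lparr>carrier := H\<rparr>) N"
  by (rule mod_homI) (auto simp: submod_def subset_iff mod_hom_closed mod_hom_add mod_hom_smult)

lemma mod_hom_restrict_codomain:
  "\<lbrakk>h \<in> mod_hom S M N; h ` carrier M \<subseteq> H\<rbrakk> \<Longrightarrow> h \<in> mod_hom S M (N\<lparr>carrier := H\<rparr>)"
  by (auto simp: mod_hom_def)

lemma mod_hom_from_sub_codomain:
  "\<lbrakk>h \<in> mod_hom S M (N\<lparr>carrier := H\<rparr>); H \<subseteq> carrier N\<rbrakk> \<Longrightarrow> h \<in> mod_hom S M N"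
  by (auto simp: mod_hom_def)

abbreviation kernel_module :: "('s, 'm) module \<Rightarrow> ('s, 'n) module \<Rightarrow> ('m \<Rightarrow> 'n) \<Rightarrow> ('s, 'm) module" where
  "kernel_module M N h \<equiv> M\<lparr>carrier := mod_kernel M N h\<rparr>"

lemma submod_kernel:
  assumes "left_module S M" "left_module S N" "h \<in> mod_hom S M N"
  shows "submod S M (mod_kernel M N h)"
proof -
  interpret M: left_module S M by fact
  interpret N: left_module S N by fact
  show ?thesis
    using assms by (auto simp: submod_def mod_kernel_def mod_hom_zero mod_hom_add mod_hom_smult M.smult_closed)
qed

lemma left_module_kernel:
  assumes "left_module S M" "left_module S N" "h \<in> mod_hom S M N"
  shows "left_module S (kernel_module M N h)"
  using assms by (intro submod_left_module submod_kernel)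

lemma submod_image:
  assumes "left_module S M" "left_module S N" "h \<in> mod_hom S M N"
  shows "submod S N (h ` carrier M)"
proof -
  interpret M: left_module S M by fact
  have "\<zero>\<^bsub>N\<^esub> \<in> h ` carrier M"
    using mod_hom_zero[OF assms] by (metis M.M.zero_closed imageI)
  moreover have "h x \<oplus>\<^bsub>N\<^esub> h y \<in> h ` carrier M" if "x \<in> carrier M" "y \<in> carrier M" for x y
    using that assms(3) by (metis M.M.a_closed imageI mod_hom_add)
  moreover have "r \<odot>\<^bsub>N\<^esub> h x \<in> h ` carrier M" if "r \<in> carrier S" "x \<in> carrier M" for r x
    using that assms(3) by (metis M.smult_closed imageI mod_hom_smult)
  ultimately show ?thesis
    using assms(3) by (auto simp: submod_def mod_hom_closed)
qed

lemma module_copy: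
  fixes M :: "('s, 'm) module" and h :: "'m \<Rightarrow> 'n"
  assumes M: "left_module S M" and h: "inj_on h (carrier M)"
  obtains N :: "('s, 'n) module" where "left_module S N" "carrier N = h ` carrier M" "h \<in> mod_iso S M N"
proof -
  interpret M: left_module S M by fact
  define k where "k = inv_into (carrier M) h"
  have k: "k (h x) = x" if "x \<in> carrier M" for x
    using that h by (simp add: k_def)
  define N :: "('s, 'n) module" where "N = \<lparr>carrier = h ` carrier M, mult = undefined, one = undefined, zero = h \<zero>\<^bsub>M\<^esub>,
    add = (\<lambda>x y. h (k x \<oplus>\<^bsub>M\<^esub> k y)), smult = (\<lambda>r x. h (r \<odot>\<^bsub>M\<^esub> k x))\<rparr>"
  have "left_module S N" "h \<in> mod_hom S M N"
    by (rule left_module_image[OF M]; simp add: N_def k)+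
  then show thesis
    using h by (intro that[of N]) (auto simp: mod_iso_def bij_betw_def N_def)
qed

text \<open>
  A quotient module is realised on a set of chosen coset representatives. So its carrier is
  a subset of the carrier of the given module, and it stays in every universe containing the latter.
\<close>

lemma quotient_module:
  fixes M :: "('s, 'm) module"
  assumes M: "left_module S M" and H: "submod S M H"
  obtains N :: "('s, 'm) module" and p where "left_module S N" "carrier N \<subseteq> carrier M" "p \<in> mod_hom S M N"
    "p ` carrier M = carrier N" "mod_kernel M N p = H"
proof -
  interpret M: left_module S M by fact
  have HM: "H \<subseteq> carrier M" and H0: "\<zero>\<^bsub>M\<^esub> \<in> H"
    and Ha: "\<And>x y. \<lbrakk>x \<in> H; y \<in> H\<rbrakk> \<Longrightarrow> x \<oplus>\<^bsub>M\<^esub> y \<in> H"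
    and Hs: "\<And>r x. \<lbrakk>r \<in> carrier S; x \<in> H\<rbrakk> \<Longrightarrow> r \<odot>\<^bsub>M\<^esub> x \<in> H"
    using H by (auto simp: submod_def)
  have Hm: "\<ominus>\<^bsub>M\<^esub> x \<in> H" if "x \<in> H" for x
    using that HM Hs by (simp add: M.minus_eq_smult subset_iff)
  define coset where "coset x = {x \<oplus>\<^bsub>M\<^esub> h |h. h \<in> H}" for x
  have coset_eq: "coset x = coset y \<longleftrightarrow> x \<ominus>\<^bsub>M\<^esub> y \<in> H" if "x \<in> carrier M" "y \<in> carrier M" for x y
  proof
    assume "coset x = coset y"
    moreover have "x \<in> coset x" using that H0 by (force simp: coset_def)
    ultimately obtain h where "h \<in> H" "x = y \<oplus>\<^bsub>M\<^esub> h" by (auto simp: coset_def)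
    then show "x \<ominus>\<^bsub>M\<^esub> y \<in> H"
      using that HM by (simp add: subset_iff a_minus_def M.M.a_ac M.M.r_neg)
  next
    have le: "coset x \<subseteq> coset y" if "x \<in> carrier M" "y \<in> carrier M" "x \<ominus>\<^bsub>M\<^esub> y \<in> H" for x y
    proof
      fix z assume "z \<in> coset x"
      then obtain h where h: "h \<in> H" "z = x \<oplus>\<^bsub>M\<^esub> h" by (auto simp: coset_def)
      have "z = y \<oplus>\<^bsub>M\<^esub> (x \<ominus>\<^bsub>M\<^esub> y \<oplus>\<^bsub>M\<^esub> h)"
        using h that(1,2) HM M.M.r_neg1[of y "x \<oplus>\<^bsub>M\<^esub> h"] M.M.r_neg2[of y "x \<oplus>\<^bsub>M\<^esub> h"]
        by (simp add: subset_iff a_minus_def M.M.a_ac)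
      then show "z \<in> coset y" using h that by (auto simp: coset_def intro: Ha)
    qed
    assume xy: "x \<ominus>\<^bsub>M\<^esub> y \<in> H"
    then have "\<ominus>\<^bsub>M\<^esub> (x \<ominus>\<^bsub>M\<^esub> y) \<in> H" by (rule Hm)
    then have "y \<ominus>\<^bsub>M\<^esub> x \<in> H"
      using that by (simp add: a_minus_def M.M.minus_add M.M.a_ac)
    with xy show "coset x = coset y"
      using le that by blast
  qed
  define p where "p x = inv_into (carrier M) coset (coset x)" for x
  have pM: "p x \<in> carrier M" if "x \<in> carrier M" for x
    unfolding p_def using that by (intro inv_into_into) auto
  have pc: "coset (p x) = coset x" if "x \<in> carrier M" for x
    unfolding p_def using that by (intro f_inv_into_f) auto
  have p_eq: "p x = p y \<longleftrightarrow> x \<ominus>\<^bsub>M\<^esub> y \<in> H" if "x \<in> carrier M" "y \<in> carrier M" for x y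
    using that by (metis coset_eq pc p_def)
  have pd: "x \<ominus>\<^bsub>M\<^esub> p x \<in> H" if "x \<in> carrier M" for x
    using that pc pM coset_eq by metis
  define N :: "('s, 'm) module" where "N = \<lparr>carrier = p ` carrier M, mult = undefined, one = undefined, zero = p \<zero>\<^bsub>M\<^esub>,
    add = (\<lambda>x y. p (x \<oplus>\<^bsub>M\<^esub> y)), smult = (\<lambda>r x. p (r \<odot>\<^bsub>M\<^esub> x))\<rparr>"
  have add: "p (x \<oplus>\<^bsub>M\<^esub> y) = p (p x \<oplus>\<^bsub>M\<^esub> p y)" if xy: "x \<in> carrier M" "y \<in> carrier M" for x y
  proof -
    have "x \<oplus>\<^bsub>M\<^esub> y \<ominus>\<^bsub>M\<^esub> (p x \<oplus>\<^bsub>M\<^esub> p y) = (x \<ominus>\<^bsub>M\<^esub> p x) \<oplus>\<^bsub>M\<^esub> (y \<ominus>\<^bsub>M\<^esub> p y)"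
      using xy pM by (simp add: a_minus_def M.M.minus_add M.M.a_ac)
    then show ?thesis using xy pM by (simp add: p_eq pd Ha)
  qed
  have smult: "p (r \<odot>\<^bsub>M\<^esub> x) = p (r \<odot>\<^bsub>M\<^esub> p x)" if rx: "r \<in> carrier S" "x \<in> carrier M" for r x
  proof -
    have "r \<odot>\<^bsub>M\<^esub> x \<ominus>\<^bsub>M\<^esub> r \<odot>\<^bsub>M\<^esub> p x = r \<odot>\<^bsub>M\<^esub> (x \<ominus>\<^bsub>M\<^esub> p x)"
      using rx pM by (simp add: a_minus_def M.smult_r_distr M.smult_minus_right)
    then show ?thesis using rx pM by (simp add: p_eq pd Hs M.smult_closed)
  qed
  have "left_module S N" "p \<in> mod_hom S M N"
    by (rule left_module_image[OF M]; simp add: N_def add[symmetric] smult[symmetric])+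
  moreover have "mod_kernel M N p = H"
    using HM by (auto simp: mod_kernel_def N_def p_eq subset_iff a_minus_def)
  ultimately show thesis
    using pM by (intro that[of N p]) (auto simp: N_def)
qed

lemma sum_module_simps [simp]:
  "carrier (sum_module M N) = carrier M \<times> carrier N"
  "\<zero>\<^bsub>sum_module M N\<^esub> = (\<zero>\<^bsub>M\<^esub>, \<zero>\<^bsub>N\<^esub>)"
  "(x, y) \<oplus>\<^bsub>sum_module M N\<^esub> (x', y') = (x \<oplus>\<^bsub>M\<^esub> x', y \<oplus>\<^bsub>N\<^esub> y')"
  "r \<odot>\<^bsub>sum_module M N\<^esub> (x, y) = (r \<odot>\<^bsub>M\<^esub> x, r \<odot>\<^bsub>N\<^esub> y)"
  by (auto simp: sum_module_def)

lemma left_module_sum: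
  assumes "left_module S M" "left_module S N"
  shows "left_module S (sum_module M N)"
proof -
  interpret M: left_module S M by fact
  interpret N: left_module S N by fact
  show ?thesis
  proof (rule left_moduleI)
    show "\<exists>y\<in>carrier (sum_module M N). y \<oplus>\<^bsub>sum_module M N\<^esub> x = \<zero>\<^bsub>sum_module M N\<^esub>"
      if "x \<in> carrier (sum_module M N)" for x
      using that
      by (intro bexI[of _ "(\<ominus>\<^bsub>M\<^esub> fst x, \<ominus>\<^bsub>N\<^esub> snd x)"]) (auto simp: M.M.l_neg N.M.l_neg)
  qed (auto simp: M.smult_closed M.smult_l_distr M.smult_r_distr M.smult_assoc M.smult_unital
      N.smult_closed N.smult_l_distr N.smult_r_distr N.smult_assoc N.smult_unital
      M.M.a_ac N.M.a_ac M.R.ring_axioms)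
qed

lemma left_module_prod:
  assumes "ring S" "\<And>i. i \<in> I \<Longrightarrow> left_module S (M i)"
  shows "left_module S (prod_module I M)"
proof -
  have ag: "abelian_group (M i)" if "i \<in> I" for i
    using assms(2)[OF that] by (simp add: left_module_def)
  then have am: "abelian_monoid (M i)" if "i \<in> I" for i
    using that by (simp add: abelian_group_def)
  note ax = left_module.smult_closed[OF assms(2)] left_module.smult_l_distr[OF assms(2)]
    left_module.smult_r_distr[OF assms(2)] left_module.smult_assoc[OF assms(2)]
    left_module.smult_unital[OF assms(2)] abelian_groupE(1,2)[OF ag]
    abelian_monoid.a_ac[OF am] abelian_monoid.l_zero[OF am] abelian_monoid.r_zero[OF am]
  show ?thesis
  proof (rule left_moduleI)
    show "\<exists>y\<in>carrier (prod_module I M). y \<oplus>\<^bsub>prod_module I M\<^esub> x = \<zero>\<^bsub>prod_module I M\<^esub>"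
      if "x \<in> carrier (prod_module I M)" for x
      using that
      by (intro bexI[of _ "\<lambda>i\<in>I. \<ominus>\<^bsub>M i\<^esub> x i"])
        (auto simp: prod_module_def PiE_iff fun_eq_iff abelian_group.l_neg[OF ag]
          abelian_group.a_inv_closed[OF ag])
  qed (use assms(1) in \<open>auto simp: prod_module_def PiE_iff fun_eq_iff ax extensional_def\<close>)
qed

definition pullback_module ::
  "('s, 'm) module \<Rightarrow> ('s, 'n) module \<Rightarrow> ('m \<Rightarrow> 'k) \<Rightarrow> ('n \<Rightarrow> 'k) \<Rightarrow> ('s, 'm \<times> 'n) module" where
  "pullback_module M N f g =
     (sum_module M N)\<lparr>carrier := {(x, y). x \<in> carrier M \<and> y \<in> carrier N \<and> f x = g y}\<rparr>"

lemma pullback_module_simps [simp]: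
  "carrier (pullback_module M N f g) = {(x, y). x \<in> carrier M \<and> y \<in> carrier N \<and> f x = g y}"
  "\<zero>\<^bsub>pullback_module M N f g\<^esub> = (\<zero>\<^bsub>M\<^esub>, \<zero>\<^bsub>N\<^esub>)"
  "(x, y) \<oplus>\<^bsub>pullback_module M N f g\<^esub> (x', y') = (x \<oplus>\<^bsub>M\<^esub> x', y \<oplus>\<^bsub>N\<^esub> y')"
  "r \<odot>\<^bsub>pullback_module M N f g\<^esub> (x, y) = (r \<odot>\<^bsub>M\<^esub> x, r \<odot>\<^bsub>N\<^esub> y)"
  by (auto simp: pullback_module_def)

lemma left_module_pullback:
  assumes "left_module S M" "left_module S N" "left_module S K"
    and "f \<in> mod_hom S M K" "g \<in> mod_hom S N K"
  shows "left_module S (pullback_module M N f g)"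
proof -
  interpret M: left_module S M by fact
  interpret N: left_module S N by fact
  show ?thesis
    unfolding pullback_module_def
  proof (rule submod_left_module[OF left_module_sum])
    show "submod S (sum_module M N) {(x, y). x \<in> carrier M \<and> y \<in> carrier N \<and> f x = g y}"
      using assms
      by (auto simp: submod_def mod_hom_zero[of S M K] mod_hom_zero[of S N K] mod_hom_add mod_hom_smult
          M.smult_closed N.smult_closed)
  qed fact+
qed

lemma pullback_fst: "fst \<in> mod_hom S (pullback_module M N f g) M"
  by (auto simp: mod_hom_def)

lemma pullback_snd: "snd \<in> mod_hom S (pullback_module M N f g) N"
  by (auto simp: mod_hom_def)

lemma pullback_fst_surj:
  assumes "f \<in> mod_hom S M K" "g ` carrier N = carrier K"
  shows "fst ` carrier (pullback_module M N f g) = carrier M"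
proof
  show "carrier M \<subseteq> fst ` carrier (pullback_module M N f g)"
  proof
    fix x assume x: "x \<in> carrier M"
    then have "f x \<in> g ` carrier N" unfolding assms(2) by (rule mod_hom_closed[OF assms(1)])
    then obtain y where "y \<in> carrier N" "f x = g y" by blast
    then show "x \<in> fst ` carrier (pullback_module M N f g)"
      using x by (intro image_eqI[of _ _ "(x, y)"]) simp_all
  qed
qed auto

lemma pullback_snd_surj:
  assumes "g \<in> mod_hom S N K" "f ` carrier M = carrier K"
  shows "snd ` carrier (pullback_module M N f g) = carrier N"
proof
  show "carrier N \<subseteq> snd ` carrier (pullback_module M N f g)"
  proof
    fix y assume y: "y \<in> carrier N"
    then have "g y \<in> f ` carrier M" unfolding assms(2) by (rule mod_hom_closed[OF assms(1)])
    then obtain x where "x \<in> carrier M" "g y = f x" by blast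
    then show "y \<in> snd ` carrier (pullback_module M N f g)"
      using y by (intro image_eqI[of _ _ "(x, y)"]) simp_all
  qed
qed auto

section \<open>Small sets and the category of small modules\<close>

definition small :: "'u set set \<Rightarrow> 'x set \<Rightarrow> bool" where
  "small \<U> X \<longleftrightarrow> (\<exists>T\<in>\<U>. X \<lesssim> T)"

lemma small_lepoll: "\<lbrakk>small \<U> X; Y \<lesssim> X\<rbrakk> \<Longrightarrow> small \<U> Y"
  unfolding small_def using lepoll_trans by blast

lemma small_subset: "\<lbrakk>small \<U> X; Y \<subseteq> X\<rbrakk> \<Longrightarrow> small \<U> Y"
  by (erule small_lepoll) (rule subset_imp_lepoll)

lemma small_member: "X \<in> \<U> \<Longrightarrow> small \<U> X"
  unfolding small_def by blast

text \<open>
  The conditions on a universe that concern a single ring of scalars, so that the same results apply to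
  both rings.
\<close>

locale module_category =
  fixes \<U> :: "'u set set" and S :: "'s ring"
  assumes scalars: "ring S"
    and lepoll_member: "\<lbrakk>T \<in> \<U>; T' \<lesssim> T\<rbrakk> \<Longrightarrow> T' \<in> \<U>"
    and countable_product: "\<And>T :: nat \<Rightarrow> 'u set. (\<And>n. T n \<in> \<U>) \<Longrightarrow> \<exists>V\<in>\<U>. (\<Pi>\<^sub>E n\<in>UNIV. T n) \<lesssim> V"
    and small_scalars: "small \<U> (carrier S)"
begin

lemma small_sequences:
  fixes X :: "nat \<Rightarrow> 'x set"
  assumes "\<And>n. small \<U> (X n)"
  shows "small \<U> (\<Pi>\<^sub>E n\<in>UNIV. X n)"
proof -
  obtain T where T: "\<And>n. T n \<in> \<U>" "\<And>n. X n \<lesssim> T n"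
    using assms unfolding small_def by metis
  have "(\<Pi>\<^sub>E n\<in>UNIV. X n) \<lesssim> (\<Pi>\<^sub>E n\<in>UNIV. T n)"
    by (rule lepoll_PiE) (rule T(2))
  moreover obtain V where "V \<in> \<U>" "(\<Pi>\<^sub>E n\<in>UNIV. T n) \<lesssim> V"
    using countable_product T(1) by blast
  ultimately show ?thesis
    unfolding small_def using lepoll_trans by blast
qed

lemma small_Times:
  assumes X: "small \<U> X" and Y: "small \<U> Y"
  shows "small \<U> (X \<times> Y)"
proof -
  let ?Z = "\<lambda>n :: nat. if n = 0 then Inl ` X else Inr ` Y"
  have "small \<U> (?Z n)" for n
    by (auto intro: small_lepoll[OF X] small_lepoll[OF Y] image_lepoll)
  then have "small \<U> (\<Pi>\<^sub>E n\<in>UNIV. ?Z n)" by (rule small_sequences)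
  moreover have "X \<times> Y \<lesssim> (\<Pi>\<^sub>E n\<in>UNIV. ?Z n)"
    unfolding lepoll_def
  proof (intro exI conjI)
    let ?g = "\<lambda>(x, y) n :: nat. if n = 0 then Inl x else Inr y"
    show "inj_on ?g (X \<times> Y)"
    proof (rule inj_onI)
      fix a b assume eq: "?g a = ?g b"
      show "a = b"
        using fun_cong[OF eq, of 0] fun_cong[OF eq, of 1] by (cases a; cases b) simp
    qed
  qed auto
  ultimately show ?thesis by (rule small_lepoll)
qed

text \<open>
  A finitely supported function is determined by its graph over the support, a finite set, which can be
  listed as a sequence of pairs. This bounds a free module without any arithmetic of cardinals.
\<close>

lemma small_finite_support:
  assumes X: "small \<U> X" and Y: "small \<U> Y" and x0: "x0 \<in> X"
  shows "small \<U> {v \<in> X \<rightarrow>\<^sub>E Y. finite {x \<in> X. v x \<noteq> z}}"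
proof -
  let ?V = "{v \<in> X \<rightarrow>\<^sub>E Y. finite {x \<in> X. v x \<noteq> z}}"
  define graph where "graph v = (\<lambda>x. (x, v x)) ` insert x0 {x \<in> X. v x \<noteq> z}" for v :: "_ \<Rightarrow> _"
  have range: "range (from_nat_into (graph v)) = graph v" if "v \<in> ?V" for v
    using that by (intro range_from_nat_into countable_finite) (auto simp: graph_def)
  have "small \<U> (\<Pi>\<^sub>E n\<in>(UNIV :: nat set). X \<times> Y)"
    by (intro small_sequences small_Times X Y)
  moreover have "?V \<lesssim> (\<Pi>\<^sub>E n\<in>(UNIV :: nat set). X \<times> Y)"
    unfolding lepoll_def
  proof (intro exI conjI)
    show "inj_on (\<lambda>v. from_nat_into (graph v)) ?V"
    proof (rule inj_onI, rule ext)
      fix v w x assume v: "v \<in> ?V" and w: "w \<in> ?V"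
        and eq: "from_nat_into (graph v) = from_nat_into (graph w)"
      have g: "graph v = graph w"
        using range[OF v] range[OF w] unfolding eq by simp
      have mem: "(x, y) \<in> graph v \<longleftrightarrow> x \<in> X \<and> y = v x \<and> (x = x0 \<or> v x \<noteq> z)" for v y
        using x0 by (auto simp: graph_def)
      show "v x = w x"
      proof (cases "x \<in> X")
        case True
        then show ?thesis using mem[of "v x" v] mem[of "v x" w] mem[of "w x" v] mem[of "w x" w] unfolding g by metis
      next
        case False
        then show ?thesis using v w by (auto simp: PiE_iff extensional_def)
      qed
    qed
    show "(\<lambda>v. from_nat_into (graph v)) ` ?V \<subseteq> (\<Pi>\<^sub>E n\<in>(UNIV :: nat set). X \<times> Y)"
    proof (intro image_subsetI PiE_I)
      fix v n assume v: "v \<in> ?V"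
      have "from_nat_into (graph v) n \<in> graph v" using range[OF v] by (metis rangeI)
      moreover have "graph v \<subseteq> X \<times> Y" using v x0 by (auto simp: graph_def)
      ultimately show "from_nat_into (graph v) n \<in> X \<times> Y" by blast
    qed auto
  qed
  ultimately show ?thesis by (rule small_lepoll)
qed

lemma left_modulesD:
  "M \<in> left_modules \<U> S \<Longrightarrow> left_module S M"
  "M \<in> left_modules \<U> S \<Longrightarrow> small \<U> (carrier M)"
  by (auto simp: left_modules_def small_member)

lemma left_modules_submod:
  assumes "M \<in> left_modules \<U> S" "submod S M H"
  shows "M\<lparr>carrier := H\<rparr> \<in> left_modules \<U> S"
proof -
  have "H \<lesssim> carrier M" using assms(2) by (auto simp: submod_def intro: subset_imp_lepoll)
  then show ?thesis
    using assms lepoll_member by (auto simp: left_modules_def submod_left_module)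
qed

lemma left_modules_kernel:
  assumes "M \<in> left_modules \<U> S" "left_module S N" "h \<in> mod_hom S M N"
  shows "kernel_module M N h \<in> left_modules \<U> S"
  using assms by (intro left_modules_submod submod_kernel) (auto simp: left_modules_def)

lemma small_pullback:
  "\<lbrakk>small \<U> (carrier M); small \<U> (carrier N)\<rbrakk> \<Longrightarrow> small \<U> (carrier (pullback_module M N f g))"
  by (rule small_subset[OF small_Times]) auto

lemma small_copy_exists:
  assumes "left_module S M" "small \<U> (carrier M)"
  obtains N h k where "N \<in> left_modules \<U> S" "h \<in> mod_iso S M N" "k \<in> mod_iso S N M"
    "\<And>x. x \<in> carrier M \<Longrightarrow> k (h x) = x" "\<And>y. y \<in> carrier N \<Longrightarrow> h (k y) = y"
proof -
  obtain T h where T: "T \<in> \<U>" and h: "inj_on h (carrier M)" "h ` carrier M \<subseteq> T"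
    using assms(2) unfolding small_def lepoll_def by blast
  obtain N where N: "left_module S N" "carrier N = h ` carrier M" "h \<in> mod_iso S M N"
    using module_copy[OF assms(1) h(1)] by blast
  show thesis
  proof (rule that[OF _ N(3) mod_iso_inv_into[OF assms(1) N(3)]])
    show "N \<in> left_modules \<U> S"
      using T h N by (auto simp: left_modules_def intro: lepoll_member subset_imp_lepoll)
    show "inv_into (carrier M) h (h x) = x" if "x \<in> carrier M" for x
      by (rule inv_into_f_f[OF h(1) that])
    show "h (inv_into (carrier M) h y) = y" if "y \<in> carrier N" for y
      using that unfolding N(2) by (rule f_inv_into_f)
  qed
qed

end

section \<open>Free modules and projective resolutions\<close>

lemma left_module_regular:
  assumes "ring S" shows "left_module S (regular_module S)"
proof -
  interpret ring S by fact
  show ?thesis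
    by (rule left_moduleI)
      (auto simp: regular_module_def a_ac l_distr r_distr m_assoc intro: ring_axioms bexI[of _ "\<ominus>\<^bsub>S\<^esub> _"] l_neg)
qed

definition free_module :: "'s ring \<Rightarrow> 'x set \<Rightarrow> ('s, 'x \<Rightarrow> 's) module" where
  "free_module S X = (prod_module X (\<lambda>_. regular_module S))
     \<lparr>carrier := {v \<in> X \<rightarrow>\<^sub>E carrier S. finite {x \<in> X. v x \<noteq> \<zero>\<^bsub>S\<^esub>}}\<rparr>"

definition basis_vector :: "'s ring \<Rightarrow> 'x set \<Rightarrow> 'x \<Rightarrow> 'x \<Rightarrow> 's" where
  "basis_vector S X x = (\<lambda>y\<in>X. if y = x then \<one>\<^bsub>S\<^esub> else \<zero>\<^bsub>S\<^esub>)"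

definition free_lift :: "'s ring \<Rightarrow> 'x set \<Rightarrow> ('s, 'm) module \<Rightarrow> ('x \<Rightarrow> 'm) \<Rightarrow> ('x \<Rightarrow> 's) \<Rightarrow> 'm" where
  "free_lift S X M h v = (\<Oplus>\<^bsub>M\<^esub>x\<in>{x \<in> X. v x \<noteq> \<zero>\<^bsub>S\<^esub>}. v x \<odot>\<^bsub>M\<^esub> h x)"

lemma free_module_simps:
  "carrier (free_module S X) = {v \<in> X \<rightarrow>\<^sub>E carrier S. finite {x \<in> X. v x \<noteq> \<zero>\<^bsub>S\<^esub>}}"
  "\<zero>\<^bsub>free_module S X\<^esub> = (\<lambda>x\<in>X. \<zero>\<^bsub>S\<^esub>)"
  "v \<oplus>\<^bsub>free_module S X\<^esub> w = (\<lambda>x\<in>X. v x \<oplus>\<^bsub>S\<^esub> w x)"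
  "r \<odot>\<^bsub>free_module S X\<^esub> v = (\<lambda>x\<in>X. r \<otimes>\<^bsub>S\<^esub> v x)"
  by (simp_all add: free_module_def prod_module_def regular_module_def)

lemma left_module_free:
  assumes "ring S" shows "left_module S (free_module S X)"
proof -
  interpret ring S by fact
  show ?thesis
    unfolding free_module_def
  proof (rule submod_left_module[OF left_module_prod[OF assms left_module_regular[OF assms]]])
    have fin: "finite {x \<in> X. (\<lambda>x\<in>X. v x \<oplus>\<^bsub>S\<^esub> w x) x \<noteq> \<zero>\<^bsub>S\<^esub>}"
      if "finite {x \<in> X. v x \<noteq> \<zero>\<^bsub>S\<^esub>}" "finite {x \<in> X. w x \<noteq> \<zero>\<^bsub>S\<^esub>}" for v w
      by (rule finite_subset[of _ "{x \<in> X. v x \<noteq> \<zero>\<^bsub>S\<^esub>} \<union> {x \<in> X. w x \<noteq> \<zero>\<^bsub>S\<^esub>}"]) (use that in auto)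
    have fin': "finite {x \<in> X. (\<lambda>x\<in>X. r \<otimes>\<^bsub>S\<^esub> v x) x \<noteq> \<zero>\<^bsub>S\<^esub>}"
      if "finite {x \<in> X. v x \<noteq> \<zero>\<^bsub>S\<^esub>}" "r \<in> carrier S" for v r
      by (rule finite_subset[of _ "{x \<in> X. v x \<noteq> \<zero>\<^bsub>S\<^esub>}"]) (use that in auto)
    show "submod S (prod_module X (\<lambda>_. regular_module S))
        {v \<in> X \<rightarrow>\<^sub>E carrier S. finite {x \<in> X. v x \<noteq> \<zero>\<^bsub>S\<^esub>}}"
      using fin fin' by (auto simp: submod_def prod_module_def regular_module_def)
  qed
qed

lemma free_lift_superset:
  assumes "left_module S M" "h \<in> X \<rightarrow> carrier M" "v \<in> X \<rightarrow>\<^sub>E carrier S"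
    and "finite B" "B \<subseteq> X" "{x \<in> X. v x \<noteq> \<zero>\<^bsub>S\<^esub>} \<subseteq> B"
  shows "free_lift S X M h v = (\<Oplus>\<^bsub>M\<^esub>x\<in>B. v x \<odot>\<^bsub>M\<^esub> h x)"
proof -
  interpret M: left_module S M by fact
  show ?thesis
    unfolding free_lift_def
    using assms(2-6)
    by (intro M.M.add.finprod_mono_neutral_cong_left)
      (auto intro!: M.smult_closed simp: Pi_iff PiE_iff subset_iff)
qed

lemma free_lift_hom:
  assumes M: "left_module S M" and h: "h \<in> X \<rightarrow> carrier M"
  shows "free_lift S X M h \<in> mod_hom S (free_module S X) M"
proof -
  interpret M: left_module S M by fact
  have summand: "v x \<odot>\<^bsub>M\<^esub> h x \<in> carrier M" if "v \<in> X \<rightarrow>\<^sub>E carrier S" "x \<in> X" for v x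
    using that h by (auto intro!: M.smult_closed)
  show ?thesis
  proof (rule mod_homI)
    fix v assume "v \<in> carrier (free_module S X)"
    then show "free_lift S X M h v \<in> carrier M"
      by (auto simp: free_lift_def free_module_simps intro!: M.M.finsum_closed summand)
  next
    fix v w assume v: "v \<in> carrier (free_module S X)" and w: "w \<in> carrier (free_module S X)"
    let ?B = "{x \<in> X. v x \<noteq> \<zero>\<^bsub>S\<^esub>} \<union> {x \<in> X. w x \<noteq> \<zero>\<^bsub>S\<^esub>}"
    have fin: "finite ?B" and vw: "v \<in> X \<rightarrow>\<^sub>E carrier S" "w \<in> X \<rightarrow>\<^sub>E carrier S"
      using v w by (auto simp: free_module_simps)
    have cl: "v x \<in> carrier S" "w x \<in> carrier S" "h x \<in> carrier M" if "x \<in> X" for x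
      using vw h that by auto
    have "free_lift S X M h (v \<oplus>\<^bsub>free_module S X\<^esub> w) = (\<Oplus>\<^bsub>M\<^esub>x\<in>?B. (v x \<oplus>\<^bsub>S\<^esub> w x) \<odot>\<^bsub>M\<^esub> h x)"
      using fin vw cl
      by (subst free_lift_superset[OF M h _ fin])
        (auto simp: free_module_simps intro!: M.M.add.finprod_cong' M.smult_closed)
    also have "\<dots> = (\<Oplus>\<^bsub>M\<^esub>x\<in>?B. v x \<odot>\<^bsub>M\<^esub> h x \<oplus>\<^bsub>M\<^esub> w x \<odot>\<^bsub>M\<^esub> h x)"
      using cl by (intro M.M.add.finprod_cong') (auto simp: M.smult_l_distr intro!: M.smult_closed)
    also have "\<dots> = (\<Oplus>\<^bsub>M\<^esub>x\<in>?B. v x \<odot>\<^bsub>M\<^esub> h x) \<oplus>\<^bsub>M\<^esub> (\<Oplus>\<^bsub>M\<^esub>x\<in>?B. w x \<odot>\<^bsub>M\<^esub> h x)"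
      by (rule M.M.finsum_addf) (use summand vw in auto)
    also have "\<dots> = free_lift S X M h v \<oplus>\<^bsub>M\<^esub> free_lift S X M h w"
      using free_lift_superset[OF M h vw(1) fin] free_lift_superset[OF M h vw(2) fin] by auto
    finally show "free_lift S X M h (v \<oplus>\<^bsub>free_module S X\<^esub> w) = free_lift S X M h v \<oplus>\<^bsub>M\<^esub> free_lift S X M h w" .
  next
    fix r v assume r: "r \<in> carrier S" and v: "v \<in> carrier (free_module S X)"
    let ?B = "{x \<in> X. v x \<noteq> \<zero>\<^bsub>S\<^esub>}"
    have fin: "finite ?B" and vX: "v \<in> X \<rightarrow>\<^sub>E carrier S"
      using v by (auto simp: free_module_simps)
    have cl: "v x \<in> carrier S" "h x \<in> carrier M" if "x \<in> X" for x
      using vX h that by auto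
    have smult_sum: "(\<Oplus>\<^bsub>M\<^esub>x\<in>B. r \<odot>\<^bsub>M\<^esub> f x) = r \<odot>\<^bsub>M\<^esub> (\<Oplus>\<^bsub>M\<^esub>x\<in>B. f x)"
      if "finite B" "f \<in> B \<rightarrow> carrier M" for B and f :: "_ \<Rightarrow> _"
      using that
    proof (induction B rule: finite_induct)
      case empty then show ?case using r by simp
    next
      case (insert b B)
      then have "f \<in> B \<rightarrow> carrier M" "f b \<in> carrier M" by auto
      then show ?case
        using insert r by (subst M.M.finsum_insert; (auto simp: M.smult_closed Pi_iff)?)
          (auto simp: M.smult_r_distr M.M.finsum_insert Pi_iff)
    qed
    have "free_lift S X M h (r \<odot>\<^bsub>free_module S X\<^esub> v) = (\<Oplus>\<^bsub>M\<^esub>x\<in>?B. (r \<otimes>\<^bsub>S\<^esub> v x) \<odot>\<^bsub>M\<^esub> h x)"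
      using fin vX cl r
      by (subst free_lift_superset[OF M h _ fin])
        (auto simp: free_module_simps intro!: M.M.add.finprod_cong' M.smult_closed)
    also have "\<dots> = (\<Oplus>\<^bsub>M\<^esub>x\<in>?B. r \<odot>\<^bsub>M\<^esub> (v x \<odot>\<^bsub>M\<^esub> h x))"
      using cl r by (intro M.M.add.finprod_cong') (auto simp: M.smult_assoc intro!: M.smult_closed)
    also have "\<dots> = r \<odot>\<^bsub>M\<^esub> free_lift S X M h v"
      unfolding free_lift_def using cl fin by (intro smult_sum) (auto intro!: M.smult_closed)
    finally show "free_lift S X M h (r \<odot>\<^bsub>free_module S X\<^esub> v) = r \<odot>\<^bsub>M\<^esub> free_lift S X M h v" .
  qed
qed

lemma basis_vector_closed:
  assumes "ring S" "x \<in> X" shows "basis_vector S X x \<in> carrier (free_module S X)"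
proof -
  interpret ring S by fact
  have "finite {y \<in> X. basis_vector S X x y \<noteq> \<zero>\<^bsub>S\<^esub>}"
    by (rule finite_subset[of _ "{x}"]) (auto simp: basis_vector_def)
  then show ?thesis by (auto simp: free_module_simps basis_vector_def)
qed

lemma free_lift_basis:
  assumes M: "left_module S M" and h: "h \<in> X \<rightarrow> carrier M" and x: "x \<in> X"
  shows "free_lift S X M h (basis_vector S X x) = h x"
proof -
  interpret M: left_module S M by fact
  have "basis_vector S X x \<in> X \<rightarrow>\<^sub>E carrier S"
    using basis_vector_closed[OF M.R.ring_axioms x] by (simp add: free_module_simps)
  then have "free_lift S X M h (basis_vector S X x) = (\<Oplus>\<^bsub>M\<^esub>y\<in>{x}. basis_vector S X x y \<odot>\<^bsub>M\<^esub> h y)"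
    by (rule free_lift_superset[OF M h]) (use x in \<open>auto simp: basis_vector_def\<close>)
  also have "\<dots> = h x"
    using x h by (auto simp: basis_vector_def M.M.finsum_insert M.smult_unital Pi_iff)
  finally show ?thesis .
qed

text \<open>By induction on a finite set that contains the support: split off one basis vector at a time.\<close>

lemma free_hom_eqI:
  assumes S: "ring S" and N: "left_module S N"
    and f: "f \<in> mod_hom S (free_module S X) N" and g: "g \<in> mod_hom S (free_module S X) N"
    and eq: "\<And>x. x \<in> X \<Longrightarrow> f (basis_vector S X x) = g (basis_vector S X x)"
    and v: "v \<in> carrier (free_module S X)"
  shows "f v = g v"
proof -
  interpret ring S by fact
  let ?F = "free_module S X"
  have "\<forall>v\<in>carrier ?F. {x \<in> X. v x \<noteq> \<zero>\<^bsub>S\<^esub>} \<subseteq> B \<longrightarrow> f v = g v" if "finite B" for B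
    using that
  proof (induction B rule: finite_induct)
    case empty
    show ?case
    proof (intro ballI impI)
      fix v assume "v \<in> carrier ?F" "{x \<in> X. v x \<noteq> \<zero>\<^bsub>S\<^esub>} \<subseteq> {}"
      then have "v = \<zero>\<^bsub>?F\<^esub>"
        by (auto simp: free_module_simps PiE_iff extensional_def fun_eq_iff)
      then show "f v = g v"
        using mod_hom_zero[OF left_module_free[OF S] N] f g by metis
    qed
  next
    case (insert x B)
    show ?case
    proof (intro ballI impI)
      fix v assume v: "v \<in> carrier ?F" and vB: "{x \<in> X. v x \<noteq> \<zero>\<^bsub>S\<^esub>} \<subseteq> insert x B"
      show "f v = g v"
      proof (cases "x \<in> X")
        case False
        then show ?thesis using insert v vB by (metis (no_types, lifting) mem_Collect_eq subset_insert)
      next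
        case True
        let ?w = "v(x := \<zero>\<^bsub>S\<^esub>)"
        have fin: "finite {y \<in> X. ?w y \<noteq> \<zero>\<^bsub>S\<^esub>}"
          by (rule finite_subset[OF _ insert.hyps(1)]) (use vB in auto)
        have w: "?w \<in> carrier ?F" "{y \<in> X. ?w y \<noteq> \<zero>\<^bsub>S\<^esub>} \<subseteq> B"
          using v vB True fin by (auto simp: free_module_simps PiE_iff extensional_def)
        have vx: "v x \<in> carrier S" using v True by (auto simp: free_module_simps)
        have b: "basis_vector S X x \<in> carrier ?F" by (rule basis_vector_closed[OF S True])
        have sb: "v x \<odot>\<^bsub>?F\<^esub> basis_vector S X x \<in> carrier ?F"
          using left_module.smult_closed[OF left_module_free[OF S] vx b] .
        have "v = ?w \<oplus>\<^bsub>?F\<^esub> v x \<odot>\<^bsub>?F\<^esub> basis_vector S X x"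
          using v True by (auto simp: free_module_simps basis_vector_def fun_eq_iff PiE_iff extensional_def)
        then have split: "h v = h ?w \<oplus>\<^bsub>N\<^esub> v x \<odot>\<^bsub>N\<^esub> h (basis_vector S X x)" if "h \<in> mod_hom S ?F N" for h
          using mod_hom_add[OF that w(1) sb] mod_hom_smult[OF that vx b] by simp
        have "f ?w = g ?w" using insert.IH w by blast
        then show ?thesis unfolding split[OF f] split[OF g] eq[OF True] by simp
      qed
    qed
  qed
  then show ?thesis using v by (auto simp: free_module_simps)
qed

context module_category
begin

lemma enough_projectives:
  assumes M: "M \<in> left_modules \<U> S"
  obtains P e where "projective_module \<U> S P" "e \<in> mod_hom S P M" "e ` carrier P = carrier M"
proof -
  let ?X = "carrier M"
  let ?F = "free_module S ?X"
  note M' = left_modulesD[OF M]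
  interpret M: left_module S M by (rule M')
  have F: "left_module S ?F" by (rule left_module_free[OF scalars])
  have "small \<U> (carrier ?F)"
    unfolding free_module_simps using small_finite_support[OF M'(2) small_scalars M.M.zero_closed] .
  then obtain P h k where P: "P \<in> left_modules \<U> S" and h: "h \<in> mod_iso S ?F P"
    and k: "k \<in> mod_iso S P ?F" and kh: "\<And>v. v \<in> carrier ?F \<Longrightarrow> k (h v) = v"
    and hk: "\<And>x. x \<in> carrier P \<Longrightarrow> h (k x) = x"
    using small_copy_exists[OF F] by metis
  have "projective_module \<U> S P"
    unfolding projective_module_def
  proof (intro conjI ballI impI P)
    fix L N p f
    assume L: "L \<in> left_modules \<U> S" and N: "N \<in> left_modules \<U> S"
      and p: "p \<in> mod_hom S L N" "p ` carrier L = carrier N" and f: "f \<in> mod_hom S P N"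
    have fh: "(\<lambda>v. f (h v)) \<in> mod_hom S ?F N"
      using mod_hom_comp[OF mod_isoD(1)[OF h] f] .
    \<comment> \<open>Choose preimages of the images of the basis vectors, and extend linearly.\<close>
    define l where "l x = inv_into (carrier L) p (f (h (basis_vector S ?X x)))" for x
    have l: "l x \<in> carrier L" "p (l x) = f (h (basis_vector S ?X x))" if "x \<in> ?X" for x
    proof -
      have "f (h (basis_vector S ?X x)) \<in> p ` carrier L"
        using mod_hom_closed[OF fh basis_vector_closed[OF scalars that]] p(2) by simp
      then show "l x \<in> carrier L" "p (l x) = f (h (basis_vector S ?X x))"
        unfolding l_def by (auto simp: inv_into_into f_inv_into_f)
    qed
    have lift: "free_lift S ?X L l \<in> mod_hom S ?F L"
      using l by (intro free_lift_hom left_modulesD[OF L]) auto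
    have eq: "p (free_lift S ?X L l v) = f (h v)" if "v \<in> carrier ?F" for v
    proof (rule free_hom_eqI[OF scalars left_modulesD(1)[OF N] mod_hom_comp[OF lift p(1)] fh _ that])
      show "p (free_lift S ?X L l (basis_vector S ?X x)) = f (h (basis_vector S ?X x))" if "x \<in> ?X" for x
        using l that by (subst free_lift_basis[OF left_modulesD(1)[OF L]]) auto
    qed
    have "p (free_lift S ?X L l (k x)) = f x" if "x \<in> carrier P" for x
      using eq[OF mod_hom_closed[OF mod_isoD(1)[OF k] that]] hk[OF that] by simp
    then show "\<exists>g\<in>mod_hom S P L. \<forall>x\<in>carrier P. p (g x) = f x"
      by (intro bexI[OF _ mod_hom_comp[OF mod_isoD(1)[OF k] lift]]) simp
  qed
  moreover
  let ?e = "\<lambda>y. free_lift S ?X M (\<lambda>x. x) (k y)"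
  have lift: "free_lift S ?X M (\<lambda>x. x) \<in> mod_hom S ?F M"
    by (intro free_lift_hom M') auto
  have e: "?e \<in> mod_hom S P M"
    by (rule mod_hom_comp[OF mod_isoD(1)[OF k] lift])
  moreover have "?e ` carrier P = carrier M"
  proof
    show "?e ` carrier P \<subseteq> carrier M" using mod_hom_closed[OF e] by auto
    show "carrier M \<subseteq> ?e ` carrier P"
    proof
      fix x assume x: "x \<in> carrier M"
      have b: "basis_vector S ?X x \<in> carrier ?F" by (rule basis_vector_closed[OF scalars x])
      have "x = ?e (h (basis_vector S ?X x))"
        using x by (simp add: kh[OF b] free_lift_basis[OF M'(1)])
      then show "x \<in> ?e ` carrier P"
        using mod_hom_closed[OF mod_isoD(1)[OF h] b] by (metis imageI)
    qed
  qed
  ultimately show thesis by (rule that)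
qed

lemma projective_left_module: "projective_module \<U> S P \<Longrightarrow> P \<in> left_modules \<U> S"
  by (simp add: projective_module_def)

lemma projective_resolution_exists:
  assumes X: "X \<in> left_modules \<U> S"
  obtains P d \<epsilon> where "projective_resolution \<U> S X P d \<epsilon>"
proof -
  have "\<forall>M. \<exists>P e. M \<in> left_modules \<U> S \<longrightarrow>
      projective_module \<U> S P \<and> e \<in> mod_hom S P M \<and> e ` carrier P = carrier M"
    using enough_projectives by metis
  then obtain P e where Pe: "\<And>M. M \<in> left_modules \<U> S \<Longrightarrow> projective_module \<U> S (P M)"
    "\<And>M. M \<in> left_modules \<U> S \<Longrightarrow> e M \<in> mod_hom S (P M) M"
    "\<And>M. M \<in> left_modules \<U> S \<Longrightarrow> e M ` carrier (P M) = carrier M"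
    by metis
  \<comment> \<open>\<open>Z\<close> is the sequence of syzygies: each is the kernel of the chosen cover of its predecessor.\<close>
  define Z where "Z n = ((\<lambda>M. kernel_module (P M) M (e M)) ^^ n) X" for n
  have Z0: "Z 0 = X" and ZS: "Z (Suc n) = kernel_module (P (Z n)) (Z n) (e (Z n))" for n
    by (simp_all add: Z_def)
  have Z: "Z n \<in> left_modules \<U> S" for n
  proof (induction n)
    case (Suc n)
    then show ?case
      unfolding ZS using Pe left_modulesD(1) projective_left_module by (intro left_modules_kernel) auto
  qed (simp add: Z0 X)
  have img: "mod_kernel (P (Z n)) (Z n) (e (Z n)) = e (Z (Suc n)) ` carrier (P (Z (Suc n)))" for n
    using Pe(3)[OF Z, of "Suc n"] by (simp add: ZS)
  have d: "e (Z (Suc n)) \<in> mod_hom S (P (Z (Suc n))) (P (Z n))" for n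
  proof (rule mod_hom_from_sub_codomain)
    show "e (Z (Suc n)) \<in> mod_hom S (P (Z (Suc n))) (kernel_module (P (Z n)) (Z n) (e (Z n)))"
      using Pe(2)[OF Z, of "Suc n"] by (simp add: ZS)
  qed (auto simp: mod_kernel_def)
  have ker: "mod_kernel (P (Z (Suc n))) (P (Z n)) f = mod_kernel (P (Z (Suc n))) (Z (Suc n)) f" for n f
    by (simp add: mod_kernel_def ZS)
  have "projective_resolution \<U> S X (\<lambda>n. P (Z n)) (\<lambda>n. e (Z (Suc n))) (e X)"
    unfolding projective_resolution_def ker
    using Pe[OF Z] d img[of 0] img Pe[OF X] by (auto simp: Z0)
  then show thesis by (rule that)
qed

end

section \<open>Vanishing of the first extension group\<close>

text \<open>
  The condition \<open>Ext\<^sup>1(X, Y) = 0\<close> says that a map into \<open>Y\<close> defined on the kernel of a surjection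
  \<open>E \<rightarrow> X\<close> always extends to \<open>E\<close>. In this form it needs no resolutions, and the modules \<open>X\<close> and
  \<open>Y\<close> may have elements of any type.
\<close>

definition ext1_vanishes :: "'u set set \<Rightarrow> 's ring \<Rightarrow> ('s, 'x) module \<Rightarrow> ('s, 'y) module \<Rightarrow> bool" where
  "ext1_vanishes \<U> S X Y \<longleftrightarrow>
     (\<forall>E\<in>left_modules \<U> S. \<forall>p\<in>mod_hom S E X. p ` carrier E = carrier X \<longrightarrow>
        (\<forall>f\<in>mod_hom S (kernel_module E X p) Y. \<exists>g\<in>mod_hom S E Y. \<forall>x\<in>mod_kernel E X p. g x = f x))"

lemma factor_through_surjection:
  assumes D: "left_module S D" and E: "left_module S E" and Y: "left_module S Y"
    and q: "q \<in> mod_hom S D E" "q ` carrier D = carrier E" and h: "h \<in> mod_hom S D Y"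
    and ker: "\<And>x. \<lbrakk>x \<in> carrier D; q x = \<zero>\<^bsub>E\<^esub>\<rbrakk> \<Longrightarrow> h x = \<zero>\<^bsub>Y\<^esub>"
  obtains g where "g \<in> mod_hom S E Y" "\<And>x. x \<in> carrier D \<Longrightarrow> g (q x) = h x"
proof -
  interpret D: left_module S D by fact
  interpret E: left_module S E by fact
  interpret Y: left_module S Y by fact
  have eq: "h x = h y" if "x \<in> carrier D" "y \<in> carrier D" "q x = q y" for x y
  proof -
    have "q (x \<ominus>\<^bsub>D\<^esub> y) = \<zero>\<^bsub>E\<^esub>"
      using that mod_hom_closed[OF q(1)] by (simp add: mod_hom_diff[OF D E q(1)] E.diff_eq_zero_iff)
    then have "h (x \<ominus>\<^bsub>D\<^esub> y) = \<zero>\<^bsub>Y\<^esub>" using that by (intro ker) simp_all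
    then show ?thesis
      using that mod_hom_closed[OF h] by (simp add: mod_hom_diff[OF D Y h] Y.diff_eq_zero_iff)
  qed
  define g where "g y = h (inv_into (carrier D) q y)" for y
  have g: "g (q x) = h x" if "x \<in> carrier D" for x
  proof -
    have "q x \<in> q ` carrier D" using that by blast
    then show ?thesis
      unfolding g_def by (intro eq that inv_into_into f_inv_into_f)
  qed
  have "g \<in> mod_hom S E Y"
  proof (rule mod_homI)
    fix x assume "x \<in> carrier E"
    then obtain x' where "x' \<in> carrier D" "x = q x'" using q(2) by auto
    then show "g x \<in> carrier Y" using mod_hom_closed[OF h] by (simp add: g)
  next
    fix x y assume "x \<in> carrier E" "y \<in> carrier E"
    then have "x \<in> q ` carrier D" "y \<in> q ` carrier D" using q(2) by simp_all
    then obtain x' y' where xy: "x' \<in> carrier D" "x = q x'" "y' \<in> carrier D" "y = q y'"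
      by blast
    have "g (q (x' \<oplus>\<^bsub>D\<^esub> y')) = h (x' \<oplus>\<^bsub>D\<^esub> y')" using xy by (intro g) simp
    then show "g (x \<oplus>\<^bsub>E\<^esub> y) = g x \<oplus>\<^bsub>Y\<^esub> g y"
      using xy by (simp add: g mod_hom_add[OF q(1)] mod_hom_add[OF h])
  next
    fix r x assume r: "r \<in> carrier S" and "x \<in> carrier E"
    then obtain x' where x: "x' \<in> carrier D" "x = q x'" using q(2) by auto
    have "g (q (r \<odot>\<^bsub>D\<^esub> x')) = h (r \<odot>\<^bsub>D\<^esub> x')" using x r by (intro g D.smult_closed)
    then show "g (r \<odot>\<^bsub>E\<^esub> x) = r \<odot>\<^bsub>Y\<^esub> g x"
      using x r by (simp add: g mod_hom_smult[OF q(1)] mod_hom_smult[OF h])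
  qed
  then show thesis using g by (rule that)
qed

lemma ext1_retract_right:
  assumes ext: "ext1_vanishes \<U> S X Y'"
    and s: "s \<in> mod_hom S Y Y'" and r: "r \<in> mod_hom S Y' Y"
    and rs: "\<And>y. y \<in> carrier Y \<Longrightarrow> r (s y) = y"
  shows "ext1_vanishes \<U> S X Y"
  unfolding ext1_vanishes_def
proof (intro ballI impI)
  fix E p f assume E: "E \<in> left_modules \<U> S" "p \<in> mod_hom S E X" "p ` carrier E = carrier X"
    and f: "f \<in> mod_hom S (kernel_module E X p) Y"
  have "\<exists>g\<in>mod_hom S E Y'. \<forall>x\<in>mod_kernel E X p. g x = s (f x)"
    using ext[unfolded ext1_vanishes_def, rule_format, OF E mod_hom_comp[OF f s]] .
  then obtain g where g: "g \<in> mod_hom S E Y'" "\<forall>x\<in>mod_kernel E X p. g x = s (f x)" ..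
  have "r (g x) = f x" if "x \<in> mod_kernel E X p" for x
    using g(2) that mod_hom_closed[OF f] rs by simp
  then show "\<exists>g\<in>mod_hom S E Y. \<forall>x\<in>mod_kernel E X p. g x = f x"
    by (intro bexI[OF _ mod_hom_comp[OF g(1) r]] ballI)
qed

text \<open>
  The section sends \<open>p x\<close> to \<open>x - i (r x)\<close>. This depends only on \<open>p x\<close>, because \<open>i \<circ> r\<close> is the identity on
  the kernel of \<open>p\<close>.
\<close>

lemma split_short_exact:
  assumes L: "left_module S L" and M: "left_module S M" and N: "left_module S N"
    and ex: "short_exact S L M N i p"
    and r: "r \<in> mod_hom S M L" and ri: "\<And>x. x \<in> carrier L \<Longrightarrow> r (i x) = x"
  shows "(\<lambda>x. (r x, p x)) \<in> mod_iso S M (sum_module L N)"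
    and "\<exists>s\<in>mod_hom S N M. \<forall>y\<in>carrier N. p (s y) = y"
proof -
  interpret L: left_module S L by fact
  interpret M: left_module S M by fact
  interpret N: left_module S N by fact
  have i: "i \<in> mod_hom S L M" and p: "p \<in> mod_hom S M N"
    and ker: "i ` carrier L = mod_kernel M N p" and surj: "p ` carrier M = carrier N"
    using ex by (auto simp: short_exact_def)
  have pi: "p (i x) = \<zero>\<^bsub>N\<^esub>" if "x \<in> carrier L" for x
  proof -
    have "i x \<in> i ` carrier L" using that by (rule imageI)
    then show ?thesis unfolding ker by (simp add: mod_kernel_def)
  qed
  let ?h = "\<lambda>x. (r x, p x)"
  have h: "?h \<in> mod_hom S M (sum_module L N)"
    using r p by (intro mod_homI) (simp_all add: mod_hom_closed mod_hom_add mod_hom_smult)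
  show "?h \<in> mod_iso S M (sum_module L N)"
  proof (rule mod_isoI[OF h])
    show "inj_on ?h (carrier M)"
    proof (rule inj_on_kernel[OF M left_module_sum[OF L N] h])
      fix x assume x: "x \<in> carrier M" "?h x = \<zero>\<^bsub>sum_module L N\<^esub>"
      then have "x \<in> mod_kernel M N p" by (simp add: mod_kernel_def)
      then obtain y where "y \<in> carrier L" "x = i y" unfolding ker[symmetric] by auto
      then show "x = \<zero>\<^bsub>M\<^esub>" using x(2) ri mod_hom_zero[OF L M i] by simp
    qed
    show "?h ` carrier M = carrier (sum_module L N)"
    proof
      show "?h ` carrier M \<subseteq> carrier (sum_module L N)" using mod_hom_closed[OF h] by blast
      show "carrier (sum_module L N) \<subseteq> ?h ` carrier M"
      proof
        fix z assume "z \<in> carrier (sum_module L N)"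
        then obtain x y where z: "z = (x, y)" "x \<in> carrier L" "y \<in> carrier N" by auto
        then obtain m where m: "m \<in> carrier M" "y = p m" using surj by auto
        let ?m = "m \<oplus>\<^bsub>M\<^esub> i (x \<ominus>\<^bsub>L\<^esub> r m)"
        have c: "r m \<in> carrier L" "x \<ominus>\<^bsub>L\<^esub> r m \<in> carrier L" "i (x \<ominus>\<^bsub>L\<^esub> r m) \<in> carrier M"
          using z m mod_hom_closed[OF r] mod_hom_closed[OF i] by simp_all
        have "r ?m = x"
          using m c ri z by (simp add: mod_hom_add[OF r] L.add_diff_cancel)
        moreover have "p ?m = y"
          using m c pi mod_hom_closed[OF p] by (simp add: mod_hom_add[OF p])
        ultimately have "z = ?h ?m" using z by simp
        then show "z \<in> ?h ` carrier M" by (rule image_eqI) (use m c in simp)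
      qed
    qed
  qed
  let ?k = "\<lambda>x. x \<ominus>\<^bsub>M\<^esub> i (r x)"
  have k: "?k \<in> mod_hom S M M"
    by (rule mod_hom_minus_hom[OF M mod_hom_id mod_hom_comp[OF r i]])
  have "?k x = \<zero>\<^bsub>M\<^esub>" if x: "x \<in> carrier M" "p x = \<zero>\<^bsub>N\<^esub>" for x
  proof -
    obtain y where "y \<in> carrier L" "x = i y" using x ker by (auto simp: mod_kernel_def)
    then show ?thesis using ri mod_hom_closed[OF i] by (simp add: M.diff_eq_zero_iff)
  qed
  then obtain s where s: "s \<in> mod_hom S N M" "\<And>x. x \<in> carrier M \<Longrightarrow> s (p x) = ?k x"
    using factor_through_surjection[OF M N M p surj k] by metis
  have "p (s y) = y" if y: "y \<in> carrier N" for y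
  proof -
    obtain x where x: "x \<in> carrier M" "y = p x" using y unfolding surj[symmetric] by blast
    have c: "i (r x) \<in> carrier M" "p (i (r x)) = \<zero>\<^bsub>N\<^esub>" "p x \<in> carrier N"
      using x mod_hom_closed[OF r] mod_hom_closed[OF i] mod_hom_closed[OF p] pi by simp_all
    then show ?thesis
      using x s(2)[OF x(1)] by (simp add: mod_hom_diff[OF M N p] a_minus_def[of N])
  qed
  with s(1) show "\<exists>s\<in>mod_hom S N M. \<forall>y\<in>carrier N. p (s y) = y" by blast
qed

context module_category
begin

lemma ext1_vanishesD:
  fixes E :: "('s, 'e) module"
  assumes ext: "ext1_vanishes \<U> S X Y"
    and E: "left_module S E" "small \<U> (carrier E)" and X: "left_module S X"
    and p: "p \<in> mod_hom S E X" "p ` carrier E = carrier X"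
    and f: "f \<in> mod_hom S (kernel_module E X p) Y"
  obtains g where "g \<in> mod_hom S E Y" "\<And>x. x \<in> mod_kernel E X p \<Longrightarrow> g x = f x"
proof -
  obtain N h k where N: "N \<in> left_modules \<U> S" and h: "h \<in> mod_iso S E N"
    and k: "k \<in> mod_iso S N E" and kh: "\<And>x. x \<in> carrier E \<Longrightarrow> k (h x) = x"
    using small_copy_exists[OF E] by metis
  let ?p = "\<lambda>x. p (k x)"
  have p': "?p \<in> mod_hom S N X" by (rule mod_hom_comp[OF mod_isoD(1)[OF k] p(1)])
  have surj: "?p ` carrier N = carrier X"
    unfolding p(2)[symmetric] mod_isoD(3)[OF k, symmetric] image_image ..
  have "k \<in> mod_hom S (kernel_module N X ?p) E"
    by (rule mod_hom_restrict_domain[OF submod_kernel[OF left_modulesD(1)[OF N] X p'] mod_isoD(1)[OF k]])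
  then have "k \<in> mod_hom S (kernel_module N X ?p) (kernel_module E X p)"
    by (rule mod_hom_restrict_codomain) (auto simp: mod_kernel_def mod_hom_closed[OF mod_isoD(1)[OF k]])
  then have "(\<lambda>x. f (k x)) \<in> mod_hom S (kernel_module N X ?p) Y"
    by (rule mod_hom_comp[OF _ f])
  then have "\<exists>g\<in>mod_hom S N Y. \<forall>x\<in>mod_kernel N X ?p. g x = f (k x)"
    by (rule ext[unfolded ext1_vanishes_def, rule_format, OF N p' surj])
  then obtain g where g: "g \<in> mod_hom S N Y" "\<forall>x\<in>mod_kernel N X ?p. g x = f (k x)" ..
  show thesis
  proof (rule that)
    show "(\<lambda>x. g (h x)) \<in> mod_hom S E Y" by (rule mod_hom_comp[OF mod_isoD(1)[OF h] g(1)])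
    show "g (h x) = f x" if "x \<in> mod_kernel E X p" for x
      using that g(2) kh mod_hom_closed[OF mod_isoD(1)[OF h]] by (simp add: mod_kernel_def)
  qed
qed

lemma ext1_short_exact:
  assumes ext: "ext1_vanishes \<U> S N Y"
    and L: "left_module S L" and M: "left_module S M" "small \<U> (carrier M)" and N: "left_module S N"
    and ex: "short_exact S L M N i p" and f: "f \<in> mod_hom S L Y"
  obtains g where "g \<in> mod_hom S M Y" "\<And>x. x \<in> carrier L \<Longrightarrow> g (i x) = f x"
proof -
  have i: "i \<in> mod_hom S L M" "inj_on i (carrier L)" and p: "p \<in> mod_hom S M N" "p ` carrier M = carrier N"
    and ker: "i ` carrier L = mod_kernel M N p"
    using ex by (auto simp: short_exact_def)
  let ?j = "inv_into (carrier L) i"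
  have "?j \<in> mod_hom S (kernel_module M N p) L"
    by (rule mod_hom_inv_into[OF L i submod_inclusion[OF submod_kernel[OF M(1) N p(1)]]]) (simp add: ker)
  then have "(\<lambda>x. f (?j x)) \<in> mod_hom S (kernel_module M N p) Y"
    by (rule mod_hom_comp[OF _ f])
  then obtain g where g: "g \<in> mod_hom S M Y" "\<And>x. x \<in> mod_kernel M N p \<Longrightarrow> g x = f (?j x)"
    using ext1_vanishesD[OF ext M N p] by metis
  have "g (i x) = f x" if "x \<in> carrier L" for x
  proof -
    have "i x \<in> mod_kernel M N p" using that ker by blast
    then have "g (i x) = f (?j (i x))" by (rule g(2))
    also have "?j (i x) = x" by (rule inv_into_f_f[OF i(2) that])
    finally show ?thesis .
  qed
  then show thesis by (rule that[OF g(1)])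
qed

text \<open>
  It suffices to extend maps along one surjection from a projective module \<open>P\<close>. Any other surjection
  \<open>E \<rightarrow> X\<close> receives a lift \<open>g\<close> of it, and \<open>E\<close> is the quotient of the direct sum of its kernel and \<open>P\<close>
  by the pairs that cancel in \<open>E\<close>; the maps on the two summands agree there.
\<close>

lemma ext1_vanishesI_projective:
  assumes P: "projective_module \<U> S P" and X: "X \<in> left_modules \<U> S" and Y: "left_module S Y"
    and e: "e \<in> mod_hom S P X" "e ` carrier P = carrier X"
    and extend: "\<And>f. f \<in> mod_hom S (kernel_module P X e) Y \<Longrightarrow>
      \<exists>g\<in>mod_hom S P Y. \<forall>x\<in>mod_kernel P X e. g x = f x"
  shows "ext1_vanishes \<U> S X Y"
  unfolding ext1_vanishes_def
proof (intro ballI impI)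
  fix E p f assume E: "E \<in> left_modules \<U> S" and p: "p \<in> mod_hom S E X" "p ` carrier E = carrier X"
    and f: "f \<in> mod_hom S (kernel_module E X p) Y"
  note P' = left_modulesD(1)[OF projective_left_module[OF P]]
  interpret P: left_module S P by (rule P')
  interpret E: left_module S E by (rule left_modulesD(1)[OF E])
  interpret X: left_module S X by (rule left_modulesD(1)[OF X])
  interpret Y: left_module S Y by (rule Y)
  let ?K = "kernel_module E X p"
  have K: "left_module S ?K"
    by (rule left_module_kernel[OF E.left_module_axioms X.left_module_axioms p(1)])
  have Ksub: "submod S E (mod_kernel E X p)"
    by (rule submod_kernel[OF E.left_module_axioms X.left_module_axioms p(1)])
  obtain g where g: "g \<in> mod_hom S P E" "\<And>x. x \<in> carrier P \<Longrightarrow> p (g x) = e x"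
  proof -
    have "\<exists>g\<in>mod_hom S P E. \<forall>x\<in>carrier P. p (g x) = e x"
      using P E X p e(1) unfolding projective_module_def by metis
    then show thesis using that by blast
  qed
  have "g \<in> mod_hom S (kernel_module P X e) ?K"
    by (rule mod_hom_restrict_codomain[OF mod_hom_restrict_domain[OF submod_kernel[OF P' X.left_module_axioms e(1)] g(1)]])
      (use g in \<open>auto simp: mod_kernel_def mod_hom_closed\<close>)
  then have "(\<lambda>x. f (g x)) \<in> mod_hom S (kernel_module P X e) Y"
    by (rule mod_hom_comp[OF _ f])
  then obtain h where h: "h \<in> mod_hom S P Y" "\<And>x. x \<in> mod_kernel P X e \<Longrightarrow> h x = f (g x)"
    using extend by metis
  let ?D = "sum_module ?K P"
  let ?q = "\<lambda>z. fst z \<oplus>\<^bsub>E\<^esub> g (snd z)" and ?r = "\<lambda>z. f (fst z) \<oplus>\<^bsub>Y\<^esub> h (snd z)"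
  have D: "left_module S ?D" by (rule left_module_sum[OF K P'])
  have fst: "fst \<in> mod_hom S ?D ?K" and snd: "snd \<in> mod_hom S ?D P"
    by (auto intro!: mod_homI)
  have q: "?q \<in> mod_hom S ?D E"
    by (rule mod_hom_plus[OF E.left_module_axioms mod_hom_comp[OF fst submod_inclusion[OF Ksub]]
          mod_hom_comp[OF snd g(1)]])
  have r: "?r \<in> mod_hom S ?D Y"
    by (rule mod_hom_plus[OF Y mod_hom_comp[OF fst f] mod_hom_comp[OF snd h(1)]])
  have surj: "?q ` carrier ?D = carrier E"
  proof
    show "?q ` carrier ?D \<subseteq> carrier E" using mod_hom_closed[OF q] by blast
    show "carrier E \<subseteq> ?q ` carrier ?D"
    proof
      fix y assume y: "y \<in> carrier E"
      then obtain x where x: "x \<in> carrier P" "e x = p y"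
        using e(2) mod_hom_closed[OF p(1)] by (metis imageE)
      have gx: "g x \<in> carrier E" using x g by (simp add: mod_hom_closed)
      have "y \<ominus>\<^bsub>E\<^esub> g x \<in> mod_kernel E X p"
        using y x gx g(2) mod_hom_closed[OF p(1)]
        by (simp add: mod_kernel_def mod_hom_diff[OF E.left_module_axioms X.left_module_axioms p(1)]
            X.diff_eq_zero_iff)
      moreover have "y = (y \<ominus>\<^bsub>E\<^esub> g x) \<oplus>\<^bsub>E\<^esub> g x" using y gx by (simp add: E.add_diff_cancel)
      ultimately show "y \<in> ?q ` carrier ?D"
        using x by (intro image_eqI[of _ _ "(y \<ominus>\<^bsub>E\<^esub> g x, x)"]) simp_all
    qed
  qed
  have "?r z = \<zero>\<^bsub>Y\<^esub>" if z: "z \<in> carrier ?D" "?q z = \<zero>\<^bsub>E\<^esub>" for z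
  proof -
    obtain k x where kx: "z = (k, x)" "k \<in> mod_kernel E X p" "x \<in> carrier P"
      using z(1) by auto
    have k: "k \<in> carrier E" "p k = \<zero>\<^bsub>X\<^esub>" using kx by (auto simp: mod_kernel_def)
    have gx: "g x \<in> carrier E" using kx g by (simp add: mod_hom_closed)
    have s: "k \<oplus>\<^bsub>E\<^esub> g x = \<zero>\<^bsub>E\<^esub>" using z kx by simp
    then have "p (k \<oplus>\<^bsub>E\<^esub> g x) = \<zero>\<^bsub>X\<^esub>"
      by (simp add: mod_hom_zero[OF E.left_module_axioms X.left_module_axioms p(1)])
    then have ex: "e x = \<zero>\<^bsub>X\<^esub>"
      using k gx g(2) kx mod_hom_closed[OF e(1)] by (simp add: mod_hom_add[OF p(1)])
    then have gK: "g x \<in> mod_kernel E X p" using gx g(2) kx by (simp add: mod_kernel_def)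
    have "?r z = f k \<oplus>\<^bsub>Y\<^esub> f (g x)" using kx ex h(2) by (simp add: mod_kernel_def)
    also have "\<dots> = f (k \<oplus>\<^bsub>E\<^esub> g x)"
      using mod_hom_add[OF f, of k "g x"] kx gK by simp
    also have "\<dots> = \<zero>\<^bsub>Y\<^esub>" using mod_hom_zero[OF K Y f] s by simp
    finally show ?thesis .
  qed
  then obtain G where G: "G \<in> mod_hom S E Y" "\<And>z. z \<in> carrier ?D \<Longrightarrow> G (?q z) = ?r z"
    using factor_through_surjection[OF D E.left_module_axioms Y q surj r] by metis
  have "G k = f k" if k: "k \<in> mod_kernel E X p" for k
  proof -
    have "f k \<in> carrier Y" "k \<in> carrier E"
      using k mod_hom_closed[OF f] by (auto simp: mod_kernel_def)
    then show ?thesis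
      using G(2)[of "(k, \<zero>\<^bsub>P\<^esub>)"] k mod_hom_zero[OF P' E.left_module_axioms g(1)]
        mod_hom_zero[OF P' Y h(1)] by simp
  qed
  then show "\<exists>g\<in>mod_hom S E Y. \<forall>x\<in>mod_kernel E X p. g x = f x" by (intro bexI[OF _ G(1)] ballI)
qed

lemma ext1_projective:
  assumes P: "projective_module \<U> S P" and Y: "left_module S Y"
  shows "ext1_vanishes \<U> S P Y"
proof (rule ext1_vanishesI_projective[OF P projective_left_module[OF P] Y mod_hom_id])
  note P' = left_modulesD(1)[OF projective_left_module[OF P]]
  let ?K = "kernel_module P P (\<lambda>x. x)"
  fix f assume f: "f \<in> mod_hom S ?K Y"
  have "left_module S ?K" by (rule left_module_kernel[OF P' P' mod_hom_id])
  then have "f \<zero>\<^bsub>P\<^esub> = \<zero>\<^bsub>Y\<^esub>" using mod_hom_zero[OF _ Y f] by simp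
  then show "\<exists>g\<in>mod_hom S P Y. \<forall>x\<in>mod_kernel P P (\<lambda>x. x). g x = f x"
    by (intro bexI[OF _ mod_hom_const_zero[OF Y]]) (auto simp: mod_kernel_def)
qed simp

text \<open>
  A surjection onto a direct summand \<open>X\<close> of \<open>X'\<close> is pulled back to \<open>X'\<close>, with the same kernel. The map
  extends to the pullback, into which the section of \<open>X' \<rightarrow> X\<close> embeds the given module.
\<close>

lemma ext1_retract_left:
  assumes ext: "ext1_vanishes \<U> S X' Y"
    and X: "left_module S X" and X': "left_module S X'" "small \<U> (carrier X')"
    and s: "s \<in> mod_hom S X X'" and r: "r \<in> mod_hom S X' X"
    and rs: "\<And>x. x \<in> carrier X \<Longrightarrow> r (s x) = x"
  shows "ext1_vanishes \<U> S X Y"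
  unfolding ext1_vanishes_def
proof (intro ballI impI)
  fix E p f assume E: "E \<in> left_modules \<U> S" and p: "p \<in> mod_hom S E X" "p ` carrier E = carrier X"
    and f: "f \<in> mod_hom S (kernel_module E X p) Y"
  note E' = left_modulesD[OF E]
  let ?D = "pullback_module E X' p r"
  have D: "left_module S ?D" by (rule left_module_pullback[OF E'(1) X'(1) X p(1) r])
  have smallD: "small \<U> (carrier ?D)" by (rule small_pullback[OF E'(2) X'(2)])
  have surj: "snd ` carrier ?D = carrier X'" by (rule pullback_snd_surj[OF r p(2)])
  have ker: "mod_kernel ?D X' snd = {(y, \<zero>\<^bsub>X'\<^esub>) |y. y \<in> mod_kernel E X p}"
    using mod_hom_zero[OF X'(1) X r] abelian_groupE(2)[of X'] X'(1)
    by (auto simp: mod_kernel_def left_module_def)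
  have "fst \<in> mod_hom S (kernel_module ?D X' snd) (kernel_module E X p)"
    by (rule mod_hom_restrict_codomain[OF mod_hom_restrict_domain[OF
            submod_kernel[OF D X'(1) pullback_snd] pullback_fst]]) (auto simp: ker)
  then have "(\<lambda>z. f (fst z)) \<in> mod_hom S (kernel_module ?D X' snd) Y"
    by (rule mod_hom_comp[OF _ f])
  then obtain G where G: "G \<in> mod_hom S ?D Y" "\<And>z. z \<in> mod_kernel ?D X' snd \<Longrightarrow> G z = f (fst z)"
    using ext1_vanishesD[OF ext D smallD X'(1) pullback_snd surj] by metis
  let ?h = "\<lambda>y. (y, s (p y))"
  have h: "?h \<in> mod_hom S E ?D"
    using p s rs
    by (intro mod_homI) (simp_all add: mod_hom_closed mod_hom_add mod_hom_smult)
  have "G (?h y) = f y" if y: "y \<in> mod_kernel E X p" for y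
  proof -
    have "(y, \<zero>\<^bsub>X'\<^esub>) \<in> mod_kernel ?D X' snd" using y ker by blast
    moreover have "s (p y) = \<zero>\<^bsub>X'\<^esub>"
      using y mod_hom_zero[OF X X'(1) s] by (simp add: mod_kernel_def)
    ultimately show ?thesis using G(2)[of "?h y"] by simp
  qed
  moreover have "(\<lambda>y. G (?h y)) \<in> mod_hom S E Y" by (rule mod_hom_comp[OF h G(1)])
  ultimately show "\<exists>g\<in>mod_hom S E Y. \<forall>x\<in>mod_kernel E X p. g x = f x"
    by (intro bexI[of _ "\<lambda>y. G (?h y)"] ballI)
qed

lemma ext1_iso_left:
  assumes ext: "ext1_vanishes \<U> S X' Y"
    and X: "left_module S X" and X': "left_module S X'" "small \<U> (carrier X')"
    and h: "h \<in> mod_iso S X X'"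
  shows "ext1_vanishes \<U> S X Y"
  by (rule ext1_retract_left[OF ext X X' mod_isoD(1)[OF h] mod_isoD(1)[OF mod_iso_inv_into[OF X h]]])
    (rule inv_into_f_f[OF mod_isoD(2)[OF h]])

lemma ext1_iso_right:
  assumes ext: "ext1_vanishes \<U> S X Y'" and Y: "left_module S Y" and h: "h \<in> mod_iso S Y Y'"
  shows "ext1_vanishes \<U> S X Y"
  by (rule ext1_retract_right[OF ext mod_isoD(1)[OF h] mod_isoD(1)[OF mod_iso_inv_into[OF Y h]]])
    (rule inv_into_f_f[OF mod_isoD(2)[OF h]])

text \<open>
  For a surjection \<open>E \<rightarrow> X\<close> and a submodule of \<open>X\<close>, first extend to the preimage of the submodule,
  then to \<open>E\<close>.
\<close>

lemma ext1_extension: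
  assumes X: "left_module S X" and N: "left_module S N"
    and q: "q \<in> mod_hom S X N" "q ` carrier X = carrier N"
    and ext_ker: "ext1_vanishes \<U> S (kernel_module X N q) Y" and ext: "ext1_vanishes \<U> S N Y"
  shows "ext1_vanishes \<U> S X Y"
  unfolding ext1_vanishes_def
proof (intro ballI impI)
  fix E p f assume E: "E \<in> left_modules \<U> S" and p: "p \<in> mod_hom S E X" "p ` carrier E = carrier X"
    and f: "f \<in> mod_hom S (kernel_module E X p) Y"
  note E' = left_modulesD[OF E]
  let ?K = "kernel_module X N q" and ?E = "kernel_module E N (\<lambda>y. q (p y))"
  have qp: "(\<lambda>y. q (p y)) \<in> mod_hom S E N" by (rule mod_hom_comp[OF p(1) q(1)])
  have qp_surj: "(\<lambda>y. q (p y)) ` carrier E = carrier N" unfolding q(2)[symmetric] p(2)[symmetric] image_image ..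
  have K: "left_module S ?K" by (rule left_module_kernel[OF X N q(1)])
  have E1: "?E \<in> left_modules \<U> S" by (rule left_modules_kernel[OF E N qp])
  have p1: "p \<in> mod_hom S ?E ?K"
    by (rule mod_hom_restrict_codomain[OF mod_hom_restrict_domain[OF submod_kernel[OF E'(1) N qp] p(1)]])
      (auto simp: mod_kernel_def mod_hom_closed[OF p(1)])
  have p1_surj: "p ` carrier ?E = carrier ?K"
    using p(2) by (auto simp: mod_kernel_def mod_hom_closed[OF p(1)] image_iff)
  have "mod_kernel ?E ?K p = mod_kernel E X p"
    using mod_hom_zero[OF X N q(1)] by (auto simp: mod_kernel_def)
  moreover from this have "f \<in> mod_hom S (kernel_module ?E ?K p) Y" using f by simp
  ultimately obtain f1 where f1: "f1 \<in> mod_hom S ?E Y" "\<And>x. x \<in> mod_kernel E X p \<Longrightarrow> f1 x = f x"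
    using ext1_vanishesD[OF ext_ker left_modulesD[OF E1] K p1 p1_surj] by metis
  obtain g where g: "g \<in> mod_hom S E Y" "\<And>x. x \<in> mod_kernel E N (\<lambda>y. q (p y)) \<Longrightarrow> g x = f1 x"
    using ext1_vanishesD[OF ext E' N qp qp_surj f1(1)] by metis
  have "g x = f x" if "x \<in> mod_kernel E X p" for x
    using that f1(2) g(2) mod_hom_zero[OF X N q(1)] by (simp add: mod_kernel_def)
  then show "\<exists>g\<in>mod_hom S E Y. \<forall>x\<in>mod_kernel E X p. g x = f x"
    by (intro bexI[OF _ g(1)] ballI)
qed

end

section \<open>Extension groups and syzygies\<close>

lemma comm_group_hom_group:
  assumes M: "left_module S M" and Y: "left_module S Y"
  shows "comm_group (hom_group S M Y)"
    and "f \<in> carrier (hom_group S M Y) \<Longrightarrow> inv\<^bsub>hom_group S M Y\<^esub> f = (\<lambda>x\<in>carrier M. \<ominus>\<^bsub>Y\<^esub> f x)"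
proof -
  interpret M: left_module S M by fact
  interpret Y: left_module S Y by fact
  let ?H = "hom_group S M Y"
  have restr: "(\<lambda>x\<in>carrier M. h x) \<in> carrier ?H" if "h \<in> mod_hom S M Y" for h
    using mod_hom_cong[OF M that, of "\<lambda>x\<in>carrier M. h x"] by (auto simp: hom_group_def)
  have hom: "f \<in> mod_hom S M Y" "f \<in> extensional (carrier M)" if "f \<in> carrier ?H" for f
    using that by (auto simp: hom_group_def)
  have closed: "f x \<in> carrier Y" if "f \<in> carrier ?H" "x \<in> carrier M" for f x
    by (rule mod_hom_closed[OF hom(1)[OF that(1)] that(2)])
  have inv: "(\<lambda>x\<in>carrier M. \<ominus>\<^bsub>Y\<^esub> f x) \<in> carrier ?H"
    "(\<lambda>x\<in>carrier M. \<ominus>\<^bsub>Y\<^esub> f x) \<otimes>\<^bsub>?H\<^esub> f = \<one>\<^bsub>?H\<^esub>" if "f \<in> carrier ?H" for f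
    using restr[OF mod_hom_uminus[OF Y hom(1)[OF that]]] closed[OF that]
    by (simp_all add: hom_group_def Y.M.l_neg fun_eq_iff)
  show cg: "comm_group ?H"
  proof (rule comm_groupI)
    show "f \<otimes>\<^bsub>?H\<^esub> g \<in> carrier ?H" if "f \<in> carrier ?H" "g \<in> carrier ?H" for f g
      using restr[OF mod_hom_plus[OF Y hom(1)[OF that(1)] hom(1)[OF that(2)]]] by (simp add: hom_group_def)
    show "\<one>\<^bsub>?H\<^esub> \<in> carrier ?H"
      using restr[OF mod_hom_const_zero[OF Y]] by (simp add: hom_group_def)
    show "\<one>\<^bsub>?H\<^esub> \<otimes>\<^bsub>?H\<^esub> f = f" if "f \<in> carrier ?H" for f
      using closed[OF that] hom(2)[OF that] by (auto simp: hom_group_def fun_eq_iff extensional_def)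
    show "\<exists>g\<in>carrier ?H. g \<otimes>\<^bsub>?H\<^esub> f = \<one>\<^bsub>?H\<^esub>" if "f \<in> carrier ?H" for f
      using inv[OF that] by blast
  next
    fix f g h assume "f \<in> carrier ?H" "g \<in> carrier ?H" "h \<in> carrier ?H"
    then have "\<And>x. x \<in> carrier M \<Longrightarrow> f x \<in> carrier Y \<and> g x \<in> carrier Y \<and> h x \<in> carrier Y"
      by (simp add: closed)
    then show "f \<otimes>\<^bsub>?H\<^esub> g \<otimes>\<^bsub>?H\<^esub> h = f \<otimes>\<^bsub>?H\<^esub> (g \<otimes>\<^bsub>?H\<^esub> h)" "f \<otimes>\<^bsub>?H\<^esub> g = g \<otimes>\<^bsub>?H\<^esub> f"
      by (auto simp: hom_group_def fun_eq_iff Y.M.a_ac)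
  qed
  interpret comm_group ?H by (rule cg)
  show "inv\<^bsub>?H\<^esub> f = (\<lambda>x\<in>carrier M. \<ominus>\<^bsub>Y\<^esub> f x)" if "f \<in> carrier ?H"
    using inv[OF that] that by (intro inv_equality)
qed

lemma trivial_quotient_iff:
  assumes G: "comm_group G" and Z: "subgroup Z G" and B: "subgroup B G" and BZ: "B \<subseteq> Z"
  shows "trivial_group (G\<lparr>carrier := Z\<rparr> Mod B) \<longleftrightarrow> Z \<subseteq> B"
proof -
  interpret G: comm_group G by fact
  interpret Z: comm_group "G\<lparr>carrier := Z\<rparr>"
    using subgroup.subset[OF Z]
    by (intro group.group_comm_groupI[OF G.subgroup_imp_group[OF Z]]) (auto intro: G.m_comm)
  have BZ': "subgroup B (G\<lparr>carrier := Z\<rparr>)"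
    using G.subgroup_incl[OF B Z BZ] .
  then have N: "B \<lhd> (G\<lparr>carrier := Z\<rparr>)" by (simp add: Z.normal_iff_subgroup)
  show ?thesis
  proof
    assume triv: "trivial_group (G\<lparr>carrier := Z\<rparr> Mod B)"
    show "Z \<subseteq> B"
    proof
      fix z assume z: "z \<in> Z"
      then have "B #>\<^bsub>G\<lparr>carrier := Z\<rparr>\<^esub> z \<in> carrier (G\<lparr>carrier := Z\<rparr> Mod B)"
        by (auto simp: carrier_FactGroup)
      then have "B #>\<^bsub>G\<lparr>carrier := Z\<rparr>\<^esub> z = B" using triv by (simp add: trivial_group_def)
      then show "z \<in> B" using Z.coset_join1[OF _ _ BZ'] z by simp
    qed
  next
    assume "Z \<subseteq> B"
    then have "B #>\<^bsub>G\<lparr>carrier := Z\<rparr>\<^esub> z = B" if "z \<in> Z" for z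
      using Z.coset_join2[OF _ BZ'] that by auto
    moreover have "Z \<noteq> {}" using subgroup.one_closed[OF Z] by auto
    ultimately show "trivial_group (G\<lparr>carrier := Z\<rparr> Mod B)"
      using normal.factorgroup_is_group[OF N] by (auto simp: trivial_group_def carrier_FactGroup)
  qed
qed

text \<open>
  The module \<open>X\<close> itself counts as syzygy \<open>0\<close>, covered by the augmentation; then every differential and the
  augmentation have the same role, and \<open>Ext\<close> in all positive degrees is treated at once.
\<close>

definition syzygy ::
  "('s, 'm) module \<Rightarrow> (nat \<Rightarrow> ('s, 'm) module) \<Rightarrow> (nat \<Rightarrow> 'm \<Rightarrow> 'm) \<Rightarrow> nat \<Rightarrow> ('s, 'm) module" where
  "syzygy X P d n = (case n of 0 \<Rightarrow> X | Suc m \<Rightarrow> (P m)\<lparr>carrier := d m ` carrier (P (Suc m))\<rparr>)"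

definition syzygy_map :: "('m \<Rightarrow> 'm) \<Rightarrow> (nat \<Rightarrow> 'm \<Rightarrow> 'm) \<Rightarrow> nat \<Rightarrow> 'm \<Rightarrow> 'm" where
  "syzygy_map \<epsilon> d n = (case n of 0 \<Rightarrow> \<epsilon> | Suc m \<Rightarrow> d m)"

context module_category
begin

lemma syzygy_presentation:
  assumes X: "X \<in> left_modules \<U> S" and res: "projective_resolution \<U> S X P d \<epsilon>"
  shows "syzygy X P d n \<in> left_modules \<U> S"
    and "syzygy_map \<epsilon> d n \<in> mod_hom S (P n) (syzygy X P d n)"
    and "syzygy_map \<epsilon> d n ` carrier (P n) = carrier (syzygy X P d n)"
    and "mod_kernel (P n) (syzygy X P d n) (syzygy_map \<epsilon> d n) = d n ` carrier (P (Suc n))"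
proof -
  have P: "left_module S (P n)" "P n \<in> left_modules \<U> S" and d: "d n \<in> mod_hom S (P (Suc n)) (P n)" for n
    using res by (auto simp: projective_resolution_def projective_module_def left_modules_def)
  show "syzygy X P d n \<in> left_modules \<U> S"
    using X P d by (cases n) (auto simp: syzygy_def intro!: left_modules_submod submod_image)
  show "syzygy_map \<epsilon> d n \<in> mod_hom S (P n) (syzygy X P d n)"
    using res d by (cases n)
      (auto simp: syzygy_def syzygy_map_def projective_resolution_def intro!: mod_hom_restrict_codomain)
  show "syzygy_map \<epsilon> d n ` carrier (P n) = carrier (syzygy X P d n)"
    using res by (cases n) (auto simp: syzygy_def syzygy_map_def projective_resolution_def)
  show "mod_kernel (P n) (syzygy X P d n) (syzygy_map \<epsilon> d n) = d n ` carrier (P (Suc n))"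
    using res by (cases n) (auto simp: syzygy_def syzygy_map_def projective_resolution_def mod_kernel_def)
qed

text \<open>
  Dimension shifting: a cocycle of degree \<open>n + 1\<close> is a map on \<open>P\<^sub>n\<^sub>+\<^sub>1\<close> that factors through the
  next syzygy inside \<open>P\<^sub>n\<close>, and it is a coboundary if this factor extends to \<open>P\<^sub>n\<close>.
\<close>

lemma cocycles_subset_coboundaries_iff:
  assumes X: "X \<in> left_modules \<U> S" and Y: "left_module S Y"
    and res: "projective_resolution \<U> S X P d \<epsilon>"
  shows "cocycles S P d Y (Suc n) \<subseteq> coboundaries S P d Y (Suc n) \<longleftrightarrow>
    ext1_vanishes \<U> S (syzygy X P d n) Y"
proof -
  let ?Z = "syzygy X P d n" and ?e = "syzygy_map \<epsilon> d n"
  let ?K = "kernel_module (P n) ?Z ?e"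
  note syz = syzygy_presentation[OF X res]
  have Pproj: "projective_module \<U> S (P n)" for n
    using res by (simp add: projective_resolution_def)
  have P: "left_module S (P n)" for n
    using Pproj left_modulesD(1) projective_left_module by blast
  have d: "d n \<in> mod_hom S (P (Suc n)) (P n)" for n
    using res by (simp add: projective_resolution_def)
  have dd: "mod_kernel (P (Suc n)) (P n) (d n) = d (Suc n) ` carrier (P (Suc (Suc n)))"
    using res by (simp add: projective_resolution_def)
  have Zm: "left_module S ?Z" by (rule left_modulesD(1)[OF syz(1)])
  have K: "left_module S ?K"
    by (rule left_module_kernel[OF P Zm syz(2)])
  have Ksub: "submod S (P n) (mod_kernel (P n) ?Z ?e)"
    by (rule submod_kernel[OF P Zm syz(2)])
  have dK: "d n \<in> mod_hom S (P (Suc n)) ?K" "d n ` carrier (P (Suc n)) = carrier ?K"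
    using d syz(4)[of n] by (auto intro!: mod_hom_restrict_codomain)
  have ddx: "d n (d (Suc n) x) = \<zero>\<^bsub>P n\<^esub>" if "x \<in> carrier (P (Suc (Suc n)))" for x
    using dd that by (auto simp: mod_kernel_def)
  show ?thesis
  proof
    assume sub: "cocycles S P d Y (Suc n) \<subseteq> coboundaries S P d Y (Suc n)"
    show "ext1_vanishes \<U> S ?Z Y"
    proof (rule ext1_vanishesI_projective[OF Pproj syz(1) Y syz(2) syz(3)])
      fix f assume f: "f \<in> mod_hom S ?K Y"
      let ?c = "\<lambda>x\<in>carrier (P (Suc n)). f (d n x)"
      have "?c \<in> mod_hom S (P (Suc n)) Y"
        by (rule mod_hom_cong[OF P mod_hom_comp[OF dK(1) f]]) simp
      moreover have "?c (d (Suc n) x) = \<zero>\<^bsub>Y\<^esub>" if "x \<in> carrier (P (Suc (Suc n)))" for x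
        using that mod_hom_closed[OF d that] ddx[OF that] mod_hom_zero[OF K Y f] by simp
      ultimately have "?c \<in> cocycles S P d Y (Suc n)" by (simp add: cocycles_def hom_group_def)
      then obtain g where g: "g \<in> carrier (hom_group S (P n) Y)" "?c = (\<lambda>x\<in>carrier (P (Suc n)). g (d n x))"
        using sub by (auto simp: coboundaries_def)
      have "g x = f x" if x: "x \<in> mod_kernel (P n) ?Z ?e" for x
      proof -
        obtain y where "y \<in> carrier (P (Suc n))" "x = d n y"
          using x unfolding syz(4) by blast
        then show ?thesis using fun_cong[OF g(2), of y] by simp
      qed
      then show "\<exists>g\<in>mod_hom S (P n) Y. \<forall>x\<in>mod_kernel (P n) ?Z ?e. g x = f x"
        using g(1) by (auto simp: hom_group_def)
    qed
  next
    assume ext: "ext1_vanishes \<U> S ?Z Y"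
    show "cocycles S P d Y (Suc n) \<subseteq> coboundaries S P d Y (Suc n)"
    proof
      fix c assume c: "c \<in> cocycles S P d Y (Suc n)"
      then have ch: "c \<in> mod_hom S (P (Suc n)) Y" "c \<in> extensional (carrier (P (Suc n)))"
        and cd: "\<And>x. x \<in> carrier (P (Suc (Suc n))) \<Longrightarrow> c (d (Suc n) x) = \<zero>\<^bsub>Y\<^esub>"
        by (auto simp: cocycles_def hom_group_def)
      have "c x = \<zero>\<^bsub>Y\<^esub>" if "x \<in> carrier (P (Suc n))" "d n x = \<zero>\<^bsub>?K\<^esub>" for x
      proof -
        have "x \<in> mod_kernel (P (Suc n)) (P n) (d n)" using that by (simp add: mod_kernel_def)
        then show ?thesis unfolding dd using cd by auto
      qed
      then obtain f where f: "f \<in> mod_hom S ?K Y" "\<And>x. x \<in> carrier (P (Suc n)) \<Longrightarrow> f (d n x) = c x"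
        using factor_through_surjection[OF P K Y dK ch(1)] by metis
      obtain g where g: "g \<in> mod_hom S (P n) Y" "\<And>x. x \<in> mod_kernel (P n) ?Z ?e \<Longrightarrow> g x = f x"
        using ext1_vanishesD[OF ext left_modulesD[OF projective_left_module[OF Pproj]]
            Zm syz(2,3) f(1)] by metis
      let ?g = "\<lambda>x\<in>carrier (P n). g x"
      have "?g \<in> carrier (hom_group S (P n) Y)"
        using mod_hom_cong[OF P g(1), of ?g] by (simp add: hom_group_def)
      moreover have "c x = ?g (d n x)" if x: "x \<in> carrier (P (Suc n))" for x
      proof -
        have "d n x \<in> mod_kernel (P n) ?Z ?e" using x dK(2) by auto
        then show ?thesis using x f(2) g(2) mod_hom_closed[OF d x] by simp
      qed
      then have "c = (\<lambda>x\<in>carrier (P (Suc n)). ?g (d n x))"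
        using ch(2) by (auto simp: fun_eq_iff extensional_def)
      ultimately show "c \<in> coboundaries S P d Y (Suc n)"
        unfolding coboundaries_def nat.case mem_Collect_eq by blast
    qed
  qed
qed

lemma trivial_cohomology_iff:
  assumes Y: "left_module S Y" and res: "projective_resolution \<U> S X P d \<epsilon>"
  shows "trivial_group ((hom_group S (P (Suc n)) Y)\<lparr>carrier := cocycles S P d Y (Suc n)\<rparr>
      Mod coboundaries S P d Y (Suc n)) \<longleftrightarrow>
    cocycles S P d Y (Suc n) \<subseteq> coboundaries S P d Y (Suc n)"
proof -
  interpret Y: left_module S Y by fact
  have P: "left_module S (P n)" for n
    using res left_modulesD(1) projective_left_module by (auto simp: projective_resolution_def)
  have d: "d n \<in> mod_hom S (P (Suc n)) (P n)" for n
    using res by (simp add: projective_resolution_def)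
  have "mod_kernel (P (Suc n)) (P n) (d n) = d (Suc n) ` carrier (P (Suc (Suc n)))"
    using res by (simp add: projective_resolution_def)
  then have dd: "d n (d (Suc n) x) = \<zero>\<^bsub>P n\<^esub>" if "x \<in> carrier (P (Suc (Suc n)))" for x
    using that by (auto simp: mod_kernel_def)
  let ?H = "\<lambda>n. hom_group S (P n) Y"
  interpret H: comm_group "?H (Suc n)" by (rule comm_group_hom_group[OF P Y])
  interpret G: comm_group "?H n" by (rule comm_group_hom_group[OF P Y])
  note inv = comm_group_hom_group(2)[OF P Y]
  have closed: "f x \<in> carrier Y" if "f \<in> carrier (?H m)" "x \<in> carrier (P m)" for f x m
    using that(1) by (intro mod_hom_closed[where S = S, OF _ that(2)]) (simp add: hom_group_def)
  have Z: "subgroup (cocycles S P d Y (Suc n)) (?H (Suc n))"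
  proof (rule H.subgroupI)
    show "cocycles S P d Y (Suc n) \<noteq> {}"
      using H.one_closed mod_hom_closed[OF d, of _ "Suc n"] by (auto simp: cocycles_def hom_group_def)
  next
    fix f assume f: "f \<in> cocycles S P d Y (Suc n)"
    then have "f \<in> carrier (?H (Suc n))" by (simp add: cocycles_def)
    then show "inv\<^bsub>?H (Suc n)\<^esub> f \<in> cocycles S P d Y (Suc n)"
      using f H.inv_closed[of f] mod_hom_closed[OF d, of _ "Suc n"] by (simp add: cocycles_def inv)
  next
    fix f g assume fg: "f \<in> cocycles S P d Y (Suc n)" "g \<in> cocycles S P d Y (Suc n)"
    then show "f \<otimes>\<^bsub>?H (Suc n)\<^esub> g \<in> cocycles S P d Y (Suc n)"
      using H.m_closed[of f g] mod_hom_closed[OF d, of _ "Suc n"]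
      by (simp add: cocycles_def) (simp add: hom_group_def)
  qed (simp add: cocycles_def)
  let ?pre = "\<lambda>g. \<lambda>x\<in>carrier (P (Suc n)). g (d n x)"
  have B_eq: "coboundaries S P d Y (Suc n) = ?pre ` carrier (?H n)"
    by (auto simp: coboundaries_def)
  have pre: "?pre g \<in> carrier (?H (Suc n))" if "g \<in> carrier (?H n)" for g
  proof -
    have "g \<in> mod_hom S (P n) Y" using that by (simp add: hom_group_def)
    then have "?pre g \<in> mod_hom S (P (Suc n)) Y"
      by (intro mod_hom_cong[OF P mod_hom_comp[OF d]]) simp_all
    then show ?thesis by (simp add: hom_group_def)
  qed
  have B: "subgroup (coboundaries S P d Y (Suc n)) (?H (Suc n))"
    unfolding B_eq
  proof (rule H.subgroupI)
    show "?pre ` carrier (?H n) \<subseteq> carrier (?H (Suc n))" using pre by blast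
    show "?pre ` carrier (?H n) \<noteq> {}" using G.one_closed by blast
  next
    fix f assume "f \<in> ?pre ` carrier (?H n)"
    then obtain g where g: "f = ?pre g" "g \<in> carrier (?H n)" by blast
    then have "inv\<^bsub>?H (Suc n)\<^esub> f = ?pre (inv\<^bsub>?H n\<^esub> g)"
      unfolding g(1) inv[OF pre[OF g(2)]] inv[OF g(2)] using mod_hom_closed[OF d]
      by (simp add: fun_eq_iff)
    then show "inv\<^bsub>?H (Suc n)\<^esub> f \<in> ?pre ` carrier (?H n)" using g by blast
  next
    fix f f' assume "f \<in> ?pre ` carrier (?H n)" "f' \<in> ?pre ` carrier (?H n)"
    then obtain g g' where g: "f = ?pre g" "g \<in> carrier (?H n)" "f' = ?pre g'" "g' \<in> carrier (?H n)" by blast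
    then have "f \<otimes>\<^bsub>?H (Suc n)\<^esub> f' = ?pre (g \<otimes>\<^bsub>?H n\<^esub> g')"
      using mod_hom_closed[OF d] by (auto simp: hom_group_def fun_eq_iff)
    then show "f \<otimes>\<^bsub>?H (Suc n)\<^esub> f' \<in> ?pre ` carrier (?H n)" using g by blast
  qed
  have "coboundaries S P d Y (Suc n) \<subseteq> cocycles S P d Y (Suc n)"
    unfolding B_eq
  proof (rule image_subsetI)
    fix g assume g: "g \<in> carrier (?H n)"
    then have "g \<zero>\<^bsub>P n\<^esub> = \<zero>\<^bsub>Y\<^esub>" using mod_hom_zero[OF P Y] by (auto simp: hom_group_def)
    then show "?pre g \<in> cocycles S P d Y (Suc n)"
      using pre[OF g] dd mod_hom_closed[OF d, of _ "Suc n"] by (simp add: cocycles_def)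
  qed
  then show ?thesis by (rule trivial_quotient_iff[OF H.comm_group_axioms Z B])
qed

text \<open>
  The resolution is the chosen one in the definition of \<open>Ext\<close>. It serves all degrees and all second
  arguments simultaneously, which dimension shifting relies on.
\<close>

lemma Ext_resolution:
  assumes X: "X \<in> left_modules \<U> S"
  obtains P d \<epsilon> where "projective_resolution \<U> S X P d \<epsilon>"
    "\<And>n Y. left_module S Y \<Longrightarrow>
      trivial_group (Ext \<U> S (Suc n) X Y) \<longleftrightarrow> ext1_vanishes \<U> S (syzygy X P d n) Y"
proof -
  let ?Q = "\<lambda>(P, d). \<exists>\<epsilon>. projective_resolution \<U> S X P d \<epsilon>"
  obtain P d where Pd: "(SOME z. ?Q z) = (P, d)" by (metis surj_pair)
  have "\<exists>z. ?Q z" using projective_resolution_exists[OF X] by (metis case_prodI)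
  then have "?Q (SOME z. ?Q z)" by (rule someI_ex)
  then obtain \<epsilon> where res: "projective_resolution \<U> S X P d \<epsilon>" unfolding Pd by auto
  show thesis
  proof (rule that[OF res])
    fix n and Y :: "('s, 'u) module" assume Y: "left_module S Y"
    have "Ext \<U> S (Suc n) X Y = (hom_group S (P (Suc n)) Y)\<lparr>carrier := cocycles S P d Y (Suc n)\<rparr>
        Mod coboundaries S P d Y (Suc n)"
      unfolding Ext_def Pd by simp
    then show "trivial_group (Ext \<U> S (Suc n) X Y) \<longleftrightarrow> ext1_vanishes \<U> S (syzygy X P d n) Y"
      by (simp add: trivial_cohomology_iff[OF Y res] cocycles_subset_coboundaries_iff[OF X Y res])
  qed
qed

lemma Ext_1_trivial_iff:
  assumes "X \<in> left_modules \<U> S" "left_module S Y"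
  shows "trivial_group (Ext \<U> S 1 X Y) \<longleftrightarrow> ext1_vanishes \<U> S X Y"
proof -
  obtain P d \<epsilon> where "projective_resolution \<U> S X P d \<epsilon>" and iff: "\<And>n Y. left_module S Y \<Longrightarrow>
      trivial_group (Ext \<U> S (Suc n) X Y) \<longleftrightarrow> ext1_vanishes \<U> S (syzygy X P d n) Y"
    using Ext_resolution[OF assms(1)] by blast
  from iff[OF assms(2), of 0] show ?thesis by (simp add: syzygy_def)
qed

end

section \<open>Cotorsion pairs\<close>

lemma iso_to_memberE:
  assumes "iso_to_member S M \<X>"
  obtains N h where "N \<in> \<X>" "h \<in> mod_iso S M N"
  using assms unfolding iso_to_member_def by blast

context module_category
begin

lemma right_perp_iff:
  assumes "\<X> \<subseteq> left_modules \<U> S"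
  shows "Y \<in> right_perp \<U> S \<X> \<longleftrightarrow> Y \<in> left_modules \<U> S \<and> (\<forall>X\<in>\<X>. ext1_vanishes \<U> S X Y)"
proof -
  have "trivial_group (Ext \<U> S 1 X Y) \<longleftrightarrow> ext1_vanishes \<U> S X Y"
    if "Y \<in> left_modules \<U> S" "X \<in> \<X>" for X
    using that assms by (intro Ext_1_trivial_iff left_modulesD(1)) auto
  then show ?thesis unfolding right_perp_def mem_Collect_eq by (intro conj_cong ball_cong refl)
qed

lemma left_perp_iff:
  assumes "\<X> \<subseteq> left_modules \<U> S"
  shows "Y \<in> left_perp \<U> S \<X> \<longleftrightarrow> Y \<in> left_modules \<U> S \<and> (\<forall>X\<in>\<X>. ext1_vanishes \<U> S Y X)"
proof -
  have "trivial_group (Ext \<U> S 1 Y X) \<longleftrightarrow> ext1_vanishes \<U> S Y X"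
    if "Y \<in> left_modules \<U> S" "X \<in> \<X>" for X
    using that assms by (intro Ext_1_trivial_iff left_modulesD(1)) auto
  then show ?thesis unfolding left_perp_def mem_Collect_eq by (intro conj_cong ball_cong refl)
qed

lemma cotorsion_pairD:
  assumes "cotorsion_pair \<U> S \<F> \<C>"
  shows "\<F> \<subseteq> left_modules \<U> S" "\<C> \<subseteq> left_modules \<U> S"
    and "X \<in> \<F> \<longleftrightarrow> X \<in> left_modules \<U> S \<and> (\<forall>Y\<in>\<C>. ext1_vanishes \<U> S X Y)"
    and "Y \<in> \<C> \<longleftrightarrow> Y \<in> left_modules \<U> S \<and> (\<forall>X\<in>\<F>. ext1_vanishes \<U> S X Y)"
proof -
  have C: "\<C> = right_perp \<U> S \<F>" and F: "\<F> = left_perp \<U> S \<C>"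
    using assms unfolding cotorsion_pair_def by (rule conjunct1, rule conjunct2)
  show FM: "\<F> \<subseteq> left_modules \<U> S" by (subst F) (auto simp: left_perp_def)
  show CM: "\<C> \<subseteq> left_modules \<U> S" by (subst C) (auto simp: right_perp_def)
  show "X \<in> \<F> \<longleftrightarrow> X \<in> left_modules \<U> S \<and> (\<forall>Y\<in>\<C>. ext1_vanishes \<U> S X Y)"
    unfolding left_perp_iff[OF CM, symmetric] F[symmetric] ..
  show "Y \<in> \<C> \<longleftrightarrow> Y \<in> left_modules \<U> S \<and> (\<forall>X\<in>\<F>. ext1_vanishes \<U> S X Y)"
    unfolding right_perp_iff[OF FM, symmetric] C[symmetric] ..
qed

lemma projective_in_left_class:
  assumes "cotorsion_pair \<U> S \<F> \<C>" "projective_module \<U> S P"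
  shows "P \<in> \<F>"
proof -
  have "ext1_vanishes \<U> S P Y" if "Y \<in> \<C>" for Y
    using that cotorsion_pairD(2)[OF assms(1)]
    by (intro ext1_projective[OF assms(2)] left_modulesD(1)) auto
  then show ?thesis
    using cotorsion_pairD(3)[OF assms(1)] projective_left_module[OF assms(2)] by blast
qed

lemma left_class_retract:
  assumes cp: "cotorsion_pair \<U> S \<F> \<C>" and X: "X \<in> left_modules \<U> S" and X': "X' \<in> \<F>"
    and s: "s \<in> mod_hom S X X'" and r: "r \<in> mod_hom S X' X"
    and rs: "\<And>x. x \<in> carrier X \<Longrightarrow> r (s x) = x"
  shows "X \<in> \<F>"
proof -
  have X'M: "X' \<in> left_modules \<U> S" using X' cotorsion_pairD(1)[OF cp] by blast
  have "ext1_vanishes \<U> S X Y" if Y: "Y \<in> \<C>" for Y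
  proof (rule ext1_retract_left[OF _ left_modulesD(1)[OF X] left_modulesD[OF X'M] s r rs])
    show "ext1_vanishes \<U> S X' Y" using X' Y cotorsion_pairD(3)[OF cp] by blast
  qed
  then show ?thesis using X cotorsion_pairD(3)[OF cp] by blast
qed

lemma left_class_iso:
  assumes cp: "cotorsion_pair \<U> S \<F> \<C>" and X: "X \<in> left_modules \<U> S" and iso: "iso_to_member S X \<F>"
  shows "X \<in> \<F>"
proof -
  obtain X' h where X': "X' \<in> \<F>" and h: "h \<in> mod_iso S X X'"
    using iso by (rule iso_to_memberE)
  show ?thesis
    by (rule left_class_retract[OF cp X X' mod_isoD(1)[OF h]
          mod_isoD(1)[OF mod_iso_inv_into[OF left_modulesD(1)[OF X] h]]])
      (rule inv_into_f_f[OF mod_isoD(2)[OF h]])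
qed

lemma zero_submodule:
  assumes "M \<in> left_modules \<U> S"
  shows "M\<lparr>carrier := {\<zero>\<^bsub>M\<^esub>}\<rparr> \<in> left_modules \<U> S"
proof -
  interpret M: left_module S M by (rule left_modulesD(1)[OF assms])
  show ?thesis by (rule left_modules_submod[OF assms]) (auto simp: submod_def)
qed

text \<open>
  The kernel \<open>K\<close> of \<open>q : E \<rightarrow> N\<close> is compared with the first syzygy \<open>\<Omega>\<close> of \<open>N\<close> as in Schanuel's
  lemma. The pullback \<open>Z\<close> of \<open>q\<close> along a surjection \<open>P \<rightarrow> N\<close> from a projective module is an extension of \<open>E\<close> by
  \<open>\<Omega>\<close>, so it lies in \<open>\<F>\<close>, because \<open>Ext\<^sup>1(\<Omega>, C) = Ext\<^sup>2(N, C) = 0\<close>; and \<open>K\<close> is a direct summand of \<open>Z\<close>, because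
  \<open>Z \<rightarrow> P\<close> splits.
\<close>

lemma hereditary_kernel:
  assumes her: "hereditary_cotorsion_pair \<U> S \<F> \<C>" and E: "E \<in> \<F>" and N: "N \<in> \<F>"
    and q: "q \<in> mod_hom S E N" "q ` carrier E = carrier N"
  shows "kernel_module E N q \<in> \<F>"
proof -
  have cp: "cotorsion_pair \<U> S \<F> \<C>" using her by (simp add: hereditary_cotorsion_pair_def)
  note cpD = cotorsion_pairD[OF cp]
  have EM: "E \<in> left_modules \<U> S" and NM: "N \<in> left_modules \<U> S" using E N cpD(1) by auto
  note E' = left_modulesD[OF EM] and N' = left_modulesD[OF NM]
  interpret E: left_module S E by (rule E')
  interpret N: left_module S N by (rule N')
  let ?K = "kernel_module E N q"
  have K: "?K \<in> left_modules \<U> S" by (rule left_modules_kernel[OF EM N'(1) q(1)])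
  obtain P d \<epsilon> where res: "projective_resolution \<U> S N P d \<epsilon>"
    and Ext: "\<And>n Y. left_module S Y \<Longrightarrow>
      trivial_group (Ext \<U> S (Suc n) N Y) \<longleftrightarrow> ext1_vanishes \<U> S (syzygy N P d n) Y"
    using Ext_resolution[OF NM] by blast
  let ?P = "P 0" and ?\<Omega> = "kernel_module (P 0) N \<epsilon>"
  have P: "projective_module \<U> S ?P" and e: "\<epsilon> \<in> mod_hom S ?P N" "\<epsilon> ` carrier ?P = carrier N"
    and ker: "mod_kernel ?P N \<epsilon> = d 0 ` carrier (P (Suc 0))"
    using res by (auto simp: projective_resolution_def)
  note PM = projective_left_module[OF P]
  note P' = left_modulesD[OF PM]
  interpret P: left_module S ?P by (rule P')
  have \<Omega>: "?\<Omega> \<in> left_modules \<U> S" by (rule left_modules_kernel[OF PM N'(1) e(1)])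
  have ext\<Omega>: "ext1_vanishes \<U> S ?\<Omega> Y" if Y: "Y \<in> \<C>" for Y
  proof -
    have "trivial_group (Ext \<U> S (Suc (Suc 0)) N Y)"
      using her N Y by (simp add: hereditary_cotorsion_pair_def)
    moreover have "left_module S Y" using Y cpD(2) left_modulesD(1) by blast
    ultimately show ?thesis using Ext[of Y "Suc 0"] by (simp add: syzygy_def ker)
  qed
  let ?Z = "pullback_module E ?P q \<epsilon>"
  have Z: "left_module S ?Z" by (rule left_module_pullback[OF E'(1) P'(1) N'(1) q(1) e(1)])
  have smallZ: "small \<U> (carrier ?Z)" by (rule small_pullback[OF E'(2) P'(2)])
  have surj: "fst ` carrier ?Z = carrier E" by (rule pullback_fst_surj[OF q(1) e(2)])
  have kerZ: "mod_kernel ?Z E fst = {(\<zero>\<^bsub>E\<^esub>, x) |x. x \<in> mod_kernel ?P N \<epsilon>}"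
    using mod_hom_zero[OF E'(1) N'(1) q(1)] by (auto simp: mod_kernel_def)
  have KZ: "left_module S (kernel_module ?Z E fst)"
    by (rule left_module_kernel[OF Z E'(1) pullback_fst])
  have iso: "snd \<in> mod_iso S (kernel_module ?Z E fst) ?\<Omega>"
  proof (rule mod_isoI)
    show "snd \<in> mod_hom S (kernel_module ?Z E fst) ?\<Omega>"
      by (rule mod_hom_restrict_codomain[OF mod_hom_restrict_domain[OF
              submod_kernel[OF Z E'(1) pullback_fst] pullback_snd]]) (auto simp: kerZ)
    show "inj_on snd (carrier (kernel_module ?Z E fst))" by (auto simp: kerZ inj_on_def)
    show "snd ` carrier (kernel_module ?Z E fst) = carrier ?\<Omega>" by (force simp: kerZ)
  qed
  have extZ: "ext1_vanishes \<U> S ?Z Y" if Y: "Y \<in> \<C>" for Y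
  proof (rule ext1_extension[OF Z E'(1) pullback_fst surj])
    show "ext1_vanishes \<U> S (kernel_module ?Z E fst) Y"
      by (rule ext1_iso_left[OF ext\<Omega>[OF Y] KZ left_modulesD[OF \<Omega>] iso])
    show "ext1_vanishes \<U> S E Y" using E Y cpD(3) by blast
  qed
  have "\<exists>g\<in>mod_hom S ?P E. \<forall>x\<in>carrier ?P. q (g x) = \<epsilon> x"
    using P EM NM q e(1) unfolding projective_module_def by metis
  then obtain g where g: "g \<in> mod_hom S ?P E" "\<forall>x\<in>carrier ?P. q (g x) = \<epsilon> x" ..
  let ?s = "\<lambda>y. (y, \<zero>\<^bsub>?P\<^esub>)" and ?r = "\<lambda>z. fst z \<ominus>\<^bsub>E\<^esub> g (snd z)"
  have s: "?s \<in> mod_hom S ?K ?Z"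
    using mod_hom_zero[OF P'(1) N'(1) e(1)] by (intro mod_homI) (simp_all add: mod_kernel_def)
  have "?r \<in> mod_hom S ?Z E"
    by (rule mod_hom_minus_hom[OF E'(1) pullback_fst mod_hom_comp[OF pullback_snd g(1)]])
  moreover have "q (?r z) = \<zero>\<^bsub>N\<^esub>" "?r z \<in> carrier E" if "z \<in> carrier ?Z" for z
    using that g(2) mod_hom_closed[OF g(1)] mod_hom_closed[OF e(1)]
    by (auto simp: mod_hom_diff[OF E'(1) N'(1) q(1)] N.diff_eq_zero_iff)
  ultimately have r: "?r \<in> mod_hom S ?Z ?K"
    by (intro mod_hom_restrict_codomain image_subsetI) (simp_all add: mod_kernel_def)
  have rs: "?r (?s y) = y" if "y \<in> carrier ?K" for y
    using that mod_hom_zero[OF P'(1) E'(1) g(1)] by (simp add: mod_kernel_def a_minus_def)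
  have "ext1_vanishes \<U> S ?K Y" if "Y \<in> \<C>" for Y
    by (rule ext1_retract_left[OF extZ[OF that] left_modulesD(1)[OF K] Z smallZ s r rs])
  then show ?thesis using K cpD(3) by blast
qed

text \<open>
  Approximation sequences whose terms from \<open>\<W>\<close> are orthogonal to \<open>\<F>\<close> already determine a cotorsion
  pair: a module orthogonal to one of the classes splits off its own approximation.
\<close>

lemma complete_cotorsion_pairI:
  assumes FM: "\<F> \<subseteq> left_modules \<U> S" and WM: "\<W> \<subseteq> left_modules \<U> S"
    and ext: "\<And>X Y. \<lbrakk>X \<in> \<F>; Y \<in> \<W>\<rbrakk> \<Longrightarrow> ext1_vanishes \<U> S X Y"
    and cover: "\<And>M. M \<in> left_modules \<U> S \<Longrightarrow> \<exists>C\<in>\<W>. \<exists>F\<in>\<F>. \<exists>i p. short_exact S C F M i p"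
    and hull: "\<And>M. M \<in> left_modules \<U> S \<Longrightarrow> \<exists>C\<in>\<W>. \<exists>F\<in>\<F>. \<exists>i p. short_exact S M C F i p"
    and retract: "\<And>X X' s r. \<lbrakk>X \<in> left_modules \<U> S; X' \<in> \<F>; s \<in> mod_hom S X X'; r \<in> mod_hom S X' X;
      \<forall>x\<in>carrier X. r (s x) = x\<rbrakk> \<Longrightarrow> X \<in> \<F>"
  shows "complete_cotorsion_pair \<U> S \<F> (direct_summands \<U> S \<W>)"
proof -
  let ?D = "direct_summands \<U> S \<W>"
  have DM: "?D \<subseteq> left_modules \<U> S" by (auto simp: direct_summands_def)
  have WD: "W \<in> ?D" if W: "W \<in> \<W>" for W
  proof -
    have WM': "W \<in> left_modules \<U> S" using W WM by blast
    interpret W: left_module S W by (rule left_modulesD(1)[OF WM'])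
    let ?Z = "W\<lparr>carrier := {\<zero>\<^bsub>W\<^esub>}\<rparr>"
    have "fst \<in> mod_iso S (sum_module W ?Z) W"
      by (rule mod_isoI) (auto intro!: mod_homI simp: inj_on_def)
    then have "iso_to_member S (sum_module W ?Z) \<W>" using W by (auto simp: iso_to_member_def)
    then show ?thesis using WM' zero_submodule[OF WM'] by (auto simp: direct_summands_def)
  qed
  have extD: "ext1_vanishes \<U> S X Y" if X: "X \<in> \<F>" and Y: "Y \<in> ?D" for X Y
  proof -
    obtain N where YM: "Y \<in> left_modules \<U> S" and NM: "N \<in> left_modules \<U> S"
      and iso: "iso_to_member S (sum_module Y N) \<W>"
      using Y by (auto simp: direct_summands_def)
    note Y' = left_modulesD(1)[OF YM] and N' = left_modulesD(1)[OF NM]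
    interpret N: left_module S N by (rule N')
    obtain W h where W: "W \<in> \<W>" and h: "h \<in> mod_iso S (sum_module Y N) W"
      using iso by (rule iso_to_memberE)
    have i: "(\<lambda>y. (y, \<zero>\<^bsub>N\<^esub>)) \<in> mod_hom S Y (sum_module Y N)"
      and p: "fst \<in> mod_hom S (sum_module Y N) Y"
      by (auto intro!: mod_homI)
    let ?k = "inv_into (carrier (sum_module Y N)) h"
    have k: "?k \<in> mod_hom S W (sum_module Y N)"
      by (rule mod_isoD(1)[OF mod_iso_inv_into[OF left_module_sum[OF Y' N'] h]])
    have "fst (?k (h (y, \<zero>\<^bsub>N\<^esub>))) = y" if "y \<in> carrier Y" for y
      using that inv_into_f_f[OF mod_isoD(2)[OF h], of "(y, \<zero>\<^bsub>N\<^esub>)"] by simp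
    then show ?thesis
      by (rule ext1_retract_right[OF ext[OF X W] mod_hom_comp[OF i mod_isoD(1)[OF h]] mod_hom_comp[OF k p]])
  qed
  have "Y \<in> ?D" if YM: "Y \<in> left_modules \<U> S" and orth: "\<forall>X\<in>\<F>. ext1_vanishes \<U> S X Y" for Y
  proof -
    obtain C F i p where CF: "C \<in> \<W>" "F \<in> \<F>" and ex: "short_exact S Y C F i p"
      using hull[OF YM] by blast
    have CM: "C \<in> left_modules \<U> S" and FM': "F \<in> left_modules \<U> S" using CF WM FM by auto
    note Y' = left_modulesD(1)[OF YM] and C' = left_modulesD[OF CM] and F' = left_modulesD(1)[OF FM']
    obtain r where r: "r \<in> mod_hom S C Y" "\<And>y. y \<in> carrier Y \<Longrightarrow> r (i y) = y"
      using ext1_short_exact[OF orth[rule_format, OF CF(2)] Y' C' F' ex mod_hom_id] by metis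
    have "(\<lambda>x. (r x, p x)) \<in> mod_iso S C (sum_module Y F)"
      by (rule split_short_exact(1)[OF Y' C'(1) F' ex r])
    then have "iso_to_member S (sum_module Y F) \<W>"
      using mod_iso_inv_into[OF C'(1)] CF(1) by (auto simp: iso_to_member_def)
    then show ?thesis using YM FM' by (auto simp: direct_summands_def)
  qed
  then have right: "?D = right_perp \<U> S \<F>"
    using extD DM right_perp_iff[OF FM] by blast
  have "X \<in> \<F>" if XM: "X \<in> left_modules \<U> S" and orth: "\<forall>Y\<in>?D. ext1_vanishes \<U> S X Y" for X
  proof -
    obtain C F i p where CF: "C \<in> \<W>" "F \<in> \<F>" and ex: "short_exact S C F X i p"
      using cover[OF XM] by blast
    have CM: "C \<in> left_modules \<U> S" and FM': "F \<in> left_modules \<U> S" using CF WM FM by auto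
    note X' = left_modulesD(1)[OF XM] and C' = left_modulesD(1)[OF CM] and F' = left_modulesD[OF FM']
    obtain r where r: "r \<in> mod_hom S F C" "\<And>y. y \<in> carrier C \<Longrightarrow> r (i y) = y"
      using ext1_short_exact[OF orth[rule_format, OF WD[OF CF(1)]] C' F' X' ex mod_hom_id] by metis
    obtain s where s: "s \<in> mod_hom S X F" "\<forall>x\<in>carrier X. p (s x) = x"
      using split_short_exact(2)[OF C' F'(1) X' ex r] by blast
    have "p \<in> mod_hom S F X" using ex by (simp add: short_exact_def)
    then show ?thesis by (rule retract[OF XM CF(2) s(1) _ s(2)])
  qed
  then have left: "\<F> = left_perp \<U> S ?D"
    using extD FM left_perp_iff[OF DM] by blast
  show ?thesis
    unfolding complete_cotorsion_pair_def cotorsion_pair_def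
    using right left cover hull WD by blast
qed

lemma hereditary_cotorsion_pairI:
  assumes cp: "cotorsion_pair \<U> S \<F> \<C>"
    and kernel: "\<And>E N q. \<lbrakk>E \<in> \<F>; N \<in> \<F>; q \<in> mod_hom S E N; q ` carrier E = carrier N\<rbrakk> \<Longrightarrow>
      kernel_module E N q \<in> \<F>"
  shows "hereditary_cotorsion_pair \<U> S \<F> \<C>"
proof -
  note cpD = cotorsion_pairD[OF cp]
  have "trivial_group (Ext \<U> S n F C)" if F: "F \<in> \<F>" and C: "C \<in> \<C>" and n: "1 \<le> n" for F C n
  proof -
    have FM: "F \<in> left_modules \<U> S" and C': "left_module S C"
      using F C cpD(1,2) left_modulesD(1) by auto
    obtain P d \<epsilon> where res: "projective_resolution \<U> S F P d \<epsilon>"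
      and Ext: "\<And>n Y. left_module S Y \<Longrightarrow>
        trivial_group (Ext \<U> S (Suc n) F Y) \<longleftrightarrow> ext1_vanishes \<U> S (syzygy F P d n) Y"
      using Ext_resolution[OF FM] by blast
    note syz = syzygy_presentation[OF FM res]
    have "syzygy F P d m \<in> \<F>" for m
    proof (induction m)
      case 0
      then show ?case using F by (simp add: syzygy_def)
    next
      case (Suc m)
      have "P m \<in> \<F>"
        using res by (intro projective_in_left_class[OF cp]) (simp add: projective_resolution_def)
      from kernel[OF this Suc syz(2,3)] show ?case by (simp add: syz(4)) (simp add: syzygy_def)
    qed
    then have "ext1_vanishes \<U> S (syzygy F P d (n - 1)) C" using cpD(3) C by blast
    then show ?thesis using Ext[OF C', of "n - 1"] n by simp
  qed
  then show ?thesis using cp by (simp add: hereditary_cotorsion_pair_def)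
qed

end

section \<open>Cofiltrations indexed by the first infinite ordinal\<close>

lemma ord_zero_enat: "ord_zero (i :: enat) \<longleftrightarrow> i = 0"
  unfolding ord_zero_def by (metis i0_lb le_zero_eq)

lemma ord_succ_enat: "ord_succ (i :: enat) j \<longleftrightarrow> (\<exists>n. i = enat n \<and> j = enat (Suc n))"
proof
  assume s: "ord_succ i j"
  then have ij: "i < j" and no: "\<not> (i < k \<and> k < j)" for k by (auto simp: ord_succ_def)
  obtain n where n: "i = enat n" using ij by (cases i) simp_all
  have "enat (Suc n) \<le> j" using ij n by (simp add: Suc_ile_eq)
  moreover have "\<not> enat (Suc n) < j" using no[of "enat (Suc n)"] n by simp
  ultimately show "\<exists>n. i = enat n \<and> j = enat (Suc n)" using n by auto
next
  assume "\<exists>n. i = enat n \<and> j = enat (Suc n)"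
  then obtain n where n: "i = enat n" "j = enat (Suc n)" by blast
  have "\<not> (enat n < k \<and> k < enat (Suc n))" for k by (cases k) auto
  then show "ord_succ i j" using n by (simp add: ord_succ_def)
qed

lemma ord_limit_enat: "ord_limit (i :: enat) \<longleftrightarrow> i = \<infinity>"
proof (cases i)
  case (enat n)
  then show ?thesis
    by (cases n) (auto simp: ord_limit_def ord_zero_enat ord_succ_enat zero_enat_def)
next
  case infinity
  then show ?thesis by (auto simp: ord_limit_def ord_zero_enat ord_succ_enat)
qed

lemma lessThan_infinity: "{..<\<infinity> :: enat} = range enat"
  by (auto elim: less_infinityE)

text \<open>
  Composites are indexed by their lower end \<open>m\<close> and their length \<open>k\<close>, so that composition is addition of
  lengths.
\<close>

primrec tower_map :: "(nat \<Rightarrow> 'm \<Rightarrow> 'm) \<Rightarrow> nat \<Rightarrow> nat \<Rightarrow> 'm \<Rightarrow> 'm" where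
  "tower_map t m 0 x = x"
| "tower_map t m (Suc k) x = tower_map t m k (t (m + k) x)"

lemma tower_map_add: "tower_map t m k (tower_map t (m + k) l x) = tower_map t m (k + l) x"
  by (induction l arbitrary: x) (simp_all add: add.assoc)

lemma tower_map_1: "tower_map t m (Suc 0) = t m"
  by (rule ext) simp

lemma tower_map_hom:
  assumes "\<And>n. t n \<in> mod_hom S (G (Suc n)) (G n)"
  shows "tower_map t m k \<in> mod_hom S (G (m + k)) (G m)"
proof (induction k)
  case 0
  have "tower_map t m 0 = (\<lambda>x. x)" by (rule ext) simp
  then show ?case using mod_hom_id[of S "G m"] by simp
next
  case (Suc k)
  have "(\<lambda>x. tower_map t m k (t (m + k) x)) \<in> mod_hom S (G (Suc (m + k))) (G m)"
    by (rule mod_hom_comp[OF assms Suc])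
  moreover have "tower_map t m (Suc k) = (\<lambda>x. tower_map t m k (t (m + k) x))" by (rule ext) simp
  ultimately show ?case by simp
qed

context module_category
begin

text \<open>
  For the ordinal \<open>\<omega>\<close>, the coherence of all transition maps and the one limit condition reduce to data on
  consecutive stages and to the statement that \<open>N\<close> is in bijection with the compatible sequences.
\<close>

lemma Cof_omegaI:
  fixes G :: "nat \<Rightarrow> ('s, 'u) module" and t u :: "nat \<Rightarrow> 'u \<Rightarrow> 'u"
  assumes N: "N \<in> left_modules \<U> S" and G: "\<And>n. G n \<in> left_modules \<U> S"
    and zero: "carrier (G 0) = {\<zero>\<^bsub>G 0\<^esub>}"
    and t: "\<And>n. t n \<in> mod_hom S (G (Suc n)) (G n)" "\<And>n. t n ` carrier (G (Suc n)) = carrier (G n)"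
    and ker: "\<And>n. iso_to_member S (kernel_module (G (Suc n)) (G n) (t n)) \<T>"
    and u: "\<And>n. u n \<in> mod_hom S N (G n)" "\<And>n x. x \<in> carrier N \<Longrightarrow> t n (u (Suc n) x) = u n x"
    and inj: "\<And>x. \<lbrakk>x \<in> carrier N; \<And>n. u n x = \<zero>\<^bsub>G n\<^esub>\<rbrakk> \<Longrightarrow> x = \<zero>\<^bsub>N\<^esub>"
    and limit: "\<And>s. \<lbrakk>\<And>n. s n \<in> carrier (G n); \<And>n. t n (s (Suc n)) = s n\<rbrakk> \<Longrightarrow>
      \<exists>x\<in>carrier N. \<forall>n. u n x = s n"
  shows "N \<in> Cof \<U> S (\<infinity> :: enat) \<T>"
proof -
  define G' where "G' i = (case i of enat n \<Rightarrow> G n | \<infinity> \<Rightarrow> N)" for i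
  define t' where "t' i j = (case i of enat n \<Rightarrow> tower_map t (the_enat j) (n - the_enat j) | \<infinity> \<Rightarrow> u (the_enat j))"
    for i j
  have G'_simps [simp]: "G' (enat n) = G n" "G' \<infinity> = N" for n by (simp_all add: G'_def)
  have t'_simps [simp]: "t' (enat n) (enat m) = tower_map t m (n - m)" "t' \<infinity> (enat m) = u m" for n m
    by (simp_all add: t'_def)
  have tm: "tower_map t m k \<in> mod_hom S (G (m + k)) (G m)" for m k
    by (rule tower_map_hom[where t = t and G = G]) (rule t(1))
  have u_tower: "tower_map t m k (u (m + k) x) = u m x" if "x \<in> carrier N" for m k x
    using that by (induction k) (simp_all add: u(2))
  let ?\<Phi> = "\<lambda>x. \<lambda>j\<in>{..<\<infinity>}. t' \<infinity> j x" and ?L = "inverse_limit G' t' \<infinity>"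
  note L_simps = inverse_limit_def prod_module_def lessThan_infinity
  have hom: "t' i j \<in> mod_hom S (G' i) (G' j)" if ij: "j < i" for i j
  proof -
    obtain m where m: "j = enat m" using ij by (metis less_infinityE order_less_le_trans enat_ord_code(3))
    show ?thesis
    proof (cases i)
      case (enat n)
      then show ?thesis using ij m tm[of m "n - m"] by simp
    next
      case infinity
      then show ?thesis using m u(1) by simp
    qed
  qed
  have comp: "t' j k (t' i j x) = t' i k x" if ij: "j < i" and jk: "k < j" and x: "x \<in> carrier (G' i)" for i j k x
  proof -
    obtain m where m: "j = enat m" using ij by (metis less_infinityE order_less_le_trans enat_ord_code(3))
    obtain l where l: "k = enat l" using jk by (metis less_infinityE order_less_le_trans enat_ord_code(3))
    have lm: "l < m" using jk m l by simp
    show ?thesis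
    proof (cases i)
      case (enat n)
      then have mn: "m < n" using ij m by simp
      show ?thesis using enat m l lm mn tower_map_add[of t l "m - l" "n - m" x] by simp
    next
      case infinity
      then show ?thesis using m l lm x u_tower[of x l "m - l"] by simp
    qed
  qed
  have \<Phi>: "?\<Phi> \<in> mod_hom S N ?L"
  proof (rule mod_homI)
    fix x assume x: "x \<in> carrier N"
    then have "\<forall>j<\<infinity>. \<forall>k<j. t' j k (t' \<infinity> j x) = t' \<infinity> k x" using comp[of _ \<infinity>] by simp
    then show "?\<Phi> x \<in> carrier ?L"
      using x mod_hom_closed[OF u(1) x] by (auto simp: L_simps elim!: less_enatE)
  qed (auto simp: L_simps fun_eq_iff mod_hom_add[OF u(1)] mod_hom_smult[OF u(1)])
  have inj_\<Phi>: "inj_on ?\<Phi> (carrier N)"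
  proof (rule inj_onI)
    fix x y assume xy: "x \<in> carrier N" "y \<in> carrier N" and eq: "?\<Phi> x = ?\<Phi> y"
    interpret N: left_module S N by (rule left_modulesD(1)[OF N])
    have un: "u n x = u n y" for n using fun_cong[OF eq, of "enat n"] by simp
    have "u n (x \<ominus>\<^bsub>N\<^esub> y) = \<zero>\<^bsub>G n\<^esub>" for n
    proof -
      interpret G: left_module S "G n" by (rule left_modulesD(1)[OF G])
      show ?thesis
        using xy un mod_hom_closed[OF u(1)]
        by (simp add: mod_hom_diff[OF N.left_module_axioms G.left_module_axioms u(1)] G.diff_eq_zero_iff)
    qed
    then show "x = y" using inj[of "x \<ominus>\<^bsub>N\<^esub> y"] xy by (simp add: N.diff_eq_zero_iff)
  qed
  have "carrier ?L \<subseteq> ?\<Phi> ` carrier N"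
  proof
    fix s assume s: "s \<in> carrier ?L"
    have "s (enat n) \<in> carrier (G n)" for n
      using s PiE_mem[of s "range enat" "\<lambda>i. carrier (G' i)" "enat n"] by (simp add: L_simps)
    moreover have "t n (s (enat (Suc n))) = s (enat n)" for n
    proof -
      have "t' (enat (Suc n)) (enat n) (s (enat (Suc n))) = s (enat n)"
        using s by (auto simp: inverse_limit_def simp del: t'_simps)
      then show ?thesis by simp
    qed
    ultimately obtain x where x: "x \<in> carrier N" "\<forall>n. u n x = s (enat n)"
      using limit[of "\<lambda>n. s (enat n)"] by blast
    have "?\<Phi> x = s"
      using s x(2) by (auto simp: L_simps fun_eq_iff PiE_iff extensional_def)
    then show "s \<in> ?\<Phi> ` carrier N" using x(1) by blast
  qed
  moreover have "?\<Phi> ` carrier N \<subseteq> carrier ?L" using mod_hom_closed[OF \<Phi>] by blast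
  ultimately have iso: "?\<Phi> \<in> mod_iso S N ?L"
    using mod_isoI[OF \<Phi> inj_\<Phi>] by blast
  have "cofiltration \<U> S \<infinity> N G' t'"
    unfolding cofiltration_def
  proof (intro conjI allI impI ballI)
    show "G' i \<in> left_modules \<U> S" for i using N G by (cases i) simp_all
    show "t' i j \<in> mod_hom S (G' i) (G' j)" if "j < i" for i j using hom[OF that] .
    show "t' j k (t' i j x) = t' i k x" if "j < i" "k < j" "x \<in> carrier (G' i)" for i j k x
      using comp[OF that] .
    show "carrier (G' i) = {\<zero>\<^bsub>G' i\<^esub>}" if "ord_zero i" for i
      using that zero by (simp add: ord_zero_enat zero_enat_def)
    show "(\<lambda>x. \<lambda>j\<in>{..<i}. t' i j x) \<in> mod_iso S (G' i) (inverse_limit G' t' i)" if "ord_limit i" for i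
      using that iso by (simp add: ord_limit_enat)
    show "t' j i ` carrier (G' j) = carrier (G' i)" if ij: "ord_succ i j" for i j
    proof -
      obtain n where "i = enat n" "j = enat (Suc n)" using ij unfolding ord_succ_enat by blast
      then show ?thesis using t(2)[of n] by (simp add: tower_map_1)
    qed
  qed simp
  moreover have "iso_to_member S (kernel_module (G' j) (G' i) (t' j i)) \<T>" if ij: "ord_succ i j" for i j
  proof -
    obtain n where "i = enat n" "j = enat (Suc n)" using ij unfolding ord_succ_enat by blast
    then show ?thesis using ker[of n] by (simp add: tower_map_1)
  qed
  ultimately show ?thesis unfolding Cof_def using N by blast
qed

text \<open>
  Dual Eklof lemma for countable cofiltrations. Extensions \<open>P \<rightarrow> G\<^sub>n\<close> of the components of a map
  \<open>K \<rightarrow> N\<close> are built one after the other: lift the last one along \<open>G\<^sub>n\<^sub>+\<^sub>1 \<rightarrow> G\<^sub>n\<close> by projectivity of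
  \<open>P\<close>, and correct the lift on \<open>K\<close> by a map into the kernel, which extends to \<open>P\<close>.
\<close>

lemma ext1_Cof:
  assumes X: "X \<in> left_modules \<U> S" and N: "N \<in> Cof \<U> S (\<infinity> :: enat) \<T>"
    and ext: "\<And>T. T \<in> \<T> \<Longrightarrow> ext1_vanishes \<U> S X T"
  shows "ext1_vanishes \<U> S X N"
proof -
  obtain G t where cof: "cofiltration \<U> S (\<infinity> :: enat) N G t"
    and kers: "\<And>i j. ord_succ i j \<Longrightarrow> iso_to_member S (kernel_module (G j) (G i) (t j i)) \<T>"
    using N unfolding Cof_def by auto
  have NM: "N \<in> left_modules \<U> S" using N by (simp add: Cof_def)
  let ?G = "\<lambda>n. G (enat n)" and ?t = "\<lambda>n. t (enat (Suc n)) (enat n)" and ?u = "\<lambda>n. t \<infinity> (enat n)"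
  have succ: "ord_succ (enat n) (enat (Suc n))" for n by (simp add: ord_succ_enat)
  have GM: "?G n \<in> left_modules \<U> S" for n using cof by (simp add: cofiltration_def)
  note G' = left_modulesD(1)[OF GM]
  have GN: "G \<infinity> = N" using cof by (simp add: cofiltration_def)
  have t: "?t n \<in> mod_hom S (?G (Suc n)) (?G n)" "?t n ` carrier (?G (Suc n)) = carrier (?G n)" for n
    using cof succ by (auto simp: cofiltration_def)
  have u: "?u n \<in> mod_hom S N (?G n)" "x \<in> carrier N \<Longrightarrow> ?t n (?u (Suc n) x) = ?u n x" for n x
    using cof by (auto simp: cofiltration_def)
  have zero: "carrier (?G 0) = {\<zero>\<^bsub>?G 0\<^esub>}"
    using cof by (auto simp: cofiltration_def ord_zero_enat zero_enat_def)
  let ?\<Phi> = "\<lambda>x. \<lambda>j\<in>{..<\<infinity>}. t \<infinity> j x" and ?L = "inverse_limit G t \<infinity>"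
  have \<Phi>: "?\<Phi> \<in> mod_iso S N ?L"
    using cof GN by (auto simp: cofiltration_def ord_limit_enat)
  have ext_ker: "ext1_vanishes \<U> S X (kernel_module (?G (Suc n)) (?G n) (?t n))" for n
  proof -
    obtain T h where "T \<in> \<T>" and h: "h \<in> mod_iso S (kernel_module (?G (Suc n)) (?G n) (?t n)) T"
      using kers[OF succ] by (rule iso_to_memberE)
    then show ?thesis
      by (intro ext1_iso_right[OF ext _ h] left_module_kernel G' t)
  qed
  obtain P e where P: "projective_module \<U> S P" and e: "e \<in> mod_hom S P X" "e ` carrier P = carrier X"
    using enough_projectives[OF X] by metis
  note PM = projective_left_module[OF P]
  note P' = left_modulesD[OF PM] and X' = left_modulesD(1)[OF X] and N' = left_modulesD(1)[OF NM]
  interpret P: left_module S P by (rule P')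
  let ?K = "kernel_module P X e"
  show ?thesis
  proof (rule ext1_vanishesI_projective[OF P X N' e])
    fix f assume f: "f \<in> mod_hom S ?K N"
    have Ksub: "submod S P (mod_kernel P X e)" by (rule submod_kernel[OF P'(1) X' e(1)])
    have fc: "f x \<in> carrier N" "x \<in> carrier P" if "x \<in> mod_kernel P X e" for x
      using that mod_hom_closed[OF f] Ksub by (auto simp: submod_def)
    have uf: "(\<lambda>x. ?u n (f x)) \<in> mod_hom S ?K (?G n)" for n by (rule mod_hom_comp[OF f u(1)])
    let ?good = "\<lambda>n g. g \<in> mod_hom S P (?G n) \<and> (\<forall>x\<in>mod_kernel P X e. g x = ?u n (f x))"
    have "\<exists>g. \<forall>n. ?good n (g n) \<and> (\<forall>x\<in>carrier P. ?t n (g (Suc n) x) = g n x)"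
    proof (rule dependent_nat_choice)
      have "?good 0 (\<lambda>x. \<zero>\<^bsub>?G 0\<^esub>)"
        using mod_hom_const_zero[OF G'] mod_hom_closed[OF uf[of 0]] zero by auto
      then show "\<exists>g. ?good 0 g" by (intro exI[of _ "\<lambda>x. \<zero>\<^bsub>?G 0\<^esub>"])
    next
      fix g n assume g: "?good n g"
      interpret Gn: left_module S "?G n" by (rule G')
      interpret GS: left_module S "?G (Suc n)" by (rule G')
      have "\<exists>g'\<in>mod_hom S P (?G (Suc n)). \<forall>x\<in>carrier P. ?t n (g' x) = g x"
        using P GM[of "Suc n"] GM[of n] t g unfolding projective_module_def by metis
      then obtain g' where g': "g' \<in> mod_hom S P (?G (Suc n))" "\<forall>x\<in>carrier P. ?t n (g' x) = g x" ..
      let ?J = "kernel_module (?G (Suc n)) (?G n) (?t n)"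
      let ?\<delta> = "\<lambda>x. ?u (Suc n) (f x) \<ominus>\<^bsub>?G (Suc n)\<^esub> g' x"
      have "?\<delta> \<in> mod_hom S ?K (?G (Suc n))"
        by (rule mod_hom_minus_hom[OF G' uf mod_hom_restrict_domain[OF Ksub g'(1)]])
      moreover have "?t n (?\<delta> x) = \<zero>\<^bsub>?G n\<^esub>" "?\<delta> x \<in> carrier (?G (Suc n))" if x: "x \<in> mod_kernel P X e" for x
      proof -
        have c: "?u (Suc n) (f x) \<in> carrier (?G (Suc n))" "g' x \<in> carrier (?G (Suc n))" "g x \<in> carrier (?G n)"
          using mod_hom_closed[OF uf] mod_hom_closed[OF g'(1)] g fc[OF x] x mod_hom_closed[of g S P "?G n"] by simp_all
        then show "?\<delta> x \<in> carrier (?G (Suc n))" by simp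
        show "?t n (?\<delta> x) = \<zero>\<^bsub>?G n\<^esub>"
          unfolding mod_hom_diff[OF G' G' t(1) c(1,2)]
          using c g g'(2) fc[OF x] x u(2) by (simp add: Gn.diff_eq_zero_iff)
      qed
      ultimately have \<delta>: "?\<delta> \<in> mod_hom S ?K ?J"
        by (intro mod_hom_restrict_codomain image_subsetI) (simp_all add: mod_kernel_def)
      obtain h where h: "h \<in> mod_hom S P ?J" "\<And>x. x \<in> mod_kernel P X e \<Longrightarrow> h x = ?\<delta> x"
        using ext1_vanishesD[OF ext_ker P' X' e \<delta>] by metis
      have hG: "h \<in> mod_hom S P (?G (Suc n))"
        by (rule mod_hom_from_sub_codomain[OF h(1)]) (auto simp: mod_kernel_def)
      let ?g = "\<lambda>x. g' x \<oplus>\<^bsub>?G (Suc n)\<^esub> h x"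
      have "?g \<in> mod_hom S P (?G (Suc n))" by (rule mod_hom_plus[OF G' g'(1) hG])
      moreover have "?g x = ?u (Suc n) (f x)" if x: "x \<in> mod_kernel P X e" for x
        using h(2)[OF x] mod_hom_closed[OF uf, of x "Suc n"] mod_hom_closed[OF g'(1)] fc[OF x] x
        by (simp add: GS.add_diff_cancel)
      moreover have "?t n (?g x) = g x" if x: "x \<in> carrier P" for x
        unfolding mod_hom_add[OF t(1) mod_hom_closed[OF g'(1) x] mod_hom_closed[OF hG x]]
        using mod_hom_closed[OF h(1) x] g'(2) x g mod_hom_closed[of g S P "?G n" x]
        by (simp add: mod_kernel_def)
      ultimately show "\<exists>g'. ?good (Suc n) g' \<and> (\<forall>x\<in>carrier P. ?t n (g' x) = g x)"
        by (intro exI[of _ ?g]) simp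
    qed
    then obtain g where g: "\<And>n. g n \<in> mod_hom S P (?G n)"
      "\<And>n x. x \<in> mod_kernel P X e \<Longrightarrow> g n x = ?u n (f x)"
      "\<And>n x. x \<in> carrier P \<Longrightarrow> ?t n (g (Suc n) x) = g n x"
      by blast
    have comp: "t (enat m) (enat k) (g m x) = g k x" if x: "x \<in> carrier P" and km: "k < m" for x k m
      using km
    proof (induction m)
      case (Suc m)
      show ?case
      proof (cases "k = m")
        case True
        then show ?thesis using g(3)[OF x] by simp
      next
        case False
        then have "k < m" using Suc.prems by simp
        moreover have "t (enat m) (enat k) (t (enat (Suc m)) (enat m) (g (Suc m) x)) = t (enat (Suc m)) (enat k) (g (Suc m) x)"
          using cof mod_hom_closed[OF g(1) x] \<open>k < m\<close> by (simp add: cofiltration_def)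
        ultimately show ?thesis using Suc.IH g(3)[OF x] by simp
      qed
    qed simp
    note L_simps = inverse_limit_def prod_module_def lessThan_infinity
    let ?\<Gamma> = "\<lambda>x. \<lambda>j\<in>{..<\<infinity>}. g (the_enat j) x"
    have \<Gamma>: "?\<Gamma> \<in> mod_hom S P ?L"
      by (rule mod_homI)
        (auto simp: L_simps fun_eq_iff comp mod_hom_closed[OF g(1)] mod_hom_add[OF g(1)] mod_hom_smult[OF g(1)]
          P.smult_closed elim!: less_enatE)
    let ?h = "\<lambda>x. inv_into (carrier N) ?\<Phi> (?\<Gamma> x)"
    have "?h \<in> mod_hom S P N"
      using mod_hom_closed[OF \<Gamma>] mod_isoD(3)[OF \<Phi>]
      by (intro mod_hom_inv_into[OF N' mod_isoD(1)[OF \<Phi>] mod_isoD(2)[OF \<Phi>] \<Gamma>]) blast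
    moreover have "?h x = f x" if x: "x \<in> mod_kernel P X e" for x
    proof -
      have "?\<Gamma> x = ?\<Phi> (f x)" using g(2)[OF x] by (auto simp: fun_eq_iff lessThan_infinity)
      then show ?thesis using inv_into_f_f[OF mod_isoD(2)[OF \<Phi>] fc(1)[OF x]] by simp
    qed
    ultimately show "\<exists>g\<in>mod_hom S P N. \<forall>x\<in>mod_kernel P X e. g x = f x" by (intro bexI[of _ ?h] ballI)
  qed
qed

end

section \<open>Limits of towers\<close>

definition limit_module ::
  "(nat \<Rightarrow> ('s, 'm) module) \<Rightarrow> (nat \<Rightarrow> 'm \<Rightarrow> 'm) \<Rightarrow> ('s, nat \<Rightarrow> 'm) module" where
  "limit_module Q t = (prod_module UNIV Q)
     \<lparr>carrier := {z. (\<forall>n. z n \<in> carrier (Q n)) \<and> (\<forall>n. t n (z (Suc n)) = z n)}\<rparr>"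

lemma limit_module_simps:
  "carrier (limit_module Q t) = {z. (\<forall>n. z n \<in> carrier (Q n)) \<and> (\<forall>n. t n (z (Suc n)) = z n)}"
  "\<zero>\<^bsub>limit_module Q t\<^esub> = (\<lambda>n. \<zero>\<^bsub>Q n\<^esub>)"
  "z \<oplus>\<^bsub>limit_module Q t\<^esub> w = (\<lambda>n. z n \<oplus>\<^bsub>Q n\<^esub> w n)"
  "r \<odot>\<^bsub>limit_module Q t\<^esub> z = (\<lambda>n. r \<odot>\<^bsub>Q n\<^esub> z n)"
  by (simp_all add: limit_module_def prod_module_def restrict_UNIV)

lemma left_module_limit:
  assumes S: "ring S" and Q: "\<And>n. left_module S (Q n)" and t: "\<And>n. t n \<in> mod_hom S (Q (Suc n)) (Q n)"
  shows "left_module S (limit_module Q t)"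
  unfolding limit_module_def
proof (rule submod_left_module[OF left_module_prod[OF S Q]])
  have zero: "\<zero>\<^bsub>Q n\<^esub> \<in> carrier (Q n)" "t n \<zero>\<^bsub>Q (Suc n)\<^esub> = \<zero>\<^bsub>Q n\<^esub>" for n
    using abelian_groupE(2)[of "Q n"] Q[of n] mod_hom_zero[OF Q Q t] by (auto simp: left_module_def)
  have add: "x \<oplus>\<^bsub>Q n\<^esub> y \<in> carrier (Q n)" if "x \<in> carrier (Q n)" "y \<in> carrier (Q n)" for x y n
    using abelian_groupE(1)[of "Q n"] Q[of n] that by (auto simp: left_module_def)
  show "submod S (prod_module UNIV Q) {z. (\<forall>n. z n \<in> carrier (Q n)) \<and> (\<forall>n. t n (z (Suc n)) = z n)}"
    by (auto simp: submod_def prod_module_def zero add left_module.smult_closed[OF Q]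
        mod_hom_add[OF t] mod_hom_smult[OF t])
qed

lemma kernel_iso:
  assumes h: "h \<in> mod_iso S M M'" and M: "left_module S M" and N: "left_module S N"
    and q: "q \<in> mod_hom S M N"
    and eq: "\<And>x. x \<in> carrier M \<Longrightarrow> q' (h x) = \<zero>\<^bsub>N'\<^esub> \<longleftrightarrow> q x = \<zero>\<^bsub>N\<^esub>"
  shows "h \<in> mod_iso S (kernel_module M N q) (kernel_module M' N' q')"
proof (rule mod_isoI)
  have img: "h ` mod_kernel M N q = mod_kernel M' N' q'"
    unfolding mod_kernel_def mod_isoD(3)[OF h, symmetric] using eq by auto
  show "h \<in> mod_hom S (kernel_module M N q) (kernel_module M' N' q')"
    by (rule mod_hom_restrict_codomain[OF mod_hom_restrict_domain[OF submod_kernel[OF M N q] mod_isoD(1)[OF h]]])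
      (simp add: img)
  show "inj_on h (carrier (kernel_module M N q))"
    by (rule inj_on_subset[OF mod_isoD(2)[OF h]]) (auto simp: mod_kernel_def)
  show "h ` carrier (kernel_module M N q) = carrier (kernel_module M' N' q')" by (simp add: img)
qed

lemma iso_to_member_iso:
  assumes "h \<in> mod_iso S M N" "iso_to_member S N \<X>"
  shows "iso_to_member S M \<X>"
proof -
  obtain X k where "X \<in> \<X>" and k: "k \<in> mod_iso S N X" using assms(2) by (rule iso_to_memberE)
  then show ?thesis using mod_iso_comp[OF assms(1) k] by (auto simp: iso_to_member_def)
qed

context module_category
begin

text \<open>
  Maps lift along \<open>M \<rightarrow> N\<close> with kernel \<open>L\<close> if \<open>Ext\<^sup>1(X, L) = 0\<close>: the pullback along \<open>u : X \<rightarrow> N\<close> splits.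
\<close>

lemma ext1_lift:
  assumes ext: "ext1_vanishes \<U> S X L"
    and L: "left_module S L" and M: "left_module S M" "small \<U> (carrier M)" and N: "left_module S N"
    and X: "left_module S X" "small \<U> (carrier X)"
    and ex: "short_exact S L M N i p" and u: "u \<in> mod_hom S X N"
  obtains v where "v \<in> mod_hom S X M" "\<And>x. x \<in> carrier X \<Longrightarrow> p (v x) = u x"
proof -
  have i: "i \<in> mod_hom S L M" "inj_on i (carrier L)" and p: "p \<in> mod_hom S M N" "p ` carrier M = carrier N"
    and ker: "i ` carrier L = mod_kernel M N p"
    using ex by (auto simp: short_exact_def)
  interpret M: left_module S M by (rule M)
  interpret N: left_module S N by (rule N)
  let ?Z = "pullback_module M X p u"
  have Z: "left_module S ?Z" by (rule left_module_pullback[OF M(1) X(1) N p(1) u])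
  have smallZ: "small \<U> (carrier ?Z)" by (rule small_pullback[OF M(2) X(2)])
  have surj: "snd ` carrier ?Z = carrier X" by (rule pullback_snd_surj[OF u p(2)])
  let ?J = "kernel_module ?Z X snd"
  have kerZ: "fst z \<in> i ` carrier L" if "z \<in> mod_kernel ?Z X snd" for z
    using that mod_hom_zero[OF X(1) N u] unfolding ker by (auto simp: mod_kernel_def)
  have "fst \<in> mod_hom S ?J M"
    by (rule mod_hom_restrict_domain[OF submod_kernel[OF Z X(1) pullback_snd] pullback_fst])
  then have j: "(\<lambda>z. inv_into (carrier L) i (fst z)) \<in> mod_hom S ?J L"
    using kerZ by (intro mod_hom_inv_into[OF L i]) auto
  obtain r where r: "r \<in> mod_hom S ?Z L"
    "\<And>z. z \<in> mod_kernel ?Z X snd \<Longrightarrow> r z = inv_into (carrier L) i (fst z)"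
    using ext1_vanishesD[OF ext Z smallZ X(1) pullback_snd surj j] by metis
  \<comment> \<open>Since \<open>r\<close> is a retraction onto the kernel of \<open>Z \<rightarrow> X\<close>, this map factors through \<open>X\<close>.\<close>
  let ?k = "\<lambda>z. fst z \<ominus>\<^bsub>M\<^esub> i (r z)"
  have k: "?k \<in> mod_hom S ?Z M"
    by (rule mod_hom_minus_hom[OF M(1) pullback_fst mod_hom_comp[OF r(1) i(1)]])
  have "?k z = \<zero>\<^bsub>M\<^esub>" if z: "z \<in> carrier ?Z" "snd z = \<zero>\<^bsub>X\<^esub>" for z
  proof -
    have zk: "z \<in> mod_kernel ?Z X snd" using z by (simp add: mod_kernel_def)
    have "i (r z) = fst z" unfolding r(2)[OF zk] by (rule f_inv_into_f[OF kerZ[OF zk]])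
    moreover have "fst z \<in> carrier M" using z by auto
    ultimately show ?thesis by (simp add: M.diff_eq_zero_iff)
  qed
  then obtain v where v: "v \<in> mod_hom S X M" "\<And>z. z \<in> carrier ?Z \<Longrightarrow> v (snd z) = ?k z"
    using factor_through_surjection[OF Z X(1) M(1) pullback_snd surj k] by metis
  have "p (v x) = u x" if x: "x \<in> carrier X" for x
  proof -
    have "x \<in> snd ` carrier ?Z" using x surj by simp
    then obtain z where z: "z \<in> carrier ?Z" "x = snd z" by blast
    have ri: "i (r z) \<in> mod_kernel M N p" using mod_hom_closed[OF r(1) z(1)] ker by blast
    then have c: "i (r z) \<in> carrier M" "p (i (r z)) = \<zero>\<^bsub>N\<^esub>" by (simp_all add: mod_kernel_def)
    have "fst z \<in> carrier M" "p (fst z) = u x" using z by auto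
    then show ?thesis
      using c v(2)[OF z(1)] z(2) mod_hom_closed[OF p(1), of "fst z"]
      by (simp add: mod_hom_diff[OF M(1) N p(1)] a_minus_def[of N])
  qed
  then show thesis by (rule that[OF v(1)])
qed

lemma hereditary_kernel_iso_to_member:
  assumes her: "hereditary_cotorsion_pair \<U> S \<F> \<C>"
    and E: "left_module S E" "iso_to_member S E \<F>" and N: "left_module S N" "iso_to_member S N \<F>"
    and q: "q \<in> mod_hom S E N" "q ` carrier E = carrier N"
  shows "iso_to_member S (kernel_module E N q) \<F>"
proof -
  have cp: "cotorsion_pair \<U> S \<F> \<C>" using her by (simp add: hereditary_cotorsion_pair_def)
  obtain E' h where E': "E' \<in> \<F>" and h: "h \<in> mod_iso S E E'" using E(2) by (rule iso_to_memberE)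
  obtain N' k where N': "N' \<in> \<F>" and k: "k \<in> mod_iso S N N'" using N(2) by (rule iso_to_memberE)
  have N'M: "left_module S N'" using N' cotorsion_pairD(1)[OF cp] left_modulesD(1) by auto
  let ?g = "inv_into (carrier E) h"
  note g = mod_iso_inv_into[OF E(1) h]
  let ?q = "\<lambda>x. k (q (?g x))"
  have q': "?q \<in> mod_hom S E' N'"
    by (rule mod_hom_comp[OF mod_hom_comp[OF mod_isoD(1)[OF g] q(1)] mod_isoD(1)[OF k]])
  have "?q ` carrier E' = k ` (q ` (?g ` carrier E'))" by (simp add: image_image)
  then have "?q ` carrier E' = carrier N'" unfolding mod_isoD(3)[OF g] q(2) mod_isoD(3)[OF k] .
  then have "kernel_module E' N' ?q \<in> \<F>" by (rule hereditary_kernel[OF her E' N' q'])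
  moreover have "?q (h x) = \<zero>\<^bsub>N'\<^esub> \<longleftrightarrow> q x = \<zero>\<^bsub>N\<^esub>" if x: "x \<in> carrier E" for x
  proof -
    have "\<zero>\<^bsub>N\<^esub> \<in> carrier N" using abelian_groupE(2)[of N] N(1) by (simp add: left_module_def)
    then have "k (q x) = k \<zero>\<^bsub>N\<^esub> \<longleftrightarrow> q x = \<zero>\<^bsub>N\<^esub>"
      using mod_isoD(2)[OF k] mod_hom_closed[OF q(1) x] by (simp add: inj_on_eq_iff)
    then show ?thesis
      unfolding inv_into_f_f[OF mod_isoD(2)[OF h] x] mod_hom_zero[OF N(1) N'M mod_isoD(1)[OF k]] .
  qed
  then have "h \<in> mod_iso S (kernel_module E N q) (kernel_module E' N' ?q)"
    by (rule kernel_iso[OF h E(1) N(1) q(1)])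
  ultimately show ?thesis by (auto simp: iso_to_member_def)
qed

text \<open>
  The pullback of a tower \<open>\<dots> \<rightarrow> Q\<^sub>1 \<rightarrow> Q\<^sub>0\<close> along \<open>b : B \<rightarrow> Q\<^sub>0\<close> starts with a copy of \<open>B\<close> and has the
  same kernels as the given tower. With the zero module put in front, it is a cofiltration of the
  pullback of the limit, with \<open>B\<close> as the first subquotient.
\<close>

lemma pullback_of_tower_in_Cof:
  fixes Q :: "nat \<Rightarrow> ('s, 'u) module" and t z :: "nat \<Rightarrow> 'u \<Rightarrow> 'u"
  assumes Q: "\<And>n. Q n \<in> left_modules \<U> S"
    and t: "\<And>n. t n \<in> mod_hom S (Q (Suc n)) (Q n)" "\<And>n. t n ` carrier (Q (Suc n)) = carrier (Q n)"
    and ker: "\<And>n. iso_to_member S (kernel_module (Q (Suc n)) (Q n) (t n)) \<T>"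
    and N: "N \<in> left_modules \<U> S"
    and z: "\<And>n. z n \<in> mod_hom S N (Q n)" "\<And>n x. x \<in> carrier N \<Longrightarrow> t n (z (Suc n) x) = z n x"
    and inj: "\<And>x. \<lbrakk>x \<in> carrier N; \<And>n. z n x = \<zero>\<^bsub>Q n\<^esub>\<rbrakk> \<Longrightarrow> x = \<zero>\<^bsub>N\<^esub>"
    and limit: "\<And>s. \<lbrakk>\<And>n. s n \<in> carrier (Q n); \<And>n. t n (s (Suc n)) = s n\<rbrakk> \<Longrightarrow>
      \<exists>x\<in>carrier N. \<forall>n. z n x = s n"
    and B: "B \<in> left_modules \<U> S" "iso_to_member S B \<T>" and b: "b \<in> mod_hom S B (Q 0)"
  obtains X k where "X \<in> Cof \<U> S (\<infinity> :: enat) \<T>" "k \<in> mod_iso S (pullback_module B N b (z 0)) X"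
proof -
  note Q' = left_modulesD[OF Q] and N' = left_modulesD[OF N] and B' = left_modulesD[OF B(1)]
  interpret B: left_module S B by (rule B')
  define \<rho> where "\<rho> n = tower_map t 0 n" for n
  have \<rho>: "\<rho> n \<in> mod_hom S (Q n) (Q 0)" for n
    using tower_map_hom[where t = t and G = Q and S = S and m = 0 and k = n, OF t(1)] by (simp add: \<rho>_def)
  have \<rho>_0: "\<rho> 0 x = x" and \<rho>_Suc: "\<rho> (Suc n) x = \<rho> n (t n x)" for n x by (simp_all add: \<rho>_def)
  have \<rho>_z: "\<rho> n (z n x) = z 0 x" if "x \<in> carrier N" for n x
    using that by (induction n) (simp_all add: \<rho>_0 \<rho>_Suc z(2))
  let ?P = "\<lambda>n. pullback_module B (Q n) b (\<rho> n)"
  have P: "left_module S (?P n)" for n by (rule left_module_pullback[OF B'(1) Q'(1) Q'(1) b \<rho>])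
  have "small \<U> (carrier (?P n))" for n by (rule small_pullback[OF B'(2) Q'(2)])
  then have "\<exists>H h h'. H \<in> left_modules \<U> S \<and> h \<in> mod_iso S (?P n) H \<and> h' \<in> mod_iso S H (?P n) \<and>
      (\<forall>x\<in>carrier (?P n). h' (h x) = x) \<and> (\<forall>x\<in>carrier H. h (h' x) = x)" for n
    using small_copy_exists[OF P] by metis
  then obtain H h h' where H: "\<And>n. H n \<in> left_modules \<U> S" and h: "\<And>n. h n \<in> mod_iso S (?P n) (H n)"
    and h': "\<And>n. h' n \<in> mod_iso S (H n) (?P n)" and h'h: "\<And>n x. x \<in> carrier (?P n) \<Longrightarrow> h' n (h n x) = x"
    and hh': "\<And>n x. x \<in> carrier (H n) \<Longrightarrow> h n (h' n x) = x"
    by metis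
  note H' = left_modulesD(1)[OF H]
  have h_zero: "h n x = \<zero>\<^bsub>H n\<^esub> \<longleftrightarrow> x = (\<zero>\<^bsub>B\<^esub>, \<zero>\<^bsub>Q n\<^esub>)" if "x \<in> carrier (?P n)" for n x
  proof -
    have "h n (\<zero>\<^bsub>B\<^esub>, \<zero>\<^bsub>Q n\<^esub>) = \<zero>\<^bsub>H n\<^esub>" "(\<zero>\<^bsub>B\<^esub>, \<zero>\<^bsub>Q n\<^esub>) \<in> carrier (?P n)"
      using mod_hom_zero[OF P H' mod_isoD(1)[OF h], of n] abelian_groupE(2)[of "?P n"] P[of n]
      by (simp_all add: left_module_def)
    then show ?thesis using inj_onD[OF mod_isoD(2)[OF h] _ that] by metis
  qed
  let ?\<tau> = "\<lambda>n x. (fst x, t n (snd x))"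
  have \<tau>: "?\<tau> n \<in> mod_hom S (?P (Suc n)) (?P n)" for n
    by (rule mod_homI) (auto simp: \<rho>_Suc mod_hom_closed[OF t(1)] mod_hom_add[OF t(1)] mod_hom_smult[OF t(1)])
  define T where "T n x = h n (?\<tau> n (h' (Suc n) x))" for n x
  have T: "T n \<in> mod_hom S (H (Suc n)) (H n)" for n
    unfolding T_def by (rule mod_hom_comp[OF mod_hom_comp[OF mod_isoD(1)[OF h'] \<tau>] mod_isoD(1)[OF h]])
  have Th: "T n (h (Suc n) x) = h n (?\<tau> n x)" if "x \<in> carrier (?P (Suc n))" for n x
    unfolding T_def h'h[OF that] ..
  have T_surj: "T n ` carrier (H (Suc n)) = carrier (H n)" for n
  proof
    show "T n ` carrier (H (Suc n)) \<subseteq> carrier (H n)" using mod_hom_closed[OF T] by blast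
    show "carrier (H n) \<subseteq> T n ` carrier (H (Suc n))"
    proof
      fix x assume x: "x \<in> carrier (H n)"
      obtain c y where cy: "h' n x = (c, y)" by (rule prod.exhaust)
      have c: "(c, y) \<in> carrier (?P n)" using mod_hom_closed[OF mod_isoD(1)[OF h'] x] cy by simp
      then have "y \<in> t n ` carrier (Q (Suc n))" using t(2) by simp
      then obtain y' where y': "y' \<in> carrier (Q (Suc n))" "y = t n y'" by blast
      have mem: "(c, y') \<in> carrier (?P (Suc n))" using c y' by (simp add: \<rho>_Suc)
      have "T n (h (Suc n) (c, y')) = x" using Th[OF mem] y' hh'[OF x] cy by simp
      then show "x \<in> T n ` carrier (H (Suc n))"
        using mod_hom_closed[OF mod_isoD(1)[OF h] mem] by (metis imageI)
    qed
  qed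
  have T_ker: "iso_to_member S (kernel_module (H (Suc n)) (H n) (T n)) \<T>" for n
  proof (rule iso_to_member_iso[OF _ ker[of n]])
    let ?K = "kernel_module (H (Suc n)) (H n) (T n)" and ?K' = "kernel_module (?P (Suc n)) (?P n) (?\<tau> n)"
    have h'0: "\<zero>\<^bsub>H n\<^esub> = h n \<zero>\<^bsub>?P n\<^esub>" using mod_hom_zero[OF P H' mod_isoD(1)[OF h]] ..
    have kiso: "h' (Suc n) \<in> mod_iso S ?K ?K'"
    proof (rule kernel_iso[OF h' H' H' T])
      fix x assume x: "x \<in> carrier (H (Suc n))"
      have "?\<tau> n (h' (Suc n) x) \<in> carrier (?P n)"
        by (rule mod_hom_closed[OF \<tau> mod_hom_closed[OF mod_isoD(1)[OF h'] x]])
      from h_zero[OF this] show "?\<tau> n (h' (Suc n) x) = \<zero>\<^bsub>?P n\<^esub> \<longleftrightarrow> T n x = \<zero>\<^bsub>H n\<^esub>"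
        by (simp add: T_def)
    qed
    have kerP: "mod_kernel (?P (Suc n)) (?P n) (?\<tau> n)
        = {(\<zero>\<^bsub>B\<^esub>, y) |y. y \<in> mod_kernel (Q (Suc n)) (Q n) (t n)}"
      using mod_hom_zero[OF B'(1) Q'(1) b] mod_hom_zero[OF Q'(1) Q'(1) \<rho>]
      by (auto simp: mod_kernel_def \<rho>_Suc)
    have "snd \<in> mod_iso S ?K' (kernel_module (Q (Suc n)) (Q n) (t n))"
    proof (rule mod_isoI)
      show "snd \<in> mod_hom S ?K' (kernel_module (Q (Suc n)) (Q n) (t n))"
        by (rule mod_hom_restrict_codomain[OF mod_hom_restrict_domain[OF
                submod_kernel[OF P P \<tau>] pullback_snd]]) (auto simp: kerP)
      show "inj_on snd (carrier ?K')" by (auto simp: kerP inj_on_def)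
      show "snd ` carrier ?K' = carrier (kernel_module (Q (Suc n)) (Q n) (t n))" by (force simp: kerP)
    qed
    from mod_iso_comp[OF kiso this]
    show "(\<lambda>x. snd (h' (Suc n) x)) \<in> mod_iso S ?K (kernel_module (Q (Suc n)) (Q n) (t n))" .
  qed
  \<comment> \<open>The stages are \<open>0\<close>, then the copies \<open>H n\<close> of the pullbacks, so the index is shifted by one.\<close>
  let ?Y = "pullback_module B N b (z 0)"
  have Y: "left_module S ?Y" by (rule left_module_pullback[OF B'(1) N'(1) Q'(1) b z(1)])
  have "small \<U> (carrier ?Y)" by (rule small_pullback[OF B'(2) N'(2)])
  then obtain X k k' where X: "X \<in> left_modules \<U> S" and k: "k \<in> mod_iso S ?Y X"
    and k': "k' \<in> mod_iso S X ?Y" and k'k: "\<And>y. y \<in> carrier ?Y \<Longrightarrow> k' (k y) = y"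
    using small_copy_exists[OF Y] by metis
  note X' = left_modulesD(1)[OF X]
  let ?Z = "B\<lparr>carrier := {\<zero>\<^bsub>B\<^esub>}\<rparr>"
  let ?G = "\<lambda>n. case n of 0 \<Rightarrow> ?Z | Suc m \<Rightarrow> H m"
  let ?T = "\<lambda>n. case n of 0 \<Rightarrow> \<lambda>x. \<zero>\<^bsub>B\<^esub> | Suc m \<Rightarrow> T m"
  let ?v = "\<lambda>n y. (fst y, z n (snd y))"
  let ?U = "\<lambda>n. case n of 0 \<Rightarrow> \<lambda>x. \<zero>\<^bsub>B\<^esub> | Suc m \<Rightarrow> \<lambda>x. h m (?v m (k' x))"
  have Z: "?Z \<in> left_modules \<U> S" by (rule zero_submodule[OF B(1)])
  have const: "(\<lambda>x. \<zero>\<^bsub>B\<^esub>) \<in> mod_hom S M ?Z" for M :: "('s, 'u) module"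
    using mod_hom_const_zero[OF left_modulesD(1)[OF Z]] by simp
  have v: "?v n \<in> mod_hom S ?Y (?P n)" for n
    by (rule mod_homI) (auto simp: \<rho>_z mod_hom_closed[OF z(1)] mod_hom_add[OF z(1)] mod_hom_smult[OF z(1)])
  have U: "(\<lambda>x. h m (?v m (k' x))) \<in> mod_hom S X (H m)" for m
    by (rule mod_hom_comp[OF mod_hom_comp[OF mod_isoD(1)[OF k'] v] mod_isoD(1)[OF h]])
  have "X \<in> Cof \<U> S (\<infinity> :: enat) \<T>"
  proof (rule Cof_omegaI[where G = ?G and t = ?T and u = ?U, OF X])
    show "?G n \<in> left_modules \<U> S" for n using Z H by (cases n) simp_all
    show "carrier (?G 0) = {\<zero>\<^bsub>?G 0\<^esub>}" by simp
    show "?T n \<in> mod_hom S (?G (Suc n)) (?G n)" for n using const T by (cases n) simp_all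
    show "?T n ` carrier (?G (Suc n)) = carrier (?G n)" for n
    proof (cases n)
      case 0
      have "carrier (H 0) \<noteq> {}"
        using abelian_groupE(2)[of "H 0"] H'[of 0] by (auto simp: left_module_def)
      then show ?thesis using 0 by (simp add: image_constant_conv)
    next
      case (Suc m)
      then show ?thesis using T_surj by simp
    qed
    show "iso_to_member S (kernel_module (?G (Suc n)) (?G n) (?T n)) \<T>" for n
    proof (cases n)
      case 0
      have "mod_kernel (H 0) ?Z (\<lambda>x. \<zero>\<^bsub>B\<^esub>) = carrier (H 0)" by (auto simp: mod_kernel_def)
      moreover have "fst \<in> mod_iso S (?P 0) B"
      proof (rule mod_isoI[OF pullback_fst])
        show "inj_on fst (carrier (?P 0))" by (auto simp: inj_on_def \<rho>_0)
        show "fst ` carrier (?P 0) = carrier B"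
          by (rule pullback_fst_surj[OF b]) (simp add: \<rho>_0)
      qed
      ultimately show ?thesis
        using 0 iso_to_member_iso[OF mod_iso_comp[OF h'[of 0]] B(2)] by simp
    next
      case (Suc m)
      then show ?thesis using T_ker by simp
    qed
    show "?U n \<in> mod_hom S X (?G n)" for n using const U by (cases n) simp_all
    show "?T n (?U (Suc n) x) = ?U n x" if x: "x \<in> carrier X" for n x
    proof (cases n)
      case (Suc m)
      have kx: "k' x \<in> carrier ?Y" by (rule mod_hom_closed[OF mod_isoD(1)[OF k'] x])
      then have "snd (k' x) \<in> carrier N" by auto
      then show ?thesis using Suc Th[OF mod_hom_closed[OF v kx]] z(2) by simp
    qed simp
    show "x = \<zero>\<^bsub>X\<^esub>" if x: "x \<in> carrier X" and zero: "\<And>n. ?U n x = \<zero>\<^bsub>?G n\<^esub>" for x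
    proof -
      have kx: "k' x \<in> carrier ?Y" by (rule mod_hom_closed[OF mod_isoD(1)[OF k'] x])
      then have snd: "snd (k' x) \<in> carrier N" by auto
      have "?v n (k' x) = (\<zero>\<^bsub>B\<^esub>, \<zero>\<^bsub>Q n\<^esub>)" for n
        using zero[of "Suc n"] h_zero[OF mod_hom_closed[OF v kx], of n] by simp
      then have "fst (k' x) = \<zero>\<^bsub>B\<^esub>" "snd (k' x) = \<zero>\<^bsub>N\<^esub>" using inj[OF snd] by simp_all
      then have "k' x = \<zero>\<^bsub>?Y\<^esub>" by (simp add: prod_eq_iff)
      also have "\<dots> = k' \<zero>\<^bsub>X\<^esub>" using mod_hom_zero[OF X' Y mod_isoD(1)[OF k']] ..
      finally show ?thesis
        using inj_onD[OF mod_isoD(2)[OF k'] _ x] abelian_groupE(2)[of X] X' by (simp add: left_module_def)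
    qed
    fix s assume s: "\<And>n. s n \<in> carrier (?G n)" and ts: "\<And>n. ?T n (s (Suc n)) = s n"
    have sH: "s (Suc n) \<in> carrier (H n)" for n using s[of "Suc n"] by simp
    define w where "w n = h' n (s (Suc n))" for n
    have w: "w n \<in> carrier (?P n)" and hw: "h n (w n) = s (Suc n)" for n
      using mod_hom_closed[OF mod_isoD(1)[OF h'] sH] hh'[OF sH] by (simp_all add: w_def)
    have \<tau>w: "?\<tau> n (w (Suc n)) = w n" for n
    proof -
      have "h n (?\<tau> n (w (Suc n))) = h n (w n)"
        using ts[of "Suc n"] Th[OF w[of "Suc n"]] hw by simp
      then show ?thesis by (rule inj_onD[OF mod_isoD(2)[OF h] _ mod_hom_closed[OF \<tau> w] w])
    qed
    have fst_w: "fst (w n) = fst (w 0)" for n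
    proof (induction n)
      case (Suc n)
      have "fst (w (Suc n)) = fst (w n)" using arg_cong[OF \<tau>w[of n], of fst] by simp
      then show ?case using Suc by simp
    qed simp
    have snd_w: "t n (snd (w (Suc n))) = snd (w n)" "snd (w n) \<in> carrier (Q n)" for n
      using arg_cong[OF \<tau>w[of n], of snd] w[of n] by auto
    obtain y where y: "y \<in> carrier N" "\<forall>n. z n y = snd (w n)"
      using limit[of "\<lambda>n. snd (w n)"] snd_w by blast
    have mem: "(fst (w 0), y) \<in> carrier ?Y" using w[of 0] y by (auto simp: \<rho>_0)
    have "?U n (k (fst (w 0), y)) = s n" for n
    proof (cases n)
      case 0
      then show ?thesis using s[of 0] by simp
    next
      case (Suc m)
      have "(fst (w 0), snd (w m)) = w m" using fst_w[of m] by (simp add: prod_eq_iff)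
      then show ?thesis using Suc k'k[OF mem] y(2) hw by simp
    qed
    then show "\<exists>x\<in>carrier X. \<forall>n. ?U n x = s n"
      using mod_hom_closed[OF mod_isoD(1)[OF k] mem] by blast
  qed
  then show thesis using k by (rule that)
qed

end

section \<open>Restriction and coinduction of modules\<close>

lemma restrict_scalars_simps [simp]:
  "carrier (restrict_scalars \<phi> M) = carrier M" "\<zero>\<^bsub>restrict_scalars \<phi> M\<^esub> = \<zero>\<^bsub>M\<^esub>"
  "x \<oplus>\<^bsub>restrict_scalars \<phi> M\<^esub> y = x \<oplus>\<^bsub>M\<^esub> y" "r \<odot>\<^bsub>restrict_scalars \<phi> M\<^esub> x = \<phi> r \<odot>\<^bsub>M\<^esub> x"
  "mod_kernel (restrict_scalars \<phi> M) (restrict_scalars \<phi> N) h = mod_kernel M N h"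
  "restrict_scalars \<phi> (M\<lparr>carrier := H\<rparr>) = (restrict_scalars \<phi> M)\<lparr>carrier := H\<rparr>"
  by (simp_all add: restrict_scalars_def mod_kernel_def)

lemma regular_module_simps [simp]:
  "carrier (regular_module A) = carrier A" "\<zero>\<^bsub>regular_module A\<^esub> = \<zero>\<^bsub>A\<^esub>"
  "x \<oplus>\<^bsub>regular_module A\<^esub> y = x \<oplus>\<^bsub>A\<^esub> y" "a \<odot>\<^bsub>regular_module A\<^esub> x = a \<otimes>\<^bsub>A\<^esub> x"
  by (simp_all add: regular_module_def)

lemma coinduced_simps:
  "carrier (coinduced R A \<phi> M) = mod_hom R (restrict_scalars \<phi> (regular_module A)) M \<inter> extensional (carrier A)"
  "\<zero>\<^bsub>coinduced R A \<phi> M\<^esub> = (\<lambda>x\<in>carrier A. \<zero>\<^bsub>M\<^esub>)"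
  "f \<oplus>\<^bsub>coinduced R A \<phi> M\<^esub> g = (\<lambda>x\<in>carrier A. f x \<oplus>\<^bsub>M\<^esub> g x)"
  "a \<odot>\<^bsub>coinduced R A \<phi> M\<^esub> f = (\<lambda>x\<in>carrier A. f (x \<otimes>\<^bsub>A\<^esub> a))"
  by (simp_all add: coinduced_def Let_def hom_group_def)

lemma coinduced_mem_iff:
  "f \<in> carrier (coinduced R A \<phi> M) \<longleftrightarrow> f \<in> extensional (carrier A) \<and> (\<forall>x\<in>carrier A. f x \<in> carrier M) \<and>
     (\<forall>x\<in>carrier A. \<forall>y\<in>carrier A. f (x \<oplus>\<^bsub>A\<^esub> y) = f x \<oplus>\<^bsub>M\<^esub> f y) \<and>
     (\<forall>r\<in>carrier R. \<forall>x\<in>carrier A. f (\<phi> r \<otimes>\<^bsub>A\<^esub> x) = r \<odot>\<^bsub>M\<^esub> f x)"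
  by (auto simp: coinduced_simps mod_hom_def)

lemma coinduced_ext:
  assumes "f \<in> carrier (coinduced R A \<phi> M)" "g \<in> carrier (coinduced R A \<phi> M)"
    and "\<And>x. x \<in> carrier A \<Longrightarrow> f x = g x"
  shows "f = g"
  using assms(1,2) by (intro extensionalityI[OF _ _ assms(3)]) (auto simp: coinduced_simps)

locale change_of_rings =
  R: module_category \<U> R + A: module_category \<U> A
  for \<U> :: "'u set set" and R :: "'r ring" and A :: "'a ring" +
  fixes \<phi> :: "'r \<Rightarrow> 'a"
  assumes ring_hom: "\<phi> \<in> ring_hom R A"
    and power_member: "T \<in> \<U> \<Longrightarrow> \<exists>V\<in>\<U>. (carrier A \<rightarrow>\<^sub>E T) \<lesssim> V"
begin

lemma scalar_hom:
  "r \<in> carrier R \<Longrightarrow> \<phi> r \<in> carrier A"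
  "\<lbrakk>r \<in> carrier R; s \<in> carrier R\<rbrakk> \<Longrightarrow> \<phi> (r \<oplus>\<^bsub>R\<^esub> s) = \<phi> r \<oplus>\<^bsub>A\<^esub> \<phi> s"
  "\<lbrakk>r \<in> carrier R; s \<in> carrier R\<rbrakk> \<Longrightarrow> \<phi> (r \<otimes>\<^bsub>R\<^esub> s) = \<phi> r \<otimes>\<^bsub>A\<^esub> \<phi> s"
  "\<phi> \<one>\<^bsub>R\<^esub> = \<one>\<^bsub>A\<^esub>"
  using ring_hom by (auto simp: ring_hom_def)

lemma left_module_restrict:
  assumes "left_module A M" shows "left_module R (restrict_scalars \<phi> M)"
proof -
  interpret M: left_module A M by fact
  show ?thesis
  proof (rule left_moduleI[OF R.scalars])
    show "\<exists>y\<in>carrier (restrict_scalars \<phi> M). y \<oplus>\<^bsub>restrict_scalars \<phi> M\<^esub> x = \<zero>\<^bsub>restrict_scalars \<phi> M\<^esub>"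
      if "x \<in> carrier (restrict_scalars \<phi> M)" for x
      using that by (intro bexI[of _ "\<ominus>\<^bsub>M\<^esub> x"]) (simp_all add: M.M.l_neg)
  qed (simp_all add: scalar_hom M.smult_closed M.smult_l_distr M.smult_r_distr M.smult_assoc
      M.smult_unital M.M.a_ac)
qed

lemma left_modules_restrict:
  "M \<in> left_modules \<U> A \<Longrightarrow> restrict_scalars \<phi> M \<in> left_modules \<U> R"
  by (simp add: left_modules_def left_module_restrict)

lemma mod_hom_restrict:
  "h \<in> mod_hom A M N \<Longrightarrow> h \<in> mod_hom R (restrict_scalars \<phi> M) (restrict_scalars \<phi> N)"
  by (rule mod_homI) (simp_all add: mod_hom_closed mod_hom_add mod_hom_smult scalar_hom)

lemma mod_iso_restrict:
  "h \<in> mod_iso A M N \<Longrightarrow> h \<in> mod_iso R (restrict_scalars \<phi> M) (restrict_scalars \<phi> N)"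
  using mod_hom_restrict[of h M N] by (simp add: mod_iso_def)

lemma left_module_coinduced:
  assumes "left_module R M" shows "left_module A (coinduced R A \<phi> M)"
proof -
  interpret M: left_module R M by fact
  interpret A: ring A by (rule A.scalars)
  show ?thesis
  proof (rule left_moduleI[OF A.scalars])
    show "\<exists>g\<in>carrier (coinduced R A \<phi> M). g \<oplus>\<^bsub>coinduced R A \<phi> M\<^esub> f = \<zero>\<^bsub>coinduced R A \<phi> M\<^esub>"
      if "f \<in> carrier (coinduced R A \<phi> M)" for f
      using that
      by (intro bexI[of _ "\<lambda>x\<in>carrier A. \<ominus>\<^bsub>M\<^esub> f x"])
        (auto simp: coinduced_mem_iff coinduced_simps(2,3) M.M.l_neg M.M.minus_add M.smult_minus_right scalar_hom)
  qed (auto simp: coinduced_mem_iff coinduced_simps(2-4) scalar_hom M.smult_r_distr M.smult_closed M.M.a_ac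
      A.l_distr A.r_distr A.m_assoc fun_eq_iff extensional_def)
qed

lemma small_coinduced:
  assumes "small \<U> (carrier M)" shows "small \<U> (carrier (coinduced R A \<phi> M))"
proof -
  obtain T V :: "'u set" where "carrier M \<lesssim> T" "V \<in> \<U>" "(carrier A \<rightarrow>\<^sub>E T) \<lesssim> V"
    using assms power_member unfolding small_def by blast
  moreover have "carrier (coinduced R A \<phi> M) \<subseteq> carrier A \<rightarrow>\<^sub>E carrier M"
    by (intro subsetI) (simp add: coinduced_mem_iff PiE_iff)
  moreover have "(carrier A \<rightarrow>\<^sub>E carrier M) \<lesssim> (carrier A \<rightarrow>\<^sub>E T)"
    by (rule lepoll_funcset_right) fact
  ultimately show ?thesis
    unfolding small_def using lepoll_trans subset_imp_lepoll by metis
qed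

lemma coinduced_hom:
  assumes K: "left_module A K" and M: "left_module R M" and f: "f \<in> mod_hom R (restrict_scalars \<phi> K) M"
  shows "(\<lambda>k. \<lambda>a\<in>carrier A. f (a \<odot>\<^bsub>K\<^esub> k)) \<in> mod_hom A K (coinduced R A \<phi> M)"
proof -
  interpret K: left_module A K by fact
  interpret M: left_module R M by fact
  interpret A: ring A by (rule A.scalars)
  have f': "f x \<in> carrier M" "f (x \<oplus>\<^bsub>K\<^esub> y) = f x \<oplus>\<^bsub>M\<^esub> f y" "f (\<phi> r \<odot>\<^bsub>K\<^esub> x) = r \<odot>\<^bsub>M\<^esub> f x"
    if "x \<in> carrier K" "y \<in> carrier K" "r \<in> carrier R" for x y r
    using mod_hom_closed[OF f] mod_hom_add[OF f] mod_hom_smult[OF f] that by simp_all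
  have zero: "\<zero>\<^bsub>R\<^esub> \<in> carrier R" by (rule M.R.zero_closed)
  show ?thesis
  proof (rule mod_homI)
    fix k assume k: "k \<in> carrier K"
    show "(\<lambda>a\<in>carrier A. f (a \<odot>\<^bsub>K\<^esub> k)) \<in> carrier (coinduced R A \<phi> M)"
      using k by (auto simp: coinduced_mem_iff f'(1)[OF _ _ zero] f'(2)[OF _ _ zero] f'(3)[OF _ K.M.zero_closed]
          K.smult_closed K.smult_l_distr K.smult_assoc scalar_hom)
  qed (auto simp: coinduced_simps fun_eq_iff f'(2)[OF _ _ zero] K.smult_closed K.smult_r_distr K.smult_assoc)
qed

lemma coinduced_eval:
  "(\<lambda>f. f \<one>\<^bsub>A\<^esub>) \<in> mod_hom R (restrict_scalars \<phi> (coinduced R A \<phi> M)) M"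
proof -
  interpret A: ring A by (rule A.scalars)
  show ?thesis
  proof (rule mod_homI)
    fix r f assume r: "r \<in> carrier R" and f: "f \<in> carrier (restrict_scalars \<phi> (coinduced R A \<phi> M))"
    have "f (\<phi> r \<otimes>\<^bsub>A\<^esub> \<one>\<^bsub>A\<^esub>) = r \<odot>\<^bsub>M\<^esub> f \<one>\<^bsub>A\<^esub>"
      using f r A.one_closed by (simp only: restrict_scalars_simps coinduced_mem_iff)
    then show "(r \<odot>\<^bsub>restrict_scalars \<phi> (coinduced R A \<phi> M)\<^esub> f) \<one>\<^bsub>A\<^esub> = r \<odot>\<^bsub>M\<^esub> f \<one>\<^bsub>A\<^esub>"
      using r by (simp add: coinduced_simps scalar_hom)
  qed (auto simp: coinduced_mem_iff coinduced_simps(3))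
qed

text \<open>
  Maps from an \<open>A\<close>-module \<open>K\<close> to the module coinduced from \<open>C\<close> are \<open>R\<close>-linear maps \<open>K \<rightarrow> C\<close>, by evaluation
  at \<open>1\<close>. So extending a map into the coinduced module means extending an \<open>R\<close>-linear map into \<open>C\<close>.
\<close>

lemma ext1_coinduced:
  assumes X: "left_module A X" and C: "left_module R C"
    and ext: "ext1_vanishes \<U> R (restrict_scalars \<phi> X) C"
  shows "ext1_vanishes \<U> A X (coinduced R A \<phi> C)"
  unfolding ext1_vanishes_def
proof (intro ballI impI)
  fix E p f assume E: "E \<in> left_modules \<U> A" and p: "p \<in> mod_hom A E X" "p ` carrier E = carrier X"
    and f: "f \<in> mod_hom A (kernel_module E X p) (coinduced R A \<phi> C)"
  note E' = A.left_modulesD[OF E]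
  interpret E: left_module A E by (rule E')
  interpret A: ring A by (rule A.scalars)
  let ?K = "kernel_module E X p"
  have f1: "(\<lambda>x. f x \<one>\<^bsub>A\<^esub>) \<in> mod_hom R (restrict_scalars \<phi> ?K) C"
    by (rule mod_hom_comp[OF mod_hom_restrict[OF f] coinduced_eval])
  have Keq: "restrict_scalars \<phi> ?K = kernel_module (restrict_scalars \<phi> E) (restrict_scalars \<phi> X) p"
    by simp
  have p': "p ` carrier (restrict_scalars \<phi> E) = carrier (restrict_scalars \<phi> X)"
    using p(2) by simp
  have smallE: "small \<U> (carrier (restrict_scalars \<phi> E))" using E'(2) by simp
  obtain g where g: "g \<in> mod_hom R (restrict_scalars \<phi> E) C"
    "\<And>x. x \<in> mod_kernel (restrict_scalars \<phi> E) (restrict_scalars \<phi> X) p \<Longrightarrow> g x = f x \<one>\<^bsub>A\<^esub>"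
    using R.ext1_vanishesD[OF ext left_module_restrict[OF E'(1)] smallE left_module_restrict[OF X]
        mod_hom_restrict[OF p(1)] p' f1[unfolded Keq]] by metis
  let ?g = "\<lambda>k. \<lambda>a\<in>carrier A. g (a \<odot>\<^bsub>E\<^esub> k)"
  have "?g \<in> mod_hom A E (coinduced R A \<phi> C)" by (rule coinduced_hom[OF E'(1) C g(1)])
  moreover have "?g x = f x" if x: "x \<in> mod_kernel E X p" for x
  proof (rule extensionalityI)
    have fx: "f x \<in> carrier (coinduced R A \<phi> C)" using mod_hom_closed[OF f] x by simp
    show "f x \<in> extensional (carrier A)" using fx by (simp add: coinduced_mem_iff)
    fix a assume a: "a \<in> carrier A"
    have ax: "a \<odot>\<^bsub>E\<^esub> x \<in> mod_kernel E X p"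
      using a x submod_kernel[OF E'(1) X p(1)] by (simp add: submod_def)
    have "f (a \<odot>\<^bsub>E\<^esub> x) = a \<odot>\<^bsub>coinduced R A \<phi> C\<^esub> f x"
      using mod_hom_smult[OF f a, of x] x by simp
    then have "f (a \<odot>\<^bsub>E\<^esub> x) \<one>\<^bsub>A\<^esub> = f x a" using a by (simp add: coinduced_simps)
    then show "?g x a = f x a" using g(2)[of "a \<odot>\<^bsub>E\<^esub> x"] ax a by simp
  qed simp
  ultimately show "\<exists>g\<in>mod_hom A E (coinduced R A \<phi> C). \<forall>x\<in>mod_kernel E X p. g x = f x"
    by (intro bexI[of _ ?g] ballI)
qed

lemma coinduced_map:
  assumes M: "left_module R M" and N: "left_module R N" and h: "h \<in> mod_hom R M N"
  shows "(\<lambda>f. \<lambda>a\<in>carrier A. h (f a)) \<in> mod_hom A (coinduced R A \<phi> M) (coinduced R A \<phi> N)"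
proof -
  interpret A: ring A by (rule A.scalars)
  show ?thesis
    by (rule mod_homI)
      (auto simp: coinduced_mem_iff coinduced_simps(3,4) fun_eq_iff scalar_hom
        mod_hom_closed[OF h] mod_hom_add[OF h] mod_hom_smult[OF h])
qed

section \<open>Towers of coinduced extensions\<close>

text \<open>
  Let \<open>0 \<rightarrow> C \<rightarrow> F \<rightarrow> Q \<rightarrow> 0\<close> be exact over \<open>R\<close>, for an \<open>A\<close>-module \<open>Q\<close>. The maps \<open>A \<rightarrow> F\<close> that lie over
  a map \<open>a \<mapsto> a q\<close> form an \<open>A\<close>-module \<open>Q'\<close>. It surjects onto \<open>Q\<close>, because these maps lift along
  \<open>F \<rightarrow> Q\<close> by \<open>Ext\<^sup>1(A, C) = 0\<close>, and the kernel is the module coinduced from \<open>C\<close>. Evaluation at \<open>1\<close>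
  factors this surjection through \<open>F\<close>, but only \<open>R\<close>-linearly.
\<close>

lemma tower_step:
  assumes C: "C \<in> left_modules \<U> R" and F: "F \<in> left_modules \<U> R" and Q: "Q \<in> left_modules \<U> A"
    and ex: "short_exact R C F (restrict_scalars \<phi> Q) i p"
    and ext: "ext1_vanishes \<U> R (restrict_scalars \<phi> (regular_module A)) C"
  obtains Q' e t where "Q' \<in> left_modules \<U> A" "e \<in> mod_hom R (restrict_scalars \<phi> Q') F"
    "t \<in> mod_hom A Q' Q" "t ` carrier Q' = carrier Q" "\<And>x. x \<in> carrier Q' \<Longrightarrow> p (e x) = t x"
    "iso_to_member A (kernel_module Q' Q t) {coinduced R A \<phi> C}"
proof -
  note C' = R.left_modulesD[OF C] and F' = R.left_modulesD[OF F] and Q' = A.left_modulesD[OF Q]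
  note RQ = left_module_restrict[OF Q'(1)]
  interpret Q: left_module A Q by (rule Q')
  interpret A: ring A by (rule A.scalars)
  have i: "i \<in> mod_hom R C F" "inj_on i (carrier C)"
    and p: "p \<in> mod_hom R F (restrict_scalars \<phi> Q)" "p ` carrier F = carrier (restrict_scalars \<phi> Q)"
    and ker: "i ` carrier C = mod_kernel F (restrict_scalars \<phi> Q) p"
    using ex by (auto simp: short_exact_def)
  let ?CF = "coinduced R A \<phi> F" and ?CC = "coinduced R A \<phi> C" and ?CQ = "coinduced R A \<phi> (restrict_scalars \<phi> Q)"
  let ?\<alpha> = "\<lambda>f. \<lambda>a\<in>carrier A. p (f a)" and ?\<beta> = "\<lambda>q. \<lambda>a\<in>carrier A. a \<odot>\<^bsub>Q\<^esub> q"
  have CF: "left_module A ?CF" and CC: "left_module A ?CC" and CQ: "left_module A ?CQ"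
    using left_module_coinduced C'(1) F'(1) RQ by auto
  have \<alpha>: "?\<alpha> \<in> mod_hom A ?CF ?CQ" by (rule coinduced_map[OF F'(1) RQ p(1)])
  have \<beta>: "?\<beta> \<in> mod_hom A Q ?CQ" by (rule coinduced_hom[OF Q'(1) RQ mod_hom_id])
  let ?P = "pullback_module ?CF Q ?\<alpha> ?\<beta>"
  have P: "left_module A ?P" by (rule left_module_pullback[OF CF Q'(1) CQ \<alpha> \<beta>])
  have smallP: "small \<U> (carrier ?P)" by (rule A.small_pullback[OF small_coinduced[OF F'(2)] Q'(2)])
  have mem: "p (f a) = a \<odot>\<^bsub>Q\<^esub> q" if "(f, q) \<in> carrier ?P" "a \<in> carrier A" for f q a
  proof -
    have "?\<alpha> f = ?\<beta> q" using that(1) by simp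
    from fun_cong[OF this, of a] show ?thesis using that(2) by simp
  qed
  have AR: "left_module R (restrict_scalars \<phi> (regular_module A))"
    by (rule left_module_restrict[OF left_module_regular[OF A.scalars]])
  have surj: "snd ` carrier ?P = carrier Q"
  proof
    show "carrier Q \<subseteq> snd ` carrier ?P"
    proof
      fix q assume q: "q \<in> carrier Q"
      have "(\<lambda>a. a \<odot>\<^bsub>Q\<^esub> q) \<in> mod_hom R (restrict_scalars \<phi> (regular_module A)) (restrict_scalars \<phi> Q)"
        using q by (intro mod_homI) (simp_all add: Q.smult_closed Q.smult_l_distr Q.smult_assoc scalar_hom)
      moreover have "small \<U> (carrier (restrict_scalars \<phi> (regular_module A)))"
        using A.small_scalars by simp
      ultimately obtain v where v: "v \<in> mod_hom R (restrict_scalars \<phi> (regular_module A)) F"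
        "\<And>a. a \<in> carrier (restrict_scalars \<phi> (regular_module A)) \<Longrightarrow> p (v a) = a \<odot>\<^bsub>Q\<^esub> q"
        using R.ext1_lift[OF ext C'(1) F' RQ AR _ ex] by metis
      let ?v = "\<lambda>a\<in>carrier A. v a"
      have "?v \<in> mod_hom R (restrict_scalars \<phi> (regular_module A)) F"
        by (rule mod_hom_cong[OF AR v(1)]) simp
      then have "?v \<in> carrier ?CF" by (simp add: coinduced_simps)
      moreover have "?\<alpha> ?v = ?\<beta> q" using v(2) by (simp add: fun_eq_iff)
      ultimately show "q \<in> snd ` carrier ?P" using q by (intro image_eqI[of _ _ "(?v, q)"]) simp_all
    qed
  qed auto
  obtain Q1 k where Q1: "Q1 \<in> left_modules \<U> A" and k: "k \<in> mod_iso A Q1 ?P"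
    by (rule A.small_copy_exists[OF P smallP]) (rule that)
  let ?t = "\<lambda>x. snd (k x)" and ?e = "\<lambda>x. fst (k x) \<one>\<^bsub>A\<^esub>"
  have t: "?t \<in> mod_hom A Q1 Q" by (rule mod_hom_comp[OF mod_isoD(1)[OF k] pullback_snd])
  have e: "?e \<in> mod_hom R (restrict_scalars \<phi> Q1) F"
    by (rule mod_hom_comp[OF mod_hom_restrict[OF mod_hom_comp[OF mod_isoD(1)[OF k] pullback_fst]] coinduced_eval])
  have t_surj: "?t ` carrier Q1 = carrier Q"
    using surj unfolding mod_isoD(3)[OF k, THEN arg_cong[of _ _ "image snd"], unfolded image_image] .
  have pe: "p (?e x) = ?t x" if x: "x \<in> carrier Q1" for x
  proof -
    have "(fst (k x), snd (k x)) \<in> carrier ?P"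
      unfolding prod.collapse by (rule mod_hom_closed[OF mod_isoD(1)[OF k] x])
    then have "p (?e x) = \<one>\<^bsub>A\<^esub> \<odot>\<^bsub>Q\<^esub> ?t x" by (rule mem[OF _ Q.R.one_closed])
    also have "\<dots> = ?t x" by (rule Q.smult_unital[OF mod_hom_closed[OF t x]])
    finally show ?thesis .
  qed
  \<comment> \<open>A map \<open>A \<rightarrow> F\<close> over \<open>0\<close> has its values in the kernel of \<open>p\<close>, that is, in the image of \<open>C\<close>.\<close>
  let ?j = "\<lambda>g. (\<lambda>a\<in>carrier A. i (g a), \<zero>\<^bsub>Q\<^esub>)"
  have i_map: "(\<lambda>g. \<lambda>a\<in>carrier A. i (g a)) \<in> mod_hom A ?CC ?CF" by (rule coinduced_map[OF C'(1) F'(1) i(1)])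
  have pi: "p (i c) = \<zero>\<^bsub>Q\<^esub>" if "c \<in> carrier C" for c
  proof -
    have "i c \<in> i ` carrier C" using that by (rule imageI)
    then show ?thesis unfolding ker by (simp add: mod_kernel_def)
  qed
  have j: "?j \<in> mod_iso A ?CC (kernel_module ?P Q snd)"
  proof (rule mod_isoI)
    show "?j \<in> mod_hom A ?CC (kernel_module ?P Q snd)"
    proof (rule mod_homI)
      fix g assume g: "g \<in> carrier ?CC"
      have "p (i (g a)) = \<zero>\<^bsub>Q\<^esub>" if "a \<in> carrier A" for a
        using g that by (intro pi) (simp add: coinduced_mem_iff)
      then show "?j g \<in> carrier (kernel_module ?P Q snd)"
        using mod_hom_closed[OF i_map g] by (simp add: mod_kernel_def fun_eq_iff)
    qed (use mod_hom_add[OF i_map] mod_hom_smult[OF i_map] in simp_all)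
    show "inj_on ?j (carrier ?CC)"
    proof (rule inj_onI)
      fix f g assume fg: "f \<in> carrier ?CC" "g \<in> carrier ?CC" and eq: "?j f = ?j g"
      show "f = g"
      proof (rule coinduced_ext[OF fg])
        fix a assume a: "a \<in> carrier A"
        have "i (f a) = i (g a)" using fun_cong[OF arg_cong[OF eq, of fst], of a] a by simp
        then show "f a = g a" using i(2) fg a by (auto simp: coinduced_mem_iff inj_on_eq_iff)
      qed
    qed
    show "?j ` carrier ?CC = carrier (kernel_module ?P Q snd)"
    proof
      show "?j ` carrier ?CC \<subseteq> carrier (kernel_module ?P Q snd)"
        using mod_hom_closed[OF \<open>?j \<in> mod_hom A ?CC (kernel_module ?P Q snd)\<close>] by blast
      show "carrier (kernel_module ?P Q snd) \<subseteq> ?j ` carrier ?CC"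
      proof
        fix z assume z: "z \<in> carrier (kernel_module ?P Q snd)"
        then obtain f where f: "z = (f, \<zero>\<^bsub>Q\<^esub>)" "(f, \<zero>\<^bsub>Q\<^esub>) \<in> carrier ?P"
          by (auto simp: mod_kernel_def)
        then have fF: "f \<in> carrier ?CF" by simp
        have fi: "f a \<in> i ` carrier C" if "a \<in> carrier A" for a
          unfolding ker using mem[OF f(2) that] fF that by (simp add: mod_kernel_def coinduced_mem_iff)
        let ?g = "\<lambda>a. inv_into (carrier C) i (f a)"
        have "?g \<in> mod_hom R (restrict_scalars \<phi> (regular_module A)) C"
          using fF fi by (intro mod_hom_inv_into[OF C'(1) i]) (auto simp: coinduced_simps)
        then have "(\<lambda>a\<in>carrier A. ?g a) \<in> mod_hom R (restrict_scalars \<phi> (regular_module A)) C"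
          by (rule mod_hom_cong[OF AR]) simp
        then have "(\<lambda>a\<in>carrier A. ?g a) \<in> carrier ?CC" by (simp add: coinduced_simps)
        moreover have "(\<lambda>a\<in>carrier A. i ((\<lambda>a\<in>carrier A. ?g a) a)) = f"
          using fF f_inv_into_f[OF fi] by (auto simp: coinduced_mem_iff fun_eq_iff extensional_def)
        ultimately show "z \<in> ?j ` carrier ?CC" using f(1) by (intro image_eqI) auto
      qed
    qed
  qed
  have "k \<in> mod_iso A (kernel_module Q1 Q ?t) (kernel_module ?P Q snd)"
    by (rule kernel_iso[OF k A.left_modulesD(1)[OF Q1] Q'(1) t]) simp
  from mod_iso_comp[OF this mod_iso_inv_into[OF CC j]]
  have "iso_to_member A (kernel_module Q1 Q ?t) {coinduced R A \<phi> C}" by (auto simp: iso_to_member_def)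
  with Q1 e t t_surj pe show thesis by (rule that)
qed

end

lemma prod_module_UNIV_simps:
  "carrier (prod_module UNIV F) = {x. \<forall>n. x n \<in> carrier (F n)}"
  "\<zero>\<^bsub>prod_module UNIV F\<^esub> = (\<lambda>n. \<zero>\<^bsub>F n\<^esub>)"
  "x \<oplus>\<^bsub>prod_module UNIV F\<^esub> y = (\<lambda>n. x n \<oplus>\<^bsub>F n\<^esub> y n)"
  "r \<odot>\<^bsub>prod_module UNIV F\<^esub> x = (\<lambda>n. r \<odot>\<^bsub>F n\<^esub> x n)"
  by (auto simp: prod_module_def restrict_UNIV PiE_iff)

text \<open>
  A tower \<open>Q\<^sub>n\<^sub>+\<^sub>1 \<rightarrow> Q\<^sub>n\<close> of surjections that factor as \<open>e\<^sub>n : Q\<^sub>n\<^sub>+\<^sub>1 \<rightarrow> F\<^sub>n\<close> followed by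
  \<open>p\<^sub>n : F\<^sub>n \<rightarrow> Q\<^sub>n\<close> has the same limit as the interleaved tower of the \<open>F\<^sub>n\<close>. This limit is the kernel of
  the difference of the identity and the shift on the product of the \<open>F\<^sub>n\<close>. The difference is onto, since
  an equation \<open>x\<^sub>n - e\<^sub>n (p\<^sub>n\<^sub>+\<^sub>1 x\<^sub>n\<^sub>+\<^sub>1) = y\<^sub>n\<close> only needs the images \<open>p\<^sub>n x\<^sub>n\<close>, which are found
  one after the other along the surjections \<open>Q\<^sub>n\<^sub>+\<^sub>1 \<rightarrow> Q\<^sub>n\<close>.
\<close>

lemma interleaved_limit:
  assumes S: "ring S" and F: "\<And>n. left_module S (F n)" and Q: "\<And>n. left_module S (Q n)"
    and p: "\<And>n. p n \<in> mod_hom S (F n) (Q n)" and e: "\<And>n. e n \<in> mod_hom S (Q (Suc n)) (F n)"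
    and t: "\<And>n. t n \<in> mod_hom S (Q (Suc n)) (Q n)" "\<And>n. t n ` carrier (Q (Suc n)) = carrier (Q n)"
    and pe: "\<And>n x. x \<in> carrier (Q (Suc n)) \<Longrightarrow> p n (e n x) = t n x"
  defines "\<sigma> \<equiv> \<lambda>x n. x n \<ominus>\<^bsub>F n\<^esub> e n (p (Suc n) (x (Suc n)))"
  shows "\<sigma> \<in> mod_hom S (prod_module UNIV F) (prod_module UNIV F)"
    and "\<sigma> ` carrier (prod_module UNIV F) = carrier (prod_module UNIV F)"
    and "(\<lambda>z n. e n (z (Suc n))) \<in> mod_iso S (limit_module Q t)
      (kernel_module (prod_module UNIV F) (prod_module UNIV F) \<sigma>)"
proof -
  let ?P = "prod_module UNIV F" and ?L = "limit_module Q t"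
  let ?E = "\<lambda>z n. e n (z (Suc n))"
  note P_simps = prod_module_UNIV_simps
  have diff: "x \<in> carrier (F n) \<Longrightarrow> y \<in> carrier (F n) \<Longrightarrow> x \<ominus>\<^bsub>F n\<^esub> y \<in> carrier (F n)"
    and diff_zero: "x \<in> carrier (F n) \<Longrightarrow> y \<in> carrier (F n) \<Longrightarrow> x \<ominus>\<^bsub>F n\<^esub> y = \<zero>\<^bsub>F n\<^esub> \<longleftrightarrow> x = y" for x y n
  proof -
    interpret F: left_module S "F n" by (rule F)
    show "x \<in> carrier (F n) \<Longrightarrow> y \<in> carrier (F n) \<Longrightarrow> x \<ominus>\<^bsub>F n\<^esub> y \<in> carrier (F n)" by simp
    show "x \<in> carrier (F n) \<Longrightarrow> y \<in> carrier (F n) \<Longrightarrow> x \<ominus>\<^bsub>F n\<^esub> y = \<zero>\<^bsub>F n\<^esub> \<longleftrightarrow> x = y"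
      by (rule F.diff_eq_zero_iff)
  qed
  have proj: "(\<lambda>x. x n) \<in> mod_hom S ?P (F n)" for n by (rule mod_homI) (simp_all add: P_simps)
  have comp: "(\<lambda>x. x n \<ominus>\<^bsub>F n\<^esub> e n (p (Suc n) (x (Suc n)))) \<in> mod_hom S ?P (F n)" for n
    by (rule mod_hom_minus_hom[OF F proj mod_hom_comp[OF mod_hom_comp[OF proj p] e]])
  show \<sigma>: "\<sigma> \<in> mod_hom S ?P ?P"
    unfolding \<sigma>_def
    by (rule mod_homI) (use mod_hom_closed[OF comp] mod_hom_add[OF comp] mod_hom_smult[OF comp] in \<open>simp_all add: P_simps\<close>)
  show "\<sigma> ` carrier ?P = carrier ?P"
  proof
    show "\<sigma> ` carrier ?P \<subseteq> carrier ?P" using mod_hom_closed[OF \<sigma>] by blast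
    show "carrier ?P \<subseteq> \<sigma> ` carrier ?P"
    proof
      fix y assume "y \<in> carrier ?P"
      then have y: "y n \<in> carrier (F n)" for n by (simp add: P_simps)
      have "\<exists>z. \<forall>n. z n \<in> carrier (Q n) \<and> t n (z (Suc n)) = z n \<ominus>\<^bsub>Q n\<^esub> p n (y n)"
      proof (rule dependent_nat_choice)
        show "\<exists>z. z \<in> carrier (Q 0)"
          using abelian_groupE(2)[of "Q 0"] Q[of 0] by (auto simp: left_module_def)
      next
        fix z n assume z: "z \<in> carrier (Q n)"
        interpret Q: left_module S "Q n" by (rule Q)
        have "z \<ominus>\<^bsub>Q n\<^esub> p n (y n) \<in> t n ` carrier (Q (Suc n))"
          unfolding t(2) using z mod_hom_closed[OF p y] by simp
        then show "\<exists>z'. z' \<in> carrier (Q (Suc n)) \<and> t n z' = z \<ominus>\<^bsub>Q n\<^esub> p n (y n)" by auto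
      qed
      then obtain z where z: "\<And>n. z n \<in> carrier (Q n)" "\<And>n. t n (z (Suc n)) = z n \<ominus>\<^bsub>Q n\<^esub> p n (y n)"
        by blast
      let ?x = "\<lambda>n. y n \<oplus>\<^bsub>F n\<^esub> e n (z (Suc n))"
      have ez: "e n (z (Suc n)) \<in> carrier (F n)" for n by (rule mod_hom_closed[OF e z(1)])
      have x: "?x n \<in> carrier (F n)" for n
      proof -
        interpret F: left_module S "F n" by (rule F)
        show ?thesis using y ez by simp
      qed
      have px: "p n (?x n) = z n" for n
      proof -
        interpret Q: left_module S "Q n" by (rule Q)
        show ?thesis
          unfolding mod_hom_add[OF p y ez] pe[OF z(1)] z(2)
          by (rule Q.add_diff_cancel(1)[OF z(1) mod_hom_closed[OF p y]])
      qed
      have "\<sigma> ?x n = y n" for n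
      proof -
        interpret F: left_module S "F n" by (rule F)
        show ?thesis
          unfolding \<sigma>_def px using y[of n] ez[of n] by (simp add: a_minus_def F.M.a_ac F.M.r_neg)
      qed
      then have "y = \<sigma> ?x" by (intro ext) simp
      moreover have "?x \<in> carrier ?P" using x by (simp add: P_simps)
      ultimately show "y \<in> \<sigma> ` carrier ?P" by (rule image_eqI)
    qed
  qed
  have ker: "x \<in> mod_kernel ?P ?P \<sigma> \<longleftrightarrow>
      (\<forall>n. x n \<in> carrier (F n)) \<and> (\<forall>n. x n = e n (p (Suc n) (x (Suc n))))" for x
  proof -
    have "\<sigma> x n = \<zero>\<^bsub>F n\<^esub> \<longleftrightarrow> x n = e n (p (Suc n) (x (Suc n)))" if "\<forall>n. x n \<in> carrier (F n)" for n
      unfolding \<sigma>_def using that mod_hom_closed[OF e mod_hom_closed[OF p]] by (intro diff_zero) auto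
    then show ?thesis by (auto simp: mod_kernel_def P_simps fun_eq_iff)
  qed
  have E_mem: "?E z \<in> mod_kernel ?P ?P \<sigma>" and pE: "\<And>n. p n (?E z n) = z n" if "z \<in> carrier ?L" for z
  proof -
    have z: "z n \<in> carrier (Q n)" "t n (z (Suc n)) = z n" for n
      using that by (simp_all add: limit_module_simps)
    show pE: "p n (?E z n) = z n" for n using pe[OF z(1)] z(2) by simp
    show "?E z \<in> mod_kernel ?P ?P \<sigma>"
      unfolding ker using mod_hom_closed[OF e z(1)] pE by simp
  qed
  show "?E \<in> mod_iso S ?L (kernel_module ?P ?P \<sigma>)"
  proof (rule mod_isoI)
    show "?E \<in> mod_hom S ?L (kernel_module ?P ?P \<sigma>)"
      by (rule mod_homI)
        (simp add: E_mem, simp_all add: limit_module_simps P_simps mod_hom_add[OF e] mod_hom_smult[OF e])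
    show "inj_on ?E (carrier ?L)"
    proof (rule inj_onI, rule ext)
      fix z w n assume zw: "z \<in> carrier ?L" "w \<in> carrier ?L" and eq: "?E z = ?E w"
      have "p n (?E z n) = p n (?E w n)" using fun_cong[OF eq, of n] by simp
      then show "z n = w n" unfolding pE[OF zw(1)] pE[OF zw(2)] .
    qed
    show "?E ` carrier ?L = carrier (kernel_module ?P ?P \<sigma>)"
    proof
      show "?E ` carrier ?L \<subseteq> carrier (kernel_module ?P ?P \<sigma>)" using E_mem by auto
      show "carrier (kernel_module ?P ?P \<sigma>) \<subseteq> ?E ` carrier ?L"
      proof
        fix x assume "x \<in> carrier (kernel_module ?P ?P \<sigma>)"
        then have "x \<in> mod_kernel ?P ?P \<sigma>" by simp
        note this[unfolded ker]
        then have x: "x n \<in> carrier (F n)" "e n (p (Suc n) (x (Suc n))) = x n" for n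
          by (blast, metis)
        let ?z = "\<lambda>n. p n (x n)"
        have pz: "?z n \<in> carrier (Q n)" for n by (rule mod_hom_closed[OF p x(1)])
        have "t n (?z (Suc n)) = ?z n" for n using pe[OF pz[of "Suc n"]] x(2) by simp
        then have "?z \<in> carrier ?L" using pz by (simp add: limit_module_simps)
        moreover have "x = ?E ?z" by (rule ext) (simp add: x(2))
        ultimately show "x \<in> ?E ` carrier ?L" by (intro image_eqI)
      qed
    qed
  qed
qed

section \<open>Approximation sequences\<close>

locale relative_cotorsion_pair = change_of_rings \<U> R A \<phi>
  for \<U> :: "'u set set" and R :: "'r ring" and A :: "'a ring" and \<phi> :: "'r \<Rightarrow> 'a" +
  fixes \<F> \<C> :: "('r, 'u) module set"
  assumes complete: "complete_cotorsion_pair \<U> R \<F> \<C>" and hereditary: "hereditary_cotorsion_pair \<U> R \<F> \<C>"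
    and regular_in_left_class: "iso_to_member R (restrict_scalars \<phi> (regular_module A)) \<F>"
    and countable_products: "closed_under_countable_products R \<F>"
begin

abbreviation left_class :: "('a, 'u) module set" where
  "left_class \<equiv> restricting_to \<U> A \<phi> \<F>"

abbreviation cofiltered :: "('a, 'u) module set" where
  "cofiltered \<equiv> Cof \<U> A (\<infinity> :: enat) (coinduced R A \<phi> ` \<C>)"

lemma cotorsion_pair: "cotorsion_pair \<U> R \<F> \<C>"
  using hereditary by (simp add: hereditary_cotorsion_pair_def)

lemmas orthogonality = R.cotorsion_pairD[OF cotorsion_pair]

text \<open>
  The limit of the tower that starts with \<open>M\<close>. The pullbacks along all maps \<open>B \<rightarrow> M\<close> are recorded because
  the two approximation sequences use different ones.
\<close>

lemma approximation_by_tower: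
  assumes M: "M \<in> left_modules \<U> A"
  obtains N q where "N \<in> left_class" "q \<in> mod_hom A N M" "q ` carrier N = carrier M"
    "\<And>B b. \<lbrakk>B \<in> left_modules \<U> A; iso_to_member A B (coinduced R A \<phi> ` \<C>); b \<in> mod_hom A B M\<rbrakk> \<Longrightarrow>
      \<exists>X\<in>cofiltered. \<exists>k. k \<in> mod_iso A (pullback_module B N b q) X"
proof -
  have AR: "left_module R (restrict_scalars \<phi> (regular_module A))"
    by (rule left_module_restrict[OF left_module_regular[OF A.scalars]])
  obtain A' a where A': "A' \<in> \<F>" and a: "a \<in> mod_iso R (restrict_scalars \<phi> (regular_module A)) A'"
    using regular_in_left_class by (rule iso_to_memberE)
  have A'M: "A' \<in> left_modules \<U> R" using A' orthogonality(1) by blast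
  have extA: "ext1_vanishes \<U> R (restrict_scalars \<phi> (regular_module A)) C" if "C \<in> \<C>" for C
  proof (rule R.ext1_iso_left[OF _ AR R.left_modulesD[OF A'M] a])
    show "ext1_vanishes \<U> R A' C" using A' that orthogonality(3) by blast
  qed
  let ?step = "\<lambda>Q F p Q' e t. F \<in> \<F> \<and> p \<in> mod_hom R F (restrict_scalars \<phi> Q) \<and>
    Q' \<in> left_modules \<U> A \<and> e \<in> mod_hom R (restrict_scalars \<phi> Q') F \<and> t \<in> mod_hom A Q' Q \<and>
    t ` carrier Q' = carrier Q \<and> (\<forall>x\<in>carrier Q'. p (e x) = t x) \<and>
    iso_to_member A (kernel_module Q' Q t) (coinduced R A \<phi> ` \<C>)"
  have "\<exists>F p Q' e t. ?step Q F p Q' e t" if Q: "Q \<in> left_modules \<U> A" for Q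
  proof -
    obtain C F i p where C: "C \<in> \<C>" and F: "F \<in> \<F>" and ex: "short_exact R C F (restrict_scalars \<phi> Q) i p"
      using complete left_modules_restrict[OF Q] unfolding complete_cotorsion_pair_def by blast
    have CM: "C \<in> left_modules \<U> R" and FM: "F \<in> left_modules \<U> R" using C F orthogonality(1,2) by auto
    have p: "p \<in> mod_hom R F (restrict_scalars \<phi> Q)" using ex by (simp add: short_exact_def)
    obtain Q' e t where s: "Q' \<in> left_modules \<U> A" "e \<in> mod_hom R (restrict_scalars \<phi> Q') F"
      "t \<in> mod_hom A Q' Q" "t ` carrier Q' = carrier Q" "\<And>x. x \<in> carrier Q' \<Longrightarrow> p (e x) = t x"
      "iso_to_member A (kernel_module Q' Q t) {coinduced R A \<phi> C}"
      using tower_step[OF CM FM Q ex extA[OF C]] by metis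
    have "iso_to_member A (kernel_module Q' Q t) (coinduced R A \<phi> ` \<C>)"
      using s(6) C by (auto simp: iso_to_member_def)
    then have "?step Q F p Q' e t" using F p s by simp
    then show ?thesis by (intro exI)
  qed
  then have "\<forall>Q. \<exists>F p Q' e t. Q \<in> left_modules \<U> A \<longrightarrow> ?step Q F p Q' e t" by simp
  then obtain Fc pc Qc ec tc where
    step: "\<And>Q. Q \<in> left_modules \<U> A \<Longrightarrow> ?step Q (Fc Q) (pc Q) (Qc Q) (ec Q) (tc Q)"
    by metis
  define Q where "Q n = (Qc ^^ n) M" for n
  define F where "F n = Fc (Q n)" for n
  define p where "p n = pc (Q n)" for n
  define e where "e n = ec (Q n)" for n
  define t where "t n = tc (Q n)" for n
  have Q0: "Q 0 = M" and QS: "Qc (Q n) = Q (Suc n)" for n by (simp_all add: Q_def)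
  have QM: "Q n \<in> left_modules \<U> A" for n
  proof (induction n)
    case (Suc n)
    then show ?case using step[of "Q n"] QS by simp
  qed (simp add: Q0 M)
  note tower = step[OF QM, unfolded QS, folded F_def p_def e_def t_def]
  have F: "F n \<in> \<F>" and p: "p n \<in> mod_hom R (F n) (restrict_scalars \<phi> (Q n))"
    and e: "e n \<in> mod_hom R (restrict_scalars \<phi> (Q (Suc n))) (F n)"
    and t: "t n \<in> mod_hom A (Q (Suc n)) (Q n)" "t n ` carrier (Q (Suc n)) = carrier (Q n)"
    and pe: "\<And>x. x \<in> carrier (Q (Suc n)) \<Longrightarrow> p n (e n x) = t n x"
    and ker: "iso_to_member A (kernel_module (Q (Suc n)) (Q n) (t n)) (coinduced R A \<phi> ` \<C>)" for n
    using tower[of n] by simp_all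
  note Q' = A.left_modulesD[OF QM]
  have FM: "left_module R (F n)" for n using F orthogonality(1) R.left_modulesD(1) by auto
  let ?L = "limit_module Q t"
  have L: "left_module A ?L" by (rule left_module_limit[where Q = Q and t = t, OF A.scalars Q'(1) t(1)])
  have "small \<U> (carrier ?L)"
    by (rule small_subset[OF A.small_sequences[where X = "\<lambda>n. carrier (Q n)"]])
      (auto simp: limit_module_simps Q'(2))
  then obtain N h k where N: "N \<in> left_modules \<U> A" and h: "h \<in> mod_iso A ?L N"
    and k: "k \<in> mod_iso A N ?L" and kh: "\<And>x. x \<in> carrier ?L \<Longrightarrow> k (h x) = x"
    by (rule A.small_copy_exists[OF L]) (rule that)
  note N' = A.left_modulesD(1)[OF N]
  let ?P = "prod_module UNIV F"
  let ?\<sigma> = "\<lambda>x n. x n \<ominus>\<^bsub>F n\<^esub> e n (p (Suc n) (x (Suc n)))"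
  let ?RQ = "\<lambda>n. restrict_scalars \<phi> (Q n)"
  have RL: "limit_module ?RQ t = restrict_scalars \<phi> ?L"
    by (simp add: limit_module_def prod_module_def restrict_scalars_def)
  have t': "t n \<in> mod_hom R (?RQ (Suc n)) (?RQ n)" "t n ` carrier (?RQ (Suc n)) = carrier (?RQ n)" for n
    using mod_hom_restrict[OF t(1)] t(2) by simp_all
  have pe': "p n (e n x) = t n x" if "x \<in> carrier (?RQ (Suc n))" for n x
    using pe that by simp
  note lim = interleaved_limit[where F = F and Q = ?RQ and p = p and e = e and t = t,
      OF R.scalars FM left_module_restrict[OF Q'(1)] p e t' pe']
  have P: "left_module R ?P" by (rule left_module_prod[OF R.scalars FM])
  have PF: "iso_to_member R ?P \<F>"
    using countable_products F unfolding closed_under_countable_products_def by blast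
  have "iso_to_member R (kernel_module ?P ?P ?\<sigma>) \<F>"
    by (rule R.hereditary_kernel_iso_to_member[OF hereditary P PF P PF lim(1,2)])
  moreover have "(\<lambda>z n. e n (z (Suc n))) \<in> mod_iso R (restrict_scalars \<phi> ?L) (kernel_module ?P ?P ?\<sigma>)"
    using lim(3) unfolding RL .
  ultimately have "iso_to_member R (restrict_scalars \<phi> ?L) \<F>"
    by (rule iso_to_member_iso[rotated])
  then have "iso_to_member R (restrict_scalars \<phi> N) \<F>"
    by (rule iso_to_member_iso[OF mod_iso_restrict[OF k]])
  then have "restrict_scalars \<phi> N \<in> \<F>"
    by (rule R.left_class_iso[OF cotorsion_pair left_modules_restrict[OF N]])
  then have N_mem: "N \<in> left_class" using N by (simp add: restricting_to_def)
  let ?z = "\<lambda>n x. k x n"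
  have kx: "k x \<in> carrier ?L" if "x \<in> carrier N" for x
    by (rule mod_hom_closed[OF mod_isoD(1)[OF k] that])
  have "(\<lambda>y. y n) \<in> mod_hom A ?L (Q n)" for n
    by (rule mod_homI) (simp_all add: limit_module_simps)
  then have z: "?z n \<in> mod_hom A N (Q n)" for n
    by (rule mod_hom_comp[OF mod_isoD(1)[OF k]])
  have tz: "t n (?z (Suc n) x) = ?z n x" if "x \<in> carrier N" for n x
    using kx[OF that] by (simp add: limit_module_simps)
  have limit: "\<exists>x\<in>carrier N. \<forall>n. ?z n x = s n" if "\<And>n. s n \<in> carrier (Q n)" "\<And>n. t n (s (Suc n)) = s n" for s
  proof -
    have s: "s \<in> carrier ?L" using that by (simp add: limit_module_simps)
    then have "k (h s) = s" by (rule kh)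
    then show ?thesis using mod_hom_closed[OF mod_isoD(1)[OF h] s] by (intro bexI[of _ "h s"]) simp_all
  qed
  have inj: "x = \<zero>\<^bsub>N\<^esub>" if x: "x \<in> carrier N" and zero: "\<And>n. ?z n x = \<zero>\<^bsub>Q n\<^esub>" for x
  proof -
    have "k x = \<zero>\<^bsub>?L\<^esub>" using zero by (simp add: limit_module_simps fun_eq_iff)
    also have "\<dots> = k \<zero>\<^bsub>N\<^esub>" using mod_hom_zero[OF N' L mod_isoD(1)[OF k]] ..
    finally show ?thesis
      using inj_onD[OF mod_isoD(2)[OF k] _ x] abelian_groupE(2)[of N] N' by (simp add: left_module_def)
  qed
  show thesis
  proof (rule that[OF N_mem])
    show "?z 0 \<in> mod_hom A N M" using z[of 0] by (simp add: Q0)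
    show "?z 0 ` carrier N = carrier M"
    proof
      show "?z 0 ` carrier N \<subseteq> carrier M" using mod_hom_closed[OF z[of 0]] by (auto simp: Q0)
      show "carrier M \<subseteq> ?z 0 ` carrier N"
      proof
        fix m assume m: "m \<in> carrier M"
        \<comment> \<open>The condition for \<open>n = 0\<close> makes the compatible sequence start with the given element.\<close>
        have "\<exists>s. \<forall>n. (s n \<in> carrier (Q n) \<and> (n = 0 \<longrightarrow> s n = m)) \<and> t n (s (Suc n)) = s n"
        proof (rule dependent_nat_choice)
          show "\<exists>x. x \<in> carrier (Q 0) \<and> (0 = 0 \<longrightarrow> x = m)" using m by (simp add: Q0)
        next
          fix x n assume "x \<in> carrier (Q n) \<and> (n = 0 \<longrightarrow> x = m)"
          then have "x \<in> t n ` carrier (Q (Suc n))" using t(2) by simp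
          then show "\<exists>y. (y \<in> carrier (Q (Suc n)) \<and> (Suc n = 0 \<longrightarrow> y = m)) \<and> t n y = x" by auto
        qed
        then obtain s where s: "\<And>n. s n \<in> carrier (Q n)" "s 0 = m" "\<And>n. t n (s (Suc n)) = s n" by blast
        obtain x where "x \<in> carrier N" "\<forall>n. ?z n x = s n" using limit[OF s(1,3)] by blast
        then show "m \<in> ?z 0 ` carrier N" using s(2) by (intro image_eqI[of _ _ x]) simp_all
      qed
    qed
    fix B b assume B: "B \<in> left_modules \<U> A" "iso_to_member A B (coinduced R A \<phi> ` \<C>)"
      and b: "b \<in> mod_hom A B M"
    have b': "b \<in> mod_hom A B (Q 0)" using b by (simp add: Q0)
    obtain X k' where "X \<in> cofiltered"
      "k' \<in> mod_iso A (pullback_module B N b (?z 0)) X"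
      using A.pullback_of_tower_in_Cof[where Q = Q and t = t and z = ?z,
          OF QM t ker N z tz inj limit B b'] by blast
    then show "\<exists>X\<in>cofiltered.
        \<exists>k. k \<in> mod_iso A (pullback_module B N b (?z 0)) X" by blast
  qed
qed

lemma coinduced_copy:
  assumes C: "C \<in> left_modules \<U> R"
  obtains B h k where "B \<in> left_modules \<U> A" "h \<in> mod_iso A (coinduced R A \<phi> C) B"
    "k \<in> mod_iso A B (coinduced R A \<phi> C)"
  by (rule A.small_copy_exists[OF left_module_coinduced[OF R.left_modulesD(1)[OF C]]
        small_coinduced[OF R.left_modulesD(2)[OF C]]]) (rule that)

text \<open>
  The kernel of \<open>N \<rightarrow> M\<close> is the pullback along \<open>0 \<rightarrow> M\<close>, and \<open>0\<close> is coinduced from the zero module, which is in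
  \<open>\<C>\<close>.
\<close>

lemma special_precover:
  assumes M: "M \<in> left_modules \<U> A"
  shows "\<exists>C\<in>cofiltered. \<exists>F\<in>left_class. \<exists>i p.
    short_exact A C F M i p"
proof -
  obtain N q where N: "N \<in> left_class" and q: "q \<in> mod_hom A N M" "q ` carrier N = carrier M"
    and Cof: "\<And>B b. \<lbrakk>B \<in> left_modules \<U> A; iso_to_member A B (coinduced R A \<phi> ` \<C>); b \<in> mod_hom A B M\<rbrakk> \<Longrightarrow>
      \<exists>X\<in>cofiltered. \<exists>k. k \<in> mod_iso A (pullback_module B N b q) X"
    using approximation_by_tower[OF M] by metis
  have NM: "N \<in> left_modules \<U> A" using N by (simp add: restricting_to_def)
  note N' = A.left_modulesD(1)[OF NM] and M' = A.left_modulesD(1)[OF M]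
  interpret M: left_module A M by (rule M')
  interpret N: left_module A N by (rule N')
  \<comment> \<open>The zero module, realised inside \<open>M\<close>.\<close>
  let ?O = "(restrict_scalars \<phi> M)\<lparr>carrier := {\<zero>\<^bsub>M\<^esub>}\<rparr>"
  have O: "?O \<in> left_modules \<U> R"
    using R.zero_submodule[OF left_modules_restrict[OF M]] by simp
  have "ext1_vanishes \<U> R X ?O" for X :: "('r, 'u) module"
    unfolding ext1_vanishes_def
  proof (intro ballI impI)
    fix E p f assume "f \<in> mod_hom R (kernel_module E X p) ?O"
    then have "\<zero>\<^bsub>M\<^esub> = f x" if "x \<in> mod_kernel E X p" for x using that mod_hom_closed by fastforce
    moreover have "(\<lambda>x. \<zero>\<^bsub>M\<^esub>) \<in> mod_hom R E ?O"
      using mod_hom_const_zero[OF R.left_modulesD(1)[OF O], of E] by simp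
    ultimately show "\<exists>g\<in>mod_hom R E ?O. \<forall>x\<in>mod_kernel E X p. g x = f x"
      by (intro bexI[of _ "\<lambda>x. \<zero>\<^bsub>M\<^esub>"] ballI)
  qed
  then have OC: "?O \<in> \<C>" using O orthogonality(4) by blast
  obtain B h g where B: "B \<in> left_modules \<U> A" and h: "h \<in> mod_iso A (coinduced R A \<phi> ?O) B"
    and g: "g \<in> mod_iso A B (coinduced R A \<phi> ?O)"
    using coinduced_copy[OF O] by metis
  note B' = A.left_modulesD(1)[OF B]
  interpret B: left_module A B by (rule B')
  have val: "f x = \<zero>\<^bsub>M\<^esub>" if "f \<in> carrier (coinduced R A \<phi> ?O)" "x \<in> carrier A" for f x
  proof -
    have "f x \<in> carrier ?O" using that unfolding coinduced_mem_iff by blast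
    then show ?thesis by simp
  qed
  have eq: "f = g" if "f \<in> carrier (coinduced R A \<phi> ?O)" "g \<in> carrier (coinduced R A \<phi> ?O)" for f g
    by (rule coinduced_ext[OF that]) (simp only: val[OF that(1)] val[OF that(2)])
  have B_zero: "x = \<zero>\<^bsub>B\<^esub>" if "x \<in> carrier B" for x
  proof -
    have "x \<in> h ` carrier (coinduced R A \<phi> ?O)" "\<zero>\<^bsub>B\<^esub> \<in> h ` carrier (coinduced R A \<phi> ?O)"
      unfolding mod_isoD(3)[OF h] using that by simp_all
    then show ?thesis using eq by (elim imageE) metis
  qed
  have Biso: "iso_to_member A B (coinduced R A \<phi> ` \<C>)"
    using g OC by (auto simp: iso_to_member_def)
  let ?b = "\<lambda>x. \<zero>\<^bsub>M\<^esub>"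
  have b: "?b \<in> mod_hom A B M" by (rule mod_hom_const_zero[OF M'])
  let ?P = "pullback_module B N ?b q"
  have P: "left_module A ?P" by (rule left_module_pullback[OF B' N' M' b q(1)])
  obtain X k where X: "X \<in> cofiltered" and k: "k \<in> mod_iso A ?P X"
    using Cof[OF B Biso b] by blast
  let ?l = "inv_into (carrier ?P) k"
  have l: "?l \<in> mod_iso A X ?P" by (rule mod_iso_inv_into[OF P k])
  have "short_exact A X N M (\<lambda>x. snd (?l x)) q"
    unfolding short_exact_def
  proof (intro conjI q)
    show "(\<lambda>x. snd (?l x)) \<in> mod_hom A X N" by (rule mod_hom_comp[OF mod_isoD(1)[OF l] pullback_snd])
    have "inj_on snd (carrier ?P)" using B_zero by (auto simp: inj_on_def)
    then show "inj_on (\<lambda>x. snd (?l x)) (carrier X)"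
      using comp_inj_on[OF mod_isoD(2)[OF l], of snd] mod_isoD(3)[OF l] by (simp add: o_def)
    have "snd ` carrier ?P = mod_kernel N M q"
    proof
      show "mod_kernel N M q \<subseteq> snd ` carrier ?P"
      proof
        fix x assume "x \<in> mod_kernel N M q"
        then show "x \<in> snd ` carrier ?P"
          by (intro image_eqI[of _ _ "(\<zero>\<^bsub>B\<^esub>, x)"]) (simp_all add: mod_kernel_def)
      qed
    qed (auto simp: mod_kernel_def)
    then show "(\<lambda>x. snd (?l x)) ` carrier X = mod_kernel N M q"
      using mod_isoD(3)[OF l, THEN arg_cong[of _ _ "image snd"], unfolded image_image] by simp
  qed
  then show ?thesis using X N by blast
qed

text \<open>
  The other approximation starts from an embedding of \<open>M\<close> into a module \<open>B\<close> coinduced from \<open>\<C>\<close>. Pulling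
  the approximation \<open>N\<close> of the cokernel back to \<open>B\<close> gives an extension of \<open>N\<close> by \<open>M\<close>.
\<close>

lemma special_preenvelope:
  assumes M: "M \<in> left_modules \<U> A"
  shows "\<exists>C\<in>cofiltered. \<exists>F\<in>left_class. \<exists>i p.
    short_exact A M C F i p"
proof -
  note M' = A.left_modulesD(1)[OF M]
  interpret M: left_module A M by (rule M')
  obtain C F' i' p' where C: "C \<in> \<C>" and "F' \<in> \<F>" and ex: "short_exact R (restrict_scalars \<phi> M) C F' i' p'"
    using complete left_modules_restrict[OF M] unfolding complete_cotorsion_pair_def by blast
  have i': "i' \<in> mod_hom R (restrict_scalars \<phi> M) C" "inj_on i' (carrier M)"
    using ex by (auto simp: short_exact_def)
  have CM: "C \<in> left_modules \<U> R" using C orthogonality(2) by blast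
  note C' = R.left_modulesD(1)[OF CM]
  obtain B h g where B: "B \<in> left_modules \<U> A" and h: "h \<in> mod_iso A (coinduced R A \<phi> C) B"
    and g: "g \<in> mod_iso A B (coinduced R A \<phi> C)"
    using coinduced_copy[OF CM] by metis
  note B' = A.left_modulesD(1)[OF B]
  have Biso: "iso_to_member A B (coinduced R A \<phi> ` \<C>)"
    using g C by (auto simp: iso_to_member_def)
  let ?c = "\<lambda>m. \<lambda>a\<in>carrier A. i' (a \<odot>\<^bsub>M\<^esub> m)"
  have c: "?c \<in> mod_hom A M (coinduced R A \<phi> C)" by (rule coinduced_hom[OF M' C' i'(1)])
  let ?j = "\<lambda>m. h (?c m)"
  have j: "?j \<in> mod_hom A M B" by (rule mod_hom_comp[OF c mod_isoD(1)[OF h]])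
  have j_inj: "inj_on ?j (carrier M)"
  proof (rule inj_onI)
    fix x y assume xy: "x \<in> carrier M" "y \<in> carrier M" and "?j x = ?j y"
    then have "?c x = ?c y"
      by (intro inj_onD[OF mod_isoD(2)[OF h]] mod_hom_closed[OF c])
    from fun_cong[OF this, of "\<one>\<^bsub>A\<^esub>"] have "i' x = i' y" using xy by (simp add: M.smult_unital)
    then show "x = y" using i'(2) xy by (simp add: inj_on_eq_iff)
  qed
  obtain L p where L: "left_module A L" "carrier L \<subseteq> carrier B" and p: "p \<in> mod_hom A B L"
    "p ` carrier B = carrier L" "mod_kernel B L p = ?j ` carrier M"
    using quotient_module[OF B' submod_image[OF M' B' j]] by metis
  have LM: "L \<in> left_modules \<U> A"
    using L B A.lepoll_member[OF _ subset_imp_lepoll] by (auto simp: left_modules_def)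
  obtain N q where N: "N \<in> left_class" and q: "q \<in> mod_hom A N L" "q ` carrier N = carrier L"
    and Cof: "\<And>B b. \<lbrakk>B \<in> left_modules \<U> A; iso_to_member A B (coinduced R A \<phi> ` \<C>); b \<in> mod_hom A B L\<rbrakk> \<Longrightarrow>
      \<exists>X\<in>cofiltered. \<exists>k. k \<in> mod_iso A (pullback_module B N b q) X"
    using approximation_by_tower[OF LM] by metis
  have NM: "N \<in> left_modules \<U> A" using N by (simp add: restricting_to_def)
  note N' = A.left_modulesD(1)[OF NM]
  interpret N: left_module A N by (rule N')
  let ?P = "pullback_module B N p q"
  have P: "left_module A ?P" by (rule left_module_pullback[OF B' N' L(1) p(1) q(1)])
  obtain X k where X: "X \<in> cofiltered" and k: "k \<in> mod_iso A ?P X"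
    using Cof[OF B Biso p(1)] by blast
  have X': "left_module A X" using X A.left_modulesD(1) by (simp add: Cof_def)
  let ?l = "inv_into (carrier ?P) k"
  have l: "?l \<in> mod_iso A X ?P" by (rule mod_iso_inv_into[OF P k])
  let ?m = "\<lambda>m. (?j m, \<zero>\<^bsub>N\<^esub>)"
  have q0: "q \<zero>\<^bsub>N\<^esub> = \<zero>\<^bsub>L\<^esub>" by (rule mod_hom_zero[OF N' L(1) q(1)])
  have ker: "{z \<in> carrier ?P. snd z = \<zero>\<^bsub>N\<^esub>} = ?m ` carrier M"
  proof -
    have "{z \<in> carrier ?P. snd z = \<zero>\<^bsub>N\<^esub>} = (\<lambda>x. (x, \<zero>\<^bsub>N\<^esub>)) ` mod_kernel B L p"
      by (auto simp: mod_kernel_def q0)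
    then show ?thesis unfolding p(3) image_image .
  qed
  have m: "?m \<in> mod_hom A M ?P"
  proof (rule mod_homI)
    fix x assume "x \<in> carrier M"
    then have "?m x \<in> {z \<in> carrier ?P. snd z = \<zero>\<^bsub>N\<^esub>}" unfolding ker by (rule imageI)
    then show "?m x \<in> carrier ?P" unfolding mem_Collect_eq by (rule conjunct1)
  qed (use mod_hom_add[OF j] mod_hom_smult[OF j] in simp_all)
  have lk: "?l (k x) = x" if "x \<in> carrier ?P" for x by (rule inv_into_f_f[OF mod_isoD(2)[OF k] that])
  have "short_exact A M X N (\<lambda>m. k (?m m)) (\<lambda>x. snd (?l x))"
    unfolding short_exact_def
  proof (intro conjI)
    show km: "(\<lambda>m. k (?m m)) \<in> mod_hom A M X" by (rule mod_hom_comp[OF m mod_isoD(1)[OF k]])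
    show "(\<lambda>x. snd (?l x)) \<in> mod_hom A X N" by (rule mod_hom_comp[OF mod_isoD(1)[OF l] pullback_snd])
    show "inj_on (\<lambda>m. k (?m m)) (carrier M)"
    proof (rule inj_onI)
      fix x y assume xy: "x \<in> carrier M" "y \<in> carrier M" and "k (?m x) = k (?m y)"
      then have "?m x = ?m y" by (intro inj_onD[OF mod_isoD(2)[OF k]] mod_hom_closed[OF m])
      then have "?j x = ?j y" by (rule Pair_inject)
      then show "x = y" by (rule inj_onD[OF j_inj _ xy])
    qed
    have "snd ` carrier ?P = carrier N" by (rule pullback_snd_surj[OF q(1) p(2)])
    then show "(\<lambda>x. snd (?l x)) ` carrier X = carrier N"
      using mod_isoD(3)[OF l, THEN arg_cong[of _ _ "image snd"], unfolded image_image] by simp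
    have "mod_kernel X N (\<lambda>x. snd (?l x)) = k ` {z \<in> carrier ?P. snd z = \<zero>\<^bsub>N\<^esub>}"
      unfolding mod_kernel_def mod_isoD(3)[OF k, symmetric] using lk by force
    then show "(\<lambda>m. k (?m m)) ` carrier M = mod_kernel X N (\<lambda>x. snd (?l x))"
      unfolding ker image_image by simp
  qed
  then show ?thesis using X N by blast
qed

end

lemma change_of_rings_universe:
  assumes "ring R" "ring A" "\<phi> \<in> ring_hom R A" and univ: "module_universe R A \<U>"
  shows "change_of_rings \<U> R A \<phi>"
proof -
  have sub: "\<And>T T'. \<lbrakk>T \<in> \<U>; T' \<lesssim> T\<rbrakk> \<Longrightarrow> T' \<in> \<U>" and small: "small \<U> (carrier R)" "small \<U> (carrier A)"
    and prod: "\<And>T. (\<And>n :: nat. T n \<in> \<U>) \<Longrightarrow> \<exists>V\<in>\<U>. (\<Pi>\<^sub>E n\<in>UNIV. T n) \<lesssim> V"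
    and power: "\<And>T. T \<in> \<U> \<Longrightarrow> \<exists>V\<in>\<U>. (carrier A \<rightarrow>\<^sub>E T) \<lesssim> V"
    using univ unfolding module_universe_def small_def by blast+
  have "module_category \<U> R" "module_category \<U> A"
    by (rule module_category.intro[OF assms(1) sub prod small(1)] module_category.intro[OF assms(2) sub prod small(2)];
        assumption?)+
  then show ?thesis
    using assms(3) power by (intro change_of_rings.intro change_of_rings_axioms.intro)
qed

theorem theorem2p23:
  fixes R :: "'r ring" and A :: "'a ring" and \<phi> :: "'r \<Rightarrow> 'a"
    and \<U> :: "'u set set" and \<F> \<C> :: "('r, 'u) module set"
  assumes "ring R" and "ring A" and "\<phi> \<in> ring_hom R A"
    and "module_universe R A \<U>"
    and "complete_cotorsion_pair \<U> R \<F> \<C>"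
    and "hereditary_cotorsion_pair \<U> R \<F> \<C>"
    and "iso_to_member R (restrict_scalars \<phi> (regular_module A)) \<F>"
    and "\<And>F. F \<in> \<F> \<Longrightarrow> iso_to_member R (restrict_scalars \<phi> (coinduced R A \<phi> F)) \<F>"
    and "closed_under_countable_products R \<F>"
  shows "complete_cotorsion_pair \<U> A
           (restricting_to \<U> A \<phi> \<F>)
           (direct_summands \<U> A (Cof \<U> A (\<infinity> :: enat) (coinduced R A \<phi> ` \<C>))) \<and>
         hereditary_cotorsion_pair \<U> A
           (restricting_to \<U> A \<phi> \<F>)
           (direct_summands \<U> A (Cof \<U> A (\<infinity> :: enat) (coinduced R A \<phi> ` \<C>)))"
proof -
  interpret relative_cotorsion_pair \<U> R A \<phi> \<F> \<C>
    by (rule relative_cotorsion_pair.intro[OF change_of_rings_universe[OF assms(1-4)]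
          relative_cotorsion_pair_axioms.intro[OF assms(5-7,9)]])
  let ?CA = "direct_summands \<U> A cofiltered"
  have complete_A: "complete_cotorsion_pair \<U> A left_class ?CA"
  proof (rule A.complete_cotorsion_pairI)
    show "left_class \<subseteq> left_modules \<U> A" by (auto simp: restricting_to_def)
    show "cofiltered \<subseteq> left_modules \<U> A" by (auto simp: Cof_def)
    show "ext1_vanishes \<U> A X Y" if X: "X \<in> left_class" and Y: "Y \<in> cofiltered" for X Y
    proof (rule A.ext1_Cof[OF _ Y])
      show XM: "X \<in> left_modules \<U> A" using X by (simp add: restricting_to_def)
      fix T assume "T \<in> coinduced R A \<phi> ` \<C>"
      then obtain C where C: "C \<in> \<C>" "T = coinduced R A \<phi> C" by blast
      have "C \<in> left_modules \<U> R" using C(1) orthogonality(2) by blast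
      moreover have "ext1_vanishes \<U> R (restrict_scalars \<phi> X) C"
        using X C(1) orthogonality(3) by (simp add: restricting_to_def)
      ultimately show "ext1_vanishes \<U> A X T"
        unfolding C(2) by (intro ext1_coinduced A.left_modulesD(1)[OF XM] R.left_modulesD(1))
    qed
    show "\<exists>C\<in>cofiltered. \<exists>F\<in>left_class. \<exists>i p. short_exact A C F M i p" if "M \<in> left_modules \<U> A" for M
      by (rule special_precover[OF that])
    show "\<exists>C\<in>cofiltered. \<exists>F\<in>left_class. \<exists>i p. short_exact A M C F i p" if "M \<in> left_modules \<U> A" for M
      by (rule special_preenvelope[OF that])
  next
    fix X X' s r
    assume X: "X \<in> left_modules \<U> A" and X': "X' \<in> left_class" and s: "s \<in> mod_hom A X X'"
      and r: "r \<in> mod_hom A X' X" and rs: "\<forall>x\<in>carrier X. r (s x) = x"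
    have "restrict_scalars \<phi> X' \<in> \<F>" using X' by (simp add: restricting_to_def)
    then have "restrict_scalars \<phi> X \<in> \<F>"
      by (rule R.left_class_retract[OF cotorsion_pair left_modules_restrict[OF X] _ mod_hom_restrict[OF s] mod_hom_restrict[OF r]])
        (simp add: rs)
    then show "X \<in> left_class" using X by (simp add: restricting_to_def)
  qed
  moreover have "hereditary_cotorsion_pair \<U> A left_class ?CA"
  proof (rule A.hereditary_cotorsion_pairI)
    show "cotorsion_pair \<U> A left_class ?CA" using complete_A by (simp add: complete_cotorsion_pair_def)
    fix E N q assume E: "E \<in> left_class" and N: "N \<in> left_class" and q: "q \<in> mod_hom A E N" "q ` carrier E = carrier N"
    have EM: "E \<in> left_modules \<U> A" "restrict_scalars \<phi> E \<in> \<F>"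
      and NM: "N \<in> left_modules \<U> A" "restrict_scalars \<phi> N \<in> \<F>"
      using E N by (auto simp: restricting_to_def)
    have "kernel_module (restrict_scalars \<phi> E) (restrict_scalars \<phi> N) q \<in> \<F>"
      by (rule R.hereditary_kernel[OF hereditary EM(2) NM(2) mod_hom_restrict[OF q(1)]]) (simp add: q(2))
    then show "kernel_module E N q \<in> left_class"
      using A.left_modules_kernel[OF EM(1) A.left_modulesD(1)[OF NM(1)] q(1)] by (simp add: restricting_to_def)
  qed
  ultimately show ?thesis ..
qed

end
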